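(* All categories of the form $\mathsf{ConSh}(\mathscr{C},j)$ for $\mathscr{C}\in\{\mathsf{Cart},\mathsf{Open},\mathsf{Man}\}$ and $j\in\{j_{\mathrm{open}},j_{\mathrm{good}}\}$ are equivalent.
   Context: $\mathsf{Man}$ is the category of finite dimensional smooth manifolds (Hausdorff, paracompact) and smooth maps; $\mathsf{Open}$ is the full subcategory of manifolds diffeomorphic to an open subset of some $\mathbb{R}^n$; $\mathsf{Cart}$ is the full subcategory of manifolds diffeomorphic to some $\mathbb{R}^n$, $n\ge0$ (cartesian spaces). A good open cover of a manifold is an open cover by cartesian spaces all of whose finite non-empty intersections are cartesian spaces. On each of these categories, $j_{\mathrm{open}}$ assigns to each object $M$ the set of all open covers $\{U_i\subseteq M\}$ with all $U_i$ in the category, and $j_{\mathrm{good}}$ assigns the set of all good open covers of $M$. For a presheaf $F:\mathscr{C}^{op}\to\mathsf{Set}$ and a family $r=\{r_i:U_i\to U\}$, a matching family is a collection $x_i\in F(U_i)$ with $F(f)(x_i)=F(g)(x_j)$ for all $f:V\to U_i$, $g:V\to U_j$ in $\mathscr{C}$ with $r_if=r_jg$; $F$ is a sheaf on $r$ if every matching family has a unique amalgamation $x\in F(U)$, i.e. $F(r_i)(x)=x_i$ for all $i$. $F$ is a sheaf on $(\mathscr{C},j)$ if it is a sheaf on every family in $j$. A sheaf $F$ is concrete if for every object $U$ the map $F(U)\to\mathsf{Set}(\mathscr{C}( *,U),F( * ))$, $x\mapsto(u\mapsto F(u)(x))$, is injective, where $*$ is the terminal object (one-point manifold). $\mathsf{ConSh}(\mathscr{C},j)$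 is the full subcategory of presheaves consisting of concrete sheaves. *)

theory Defs
  imports "HOL-Analysis.Analysis" "HOL-Library.Equipollence" "HOL-Library.FuncSet"
begin

section \<open>Categories, functors, equivalence\<close>

text \<open>Hom-sets are indexed by pairs of objects and need not be disjoint, so composition
  takes the three objects as arguments: \<open>Comp C A B D g f\<close> is \<open>g \<circ> f\<close> for
  \<open>f : A \<rightarrow> B\<close> and \<open>g : B \<rightarrow> D\<close>.\<close>

record ('o, 'a) category =
  Ob :: "'o set"
  Hom :: "'o \<Rightarrow> 'o \<Rightarrow> 'a set"
  Id :: "'o \<Rightarrow> 'a"
  Comp :: "'o \<Rightarrow> 'o \<Rightarrow> 'o \<Rightarrow> 'a \<Rightarrow> 'a \<Rightarrow> 'a"

definition is_category :: "('o, 'a) category \<Rightarrow> bool" where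
  "is_category C \<longleftrightarrow>
     (\<forall>A\<in>Ob C. Id C A \<in> Hom C A A) \<and>
     (\<forall>A\<in>Ob C. \<forall>B\<in>Ob C. \<forall>D\<in>Ob C. \<forall>f\<in>Hom C A B. \<forall>g\<in>Hom C B D.
        Comp C A B D g f \<in> Hom C A D) \<and>
     (\<forall>A\<in>Ob C. \<forall>B\<in>Ob C. \<forall>f\<in>Hom C A B.
        Comp C A A B f (Id C A) = f \<and> Comp C A B B (Id C B) f = f) \<and>
     (\<forall>A\<in>Ob C. \<forall>B\<in>Ob C. \<forall>D\<in>Ob C. \<forall>E\<in>Ob C.
        \<forall>f\<in>Hom C A B. \<forall>g\<in>Hom C B D. \<forall>h\<in>Hom C D E.
        Comp C A D E h (Comp C A B D g f) = Comp C A B E (Comp C B D E h g) f)"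

definition opposite :: "('o, 'a) category \<Rightarrow> ('o, 'a) category" where
  "opposite C = \<lparr>Ob = Ob C, Hom = (\<lambda>A B. Hom C B A), Id = Id C,
     Comp = (\<lambda>A B D g f. Comp C D B A f g)\<rparr>"

definition full_subcategory :: "('o, 'a) category \<Rightarrow> ('o \<Rightarrow> bool) \<Rightarrow> ('o, 'a) category" where
  "full_subcategory C P = C\<lparr>Ob := {A \<in> Ob C. P A}\<rparr>"

definition isomorphism_in :: "('o, 'a) category \<Rightarrow> 'o \<Rightarrow> 'o \<Rightarrow> 'a \<Rightarrow> bool" where
  "isomorphism_in C A B f \<longleftrightarrow> f \<in> Hom C A B \<and>
     (\<exists>g\<in>Hom C B A. Comp C A B A g f = Id C A \<and> Comp C B A B f g = Id C B)"

definition isomorphic_in :: "('o, 'a) category \<Rightarrow> 'o \<Rightarrow> 'o \<Rightarrow> bool" where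
  "isomorphic_in C A B \<longleftrightarrow> A \<in> Ob C \<and> B \<in> Ob C \<and> (\<exists>f. isomorphism_in C A B f)"

record ('o, 'a, 'p, 'b) functor_data =
  FOb :: "'o \<Rightarrow> 'p"
  FMor :: "'o \<Rightarrow> 'o \<Rightarrow> 'a \<Rightarrow> 'b"

text \<open>The first two conditions fix the values of the underlying total functions off the
  source category, so that equality in HOL is equality of functors.\<close>

definition is_functor ::
  "('o, 'a) category \<Rightarrow> ('p, 'b) category \<Rightarrow> ('o, 'a, 'p, 'b) functor_data \<Rightarrow> bool" where
  "is_functor C D F \<longleftrightarrow>
     FOb F \<in> extensional (Ob C) \<and>
     (\<forall>A B f. \<not> (A \<in> Ob C \<and> B \<in> Ob C \<and> f \<in> Hom C A B) \<longrightarrow> FMor F A B f = undefined) \<and>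
     (\<forall>A\<in>Ob C. FOb F A \<in> Ob D) \<and>
     (\<forall>A\<in>Ob C. \<forall>B\<in>Ob C. \<forall>f\<in>Hom C A B. FMor F A B f \<in> Hom D (FOb F A) (FOb F B)) \<and>
     (\<forall>A\<in>Ob C. FMor F A A (Id C A) = Id D (FOb F A)) \<and>
     (\<forall>A\<in>Ob C. \<forall>B\<in>Ob C. \<forall>E\<in>Ob C. \<forall>f\<in>Hom C A B. \<forall>g\<in>Hom C B E.
        FMor F A E (Comp C A B E g f) =
        Comp D (FOb F A) (FOb F B) (FOb F E) (FMor F B E g) (FMor F A B f))"

definition id_functor :: "('o, 'a) category \<Rightarrow> ('o, 'a, 'o, 'a) functor_data" where
  "id_functor C = \<lparr>FOb = (\<lambda>A\<in>Ob C. A),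
     FMor = (\<lambda>A B f. if A \<in> Ob C \<and> B \<in> Ob C \<and> f \<in> Hom C A B then f else undefined)\<rparr>"

definition comp_functor ::
  "('o, 'a) category \<Rightarrow> ('p, 'b, 'q, 'c) functor_data \<Rightarrow> ('o, 'a, 'p, 'b) functor_data \<Rightarrow>
   ('o, 'a, 'q, 'c) functor_data" where
  "comp_functor C G F = \<lparr>FOb = (\<lambda>A\<in>Ob C. FOb G (FOb F A)),
     FMor = (\<lambda>A B f. if A \<in> Ob C \<and> B \<in> Ob C \<and> f \<in> Hom C A B
                     then FMor G (FOb F A) (FOb F B) (FMor F A B f) else undefined)\<rparr>"

definition nat_trans ::
  "('o, 'a) category \<Rightarrow> ('p, 'b) category \<Rightarrow> ('o, 'a, 'p, 'b) functor_data \<Rightarrow>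
   ('o, 'a, 'p, 'b) functor_data \<Rightarrow> ('o \<Rightarrow> 'b) set" where
  "nat_trans C D F G = {\<eta> \<in> extensional (Ob C).
     (\<forall>A\<in>Ob C. \<eta> A \<in> Hom D (FOb F A) (FOb G A)) \<and>
     (\<forall>A\<in>Ob C. \<forall>B\<in>Ob C. \<forall>f\<in>Hom C A B.
        Comp D (FOb F A) (FOb F B) (FOb G B) (\<eta> B) (FMor F A B f) =
        Comp D (FOb F A) (FOb G A) (FOb G B) (FMor G A B f) (\<eta> A))}"

definition functor_category ::
  "('o, 'a) category \<Rightarrow> ('p, 'b) category \<Rightarrow>
   (('o, 'a, 'p, 'b) functor_data, 'o \<Rightarrow> 'b) category" where
  "functor_category C D = \<lparr>Ob = {F. is_functor C D F}, Hom = nat_trans C D,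
     Id = (\<lambda>F. \<lambda>A\<in>Ob C. Id D (FOb F A)),
     Comp = (\<lambda>F G H \<theta> \<eta>. \<lambda>A\<in>Ob C. Comp D (FOb F A) (FOb G A) (FOb H A) (\<theta> A) (\<eta> A))\<rparr>"

definition equivalent_categories ::
  "('o, 'a) category \<Rightarrow> ('p, 'b) category \<Rightarrow> bool" where
  "equivalent_categories C D \<longleftrightarrow> is_category C \<and> is_category D \<and>
     (\<exists>F G. is_functor C D F \<and> is_functor D C G \<and>
        isomorphic_in (functor_category C C) (comp_functor C G F) (id_functor C) \<and>
        isomorphic_in (functor_category D D) (comp_functor D F G) (id_functor D))"


section \<open>Sets, presheaves, concrete sheaves\<close>

definition Set_cat :: "'u set set \<Rightarrow> ('u set, 'u \<Rightarrow> 'u) category" where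
  "Set_cat \<S> = \<lparr>Ob = \<S>, Hom = (\<lambda>A B. A \<rightarrow>\<^sub>E B), Id = (\<lambda>A. \<lambda>x\<in>A. x),
     Comp = (\<lambda>A B D g f. compose A g f)\<rparr>"

type_synonym ('o, 'a, 'u) presheaf = "('o, 'a, 'u set, 'u \<Rightarrow> 'u) functor_data"

text \<open>For a presheaf \<open>F\<close> and \<open>f : V \<rightarrow> U\<close> in \<open>C\<close>, the restriction map
  \<open>F(f) : F(U) \<rightarrow> F(V)\<close> is \<open>FMor F U V f\<close>.\<close>

definition PSh :: "('o, 'a) category \<Rightarrow> 'u set set \<Rightarrow>
    (('o, 'a, 'u) presheaf, 'o \<Rightarrow> 'u \<Rightarrow> 'u) category" where
  "PSh C \<S> = functor_category (opposite C) (Set_cat \<S>)"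

text \<open>A family of morphisms with common target \<open>U\<close> is the set \<open>R\<close> of pairs
  (source, morphism).\<close>

definition matching_family ::
  "('o, 'a) category \<Rightarrow> ('o, 'a, 'u) presheaf \<Rightarrow> 'o \<Rightarrow> ('o \<times> 'a) set \<Rightarrow>
   ('o \<times> 'a \<Rightarrow> 'u) \<Rightarrow> bool" where
  "matching_family C F U R x \<longleftrightarrow>
     (\<forall>(V, r)\<in>R. x (V, r) \<in> FOb F V) \<and>
     (\<forall>(V, r)\<in>R. \<forall>(V', r')\<in>R. \<forall>W\<in>Ob C. \<forall>f\<in>Hom C W V. \<forall>g\<in>Hom C W V'.
        Comp C W V U r f = Comp C W V' U r' g \<longrightarrow>
        FMor F V W f (x (V, r)) = FMor F V' W g (x (V', r')))"

definition sheaf_on_family ::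
  "('o, 'a) category \<Rightarrow> ('o, 'a, 'u) presheaf \<Rightarrow> 'o \<Rightarrow> ('o \<times> 'a) set \<Rightarrow> bool" where
  "sheaf_on_family C F U R \<longleftrightarrow>
     (\<forall>x. matching_family C F U R x \<longrightarrow>
        (\<exists>!y. y \<in> FOb F U \<and> (\<forall>(V, r)\<in>R. FMor F U V r y = x (V, r))))"

definition is_sheaf ::
  "('o, 'a) category \<Rightarrow> ('o \<Rightarrow> ('o \<times> 'a) set set) \<Rightarrow> ('o, 'a, 'u) presheaf \<Rightarrow> bool" where
  "is_sheaf C j F \<longleftrightarrow> (\<forall>U\<in>Ob C. \<forall>R\<in>j U. sheaf_on_family C F U R)"

definition terminal_in :: "('o, 'a) category \<Rightarrow> 'o \<Rightarrow> bool" where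
  "terminal_in C t \<longleftrightarrow> t \<in> Ob C \<and> (\<forall>A\<in>Ob C. \<exists>!f. f \<in> Hom C A t)"

text \<open>The second argument is the chosen terminal object.\<close>

definition is_concrete ::
  "('o, 'a) category \<Rightarrow> 'o \<Rightarrow> ('o, 'a, 'u) presheaf \<Rightarrow> bool" where
  "is_concrete C t F \<longleftrightarrow>
     (\<forall>U\<in>Ob C. inj_on (\<lambda>x. \<lambda>u\<in>Hom C t U. FMor F U t u x) (FOb F U))"


section \<open>Smooth manifolds\<close>

definition partial_derivative :: "nat \<Rightarrow> ((nat \<Rightarrow> real) \<Rightarrow> real) \<Rightarrow> (nat \<Rightarrow> real) \<Rightarrow> real" where
  "partial_derivative i f x = deriv (\<lambda>t. f (x(i := t))) (x i)"

text \<open>\<open>C_diff n k U f\<close>: \<open>f\<close> is of class \<open>C\<^sup>k\<close> on the subset \<open>U\<close> of \<open>\<real>\<^sup>n\<close>, meant for open \<open>U\<close>.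
  Here \<open>\<real>\<^sup>n\<close> is \<^term>\<open>Euclidean_space n\<close>, the sequences vanishing from index \<open>n\<close> on.\<close>

primrec C_diff :: "nat \<Rightarrow> nat \<Rightarrow> (nat \<Rightarrow> real) set \<Rightarrow> ((nat \<Rightarrow> real) \<Rightarrow> real) \<Rightarrow> bool" where
  "C_diff n 0 U f \<longleftrightarrow> continuous_map (subtopology (Euclidean_space n) U) euclideanreal f"
| "C_diff n (Suc k) U f \<longleftrightarrow>
     continuous_map (subtopology (Euclidean_space n) U) euclideanreal f \<and>
     (\<forall>i<n. (\<forall>x\<in>U. (\<lambda>t. f (x(i := t))) field_differentiable at (x i)) \<and>
            C_diff n k U (partial_derivative i f))"

definition smooth_on ::
  "nat \<Rightarrow> nat \<Rightarrow> (nat \<Rightarrow> real) set \<Rightarrow> ((nat \<Rightarrow> real) \<Rightarrow> (nat \<Rightarrow> real)) \<Rightarrow> bool" where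
  "smooth_on n m U f \<longleftrightarrow> (\<forall>j<m. \<forall>k. C_diff n k U (\<lambda>x. f x j))"

text \<open>A chart is an open set \<open>U\<close> together with a homeomorphism from \<open>U\<close> onto an open subset
  of \<open>\<real>\<^sup>n\<close>, extended by \<^term>\<open>undefined\<close> outside \<open>U\<close>.\<close>

type_synonym 'm chart = "'m set \<times> ('m \<Rightarrow> nat \<Rightarrow> real)"

definition is_chart :: "'m topology \<Rightarrow> nat \<Rightarrow> 'm chart \<Rightarrow> bool" where
  "is_chart X n = (\<lambda>(U, \<phi>). openin X U \<and> \<phi> \<in> extensional U \<and>
     openin (Euclidean_space n) (\<phi> ` U) \<and>
     homeomorphic_map (subtopology X U) (subtopology (Euclidean_space n) (\<phi> ` U)) \<phi>)"

definition compatible_charts :: "nat \<Rightarrow> 'm chart \<Rightarrow> 'm chart \<Rightarrow> bool" where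
  "compatible_charts n = (\<lambda>(U, \<phi>) (V, \<psi>).
     smooth_on n n (\<phi> ` (U \<inter> V)) (\<psi> \<circ> inv_into U \<phi>) \<and>
     smooth_on n n (\<psi> ` (U \<inter> V)) (\<phi> \<circ> inv_into V \<psi>))"

record 'm mfd =
  space_of :: "'m topology"
  mdim :: nat
  atlas :: "'m chart set"

abbreviation points :: "'m mfd \<Rightarrow> 'm set" where
  "points M \<equiv> topspace (space_of M)"

definition paracompact_space :: "'m topology \<Rightarrow> bool" where
  "paracompact_space X \<longleftrightarrow>
     (\<forall>\<U>. (\<forall>U\<in>\<U>. openin X U) \<and> \<Union>\<U> = topspace X \<longrightarrow>
        (\<exists>\<V>. (\<forall>V\<in>\<V>. openin X V \<and> (\<exists>U\<in>\<U>. V \<subseteq> U)) \<and> \<Union>\<V> = topspace X \<and>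
             locally_finite_in X \<V>))"

text \<open>A smooth structure is a maximal atlas; the last conjunct is maximality.\<close>

definition smooth_manifold :: "'m mfd \<Rightarrow> bool" where
  "smooth_manifold M \<longleftrightarrow>
     Hausdorff_space (space_of M) \<and> paracompact_space (space_of M) \<and>
     (\<forall>c\<in>atlas M. is_chart (space_of M) (mdim M) c) \<and>
     (\<Union>c\<in>atlas M. fst c) = points M \<and>
     (\<forall>c\<in>atlas M. \<forall>d\<in>atlas M. compatible_charts (mdim M) c d) \<and>
     (\<forall>c. is_chart (space_of M) (mdim M) c \<and> (\<forall>d\<in>atlas M. compatible_charts (mdim M) c d)
          \<longrightarrow> c \<in> atlas M)"

definition smooth_maps :: "'m mfd \<Rightarrow> 'n mfd \<Rightarrow> ('m \<Rightarrow> 'n) set" where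
  "smooth_maps M N = {f \<in> points M \<rightarrow>\<^sub>E points N.
     continuous_map (space_of M) (space_of N) f \<and>
     (\<forall>(U, \<phi>)\<in>atlas M. \<forall>(V, \<psi>)\<in>atlas N.
        smooth_on (mdim M) (mdim N) (\<phi> ` (U \<inter> f -` V)) (\<psi> \<circ> f \<circ> inv_into U \<phi>))}"

definition diffeomorphic :: "'m mfd \<Rightarrow> 'n mfd \<Rightarrow> bool" where
  "diffeomorphic M N \<longleftrightarrow> (\<exists>f\<in>smooth_maps M N. \<exists>g\<in>smooth_maps N M.
     (\<forall>x\<in>points M. g (f x) = x) \<and> (\<forall>y\<in>points N. f (g y) = y))"

definition open_submanifold :: "'m mfd \<Rightarrow> 'm set \<Rightarrow> 'm mfd" where
  "open_submanifold M U = \<lparr>space_of = subtopology (space_of M) U, mdim = mdim M,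
     atlas = {c \<in> atlas M. fst c \<subseteq> U}\<rparr>"

text \<open>\<open>\<real>\<^sup>n\<close> with the smooth structure determined by the identity chart.\<close>

definition Euclidean_mfd :: "nat \<Rightarrow> (nat \<Rightarrow> real) mfd" where
  "Euclidean_mfd n = \<lparr>space_of = Euclidean_space n, mdim = n,
     atlas = {c. is_chart (Euclidean_space n) n c \<and>
       compatible_charts n c
         (topspace (Euclidean_space n), \<lambda>x\<in>topspace (Euclidean_space n). x)}\<rparr>"

definition one_point_mfd :: "'m mfd" where
  "one_point_mfd = \<lparr>space_of = discrete_topology {undefined}, mdim = 0,
     atlas = {c. is_chart (discrete_topology {undefined}) 0 c}\<rparr>"

definition cartesian_mfd :: "'m mfd \<Rightarrow> bool" where
  "cartesian_mfd M \<longleftrightarrow> smooth_manifold M \<and> (\<exists>n. diffeomorphic M (Euclidean_mfd n))"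

definition open_type_mfd :: "'m mfd \<Rightarrow> bool" where
  "open_type_mfd M \<longleftrightarrow> smooth_manifold M \<and>
     (\<exists>n W. openin (Euclidean_space n) W \<and>
            diffeomorphic M (open_submanifold (Euclidean_mfd n) W))"


section \<open>The sites\<close>

text \<open>Size conventions. The points of all manifolds are taken from one type \<open>'m\<close>, and \<open>\<P>\<close> is
  the collection of subsets of \<open>'m\<close> that are small enough to underlie a manifold; the
  elements of all sets are taken from one type \<open>'u\<close>, and \<open>\<S>\<close> is the collection of subsets
  of \<open>'u\<close> that count as objects of the category of sets. The requirements say that
  smallness only depends on (and is downwards closed in) the cardinality, that every \<open>\<real>\<^sup>n\<close>
  has a small copy, and that there is a set of all maps from a manifold to a set.
  Uncountable Grothendieck universes are an instance; so is \<open>\<P> = UNIV\<close>, \<open>\<S> = UNIV\<close> with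
  \<open>'m = nat \<Rightarrow> real\<close> and \<open>'u = 'm \<Rightarrow> bool\<close>.\<close>

definition size_conventions :: "'m set set \<Rightarrow> 'u set set \<Rightarrow> bool" where
  "size_conventions \<P> \<S> \<longleftrightarrow>
     (\<forall>X Y. X \<in> \<P> \<and> Y \<lesssim> X \<longrightarrow> Y \<in> \<P>) \<and>
     (\<forall>n. \<exists>X\<in>\<P>. topspace (Euclidean_space n) \<lesssim> X) \<and>
     (\<forall>A B. A \<in> \<S> \<and> B \<lesssim> A \<longrightarrow> B \<in> \<S>) \<and>
     (\<forall>X\<in>\<P>. \<forall>A\<in>\<S>. \<exists>B\<in>\<S>. (X \<rightarrow>\<^sub>E A) \<lesssim> B)"

definition Man :: "'m set set \<Rightarrow> ('m mfd, 'm \<Rightarrow> 'm) category" where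
  "Man \<P> = \<lparr>Ob = {M. smooth_manifold M \<and> points M \<in> \<P>}, Hom = smooth_maps,
     Id = (\<lambda>M. \<lambda>x\<in>points M. x), Comp = (\<lambda>L M N g f. compose (points L) g f)\<rparr>"

definition Open :: "'m set set \<Rightarrow> ('m mfd, 'm \<Rightarrow> 'm) category" where
  "Open \<P> = full_subcategory (Man \<P>) open_type_mfd"

definition Cart :: "'m set set \<Rightarrow> ('m mfd, 'm \<Rightarrow> 'm) category" where
  "Cart \<P> = full_subcategory (Man \<P>) cartesian_mfd"

definition open_cover :: "'m mfd \<Rightarrow> 'm set set \<Rightarrow> bool" where
  "open_cover M \<U> \<longleftrightarrow> (\<forall>U\<in>\<U>. openin (space_of M) U) \<and> \<Union>\<U> = points M"

definition good_open_cover :: "'m mfd \<Rightarrow> 'm set set \<Rightarrow> bool" where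
  "good_open_cover M \<U> \<longleftrightarrow> open_cover M \<U> \<and>
     (\<forall>U\<in>\<U>. cartesian_mfd (open_submanifold M U)) \<and>
     (\<forall>\<V>\<subseteq>\<U>. finite \<V> \<and> \<V> \<noteq> {} \<and> \<Inter>\<V> \<noteq> {} \<longrightarrow>
        cartesian_mfd (open_submanifold M (\<Inter>\<V>)))"

definition inclusions :: "'m mfd \<Rightarrow> 'm set set \<Rightarrow> ('m mfd \<times> ('m \<Rightarrow> 'm)) set" where
  "inclusions M \<U> = (\<lambda>U. (open_submanifold M U, \<lambda>x\<in>U. x)) ` \<U>"

definition j_open ::
  "('m mfd, 'm \<Rightarrow> 'm) category \<Rightarrow> 'm mfd \<Rightarrow> ('m mfd \<times> ('m \<Rightarrow> 'm)) set set" where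
  "j_open C M = {inclusions M \<U> | \<U>.
     open_cover M \<U> \<and> (\<forall>U\<in>\<U>. open_submanifold M U \<in> Ob C)}"

definition j_good ::
  "('m mfd, 'm \<Rightarrow> 'm) category \<Rightarrow> 'm mfd \<Rightarrow> ('m mfd \<times> ('m \<Rightarrow> 'm)) set set" where
  "j_good C M = {inclusions M \<U> | \<U>.
     good_open_cover M \<U> \<and> (\<forall>U\<in>\<U>. open_submanifold M U \<in> Ob C)}"

definition ConSh ::
  "'u set set \<Rightarrow> ('m mfd, 'm \<Rightarrow> 'm) category \<Rightarrow>
   ('m mfd \<Rightarrow> ('m mfd \<times> ('m \<Rightarrow> 'm)) set set) \<Rightarrow>
   (('m mfd, 'm \<Rightarrow> 'm, 'u) presheaf, 'm mfd \<Rightarrow> 'u \<Rightarrow> 'u) category" where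
  "ConSh \<S> C j =
     full_subcategory (PSh C \<S>) (\<lambda>F. is_sheaf C j F \<and> is_concrete C one_point_mfd F)"


section \<open>Basic facts\<close>

lemma is_category_Set_cat: "is_category (Set_cat \<S>)"
  unfolding is_category_def Set_cat_def
  by (auto simp: compose_def PiE_iff fun_eq_iff restrict_def extensional_def)

lemma is_category_functor_category:
  assumes "is_category D"
  shows "is_category (functor_category C D)"
proof -
  have idm: "\<And>A. A \<in> Ob D \<Longrightarrow> Id D A \<in> Hom D A A"
    and cmp: "\<And>A B E f g. A \<in> Ob D \<Longrightarrow> B \<in> Ob D \<Longrightarrow> E \<in> Ob D \<Longrightarrow> f \<in> Hom D A B \<Longrightarrow>
      g \<in> Hom D B E \<Longrightarrow> Comp D A B E g f \<in> Hom D A E"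
    and unl: "\<And>A B f. A \<in> Ob D \<Longrightarrow> B \<in> Ob D \<Longrightarrow> f \<in> Hom D A B \<Longrightarrow> Comp D A A B f (Id D A) = f"
    and unr: "\<And>A B f. A \<in> Ob D \<Longrightarrow> B \<in> Ob D \<Longrightarrow> f \<in> Hom D A B \<Longrightarrow> Comp D A B B (Id D B) f = f"
    and asc: "\<And>A B E H f g h. A \<in> Ob D \<Longrightarrow> B \<in> Ob D \<Longrightarrow> E \<in> Ob D \<Longrightarrow> H \<in> Ob D \<Longrightarrow>
      f \<in> Hom D A B \<Longrightarrow> g \<in> Hom D B E \<Longrightarrow> h \<in> Hom D E H \<Longrightarrow>
      Comp D A E H h (Comp D A B E g f) = Comp D A B H (Comp D B E H h g) f"
    using assms unfolding is_category_def by metis+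
  have fob: "FOb F A \<in> Ob D" if "is_functor C D F" "A \<in> Ob C" for F A
    using that unfolding is_functor_def by blast
  have fmor: "FMor F A B f \<in> Hom D (FOb F A) (FOb F B)"
    if "is_functor C D F" "A \<in> Ob C" "B \<in> Ob C" "f \<in> Hom C A B" for F A B f
    using that unfolding is_functor_def by blast
  have nt: "\<eta> A \<in> Hom D (FOb F A) (FOb G A)" if "\<eta> \<in> nat_trans C D F G" "A \<in> Ob C" for F G \<eta> A
    using that unfolding nat_trans_def by blast
  have nat: "Comp D (FOb F A) (FOb F B) (FOb G B) (\<eta> B) (FMor F A B f) =
        Comp D (FOb F A) (FOb G A) (FOb G B) (FMor G A B f) (\<eta> A)"
    if "\<eta> \<in> nat_trans C D F G" "A \<in> Ob C" "B \<in> Ob C" "f \<in> Hom C A B" for F G \<eta> A B f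
    using that unfolding nat_trans_def by blast
  have ext: "\<eta> \<in> extensional (Ob C)" if "\<eta> \<in> nat_trans C D F G" for F G \<eta>
    using that unfolding nat_trans_def by blast
  have 1: "(\<lambda>A\<in>Ob C. Id D (FOb F A)) \<in> nat_trans C D F F" if "is_functor C D F" for F
    using that by (simp add: nat_trans_def idm fob fmor unl unr)
  have 2: "(\<lambda>A\<in>Ob C. Comp D (FOb F A) (FOb G A) (FOb H A) (\<theta> A) (\<eta> A)) \<in> nat_trans C D F H"
    if F: "is_functor C D F" "is_functor C D G" "is_functor C D H"
      and e: "\<eta> \<in> nat_trans C D F G" "\<theta> \<in> nat_trans C D G H" for F G H \<eta> \<theta>
  proof -
    have "Comp D (FOb F A) (FOb F B) (FOb H B)
            (Comp D (FOb F B) (FOb G B) (FOb H B) (\<theta> B) (\<eta> B)) (FMor F A B f) =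
          Comp D (FOb F A) (FOb H A) (FOb H B) (FMor H A B f)
            (Comp D (FOb F A) (FOb G A) (FOb H A) (\<theta> A) (\<eta> A))"
      if A: "A \<in> Ob C" "B \<in> Ob C" "f \<in> Hom C A B" for A B f
    proof -
      note o = fob[OF F(1) A(1)] fob[OF F(1) A(2)] fob[OF F(2) A(1)] fob[OF F(2) A(2)]
        fob[OF F(3) A(1)] fob[OF F(3) A(2)]
      note m = fmor[OF F(1) A] fmor[OF F(2) A] fmor[OF F(3) A]
        nt[OF e(1) A(1)] nt[OF e(1) A(2)] nt[OF e(2) A(1)] nt[OF e(2) A(2)]
      show ?thesis
        using asc[OF o(1,2,4,6) m(1,5,7)] asc[OF o(1,3,4,6) m(4,2,7)]
          asc[OF o(1,3,5,6) m(4,6,3)] nat[OF e(1) A] nat[OF e(2) A] by simp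
    qed
    then show ?thesis
      unfolding nat_trans_def using F e
      by (auto simp del: restrict_apply simp: restrict_apply' intro!: cmp fob[of F] fob[of G] fob[of H]
          nt[of \<eta> F G] nt[of \<theta> G H])
  qed
  show ?thesis
    unfolding is_category_def functor_category_def
    by (auto intro!: 1 2 extensionalityI[of _ "Ob C"] restrict_extensional ext
        simp: unl unr fob nt asc)
qed

lemma is_category_full_subcategory:
  assumes "is_category C"
  shows "is_category (full_subcategory C P)"
  using assms unfolding is_category_def full_subcategory_def by simp

lemma is_category_ConSh: "is_category (ConSh \<S> C j)"
  unfolding ConSh_def PSh_def
  by (intro is_category_full_subcategory is_category_functor_category is_category_Set_cat)

lemma smooth_on_0 [simp]: "smooth_on n 0 U f"
  by (simp add: smooth_on_def)

lemma topspace_Euclidean_space_0: "topspace (Euclidean_space 0) = {\<lambda>_. 0}"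
  by (auto simp: topspace_Euclidean_space)

lemma smooth_manifold_one_point: "smooth_manifold (one_point_mfd :: 'm mfd)"
proof -
  let ?X = "discrete_topology {undefined :: 'm}" and ?\<phi> = "\<lambda>x\<in>{undefined}. (\<lambda>_::nat. 0::real)"
  have E: "Euclidean_space 0 = discrete_topology {\<lambda>_. 0}"
    using topspace_Euclidean_space_0 subtopology_eq_discrete_topology_sing
    by (metis subtopology_topspace)
  have ch: "is_chart ?X 0 ({undefined}, ?\<phi>)"
    by (simp add: is_chart_def E homeomorphic_map_maps homeomorphic_maps_def
        subtopology_restrict) (rule exI[of _ "\<lambda>_. undefined"], auto)
  have sub: "fst c \<subseteq> {undefined}" if "is_chart ?X 0 c" for c :: "'m chart"
    using that by (cases c) (auto simp: is_chart_def)
  have pc: "paracompact_space ?X"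
    unfolding paracompact_space_def
  proof (intro allI impI)
    fix \<U> :: "'m set set"
    assume U: "(\<forall>U\<in>\<U>. openin ?X U) \<and> \<Union>\<U> = topspace ?X"
    then have "finite \<U>"
      by (auto intro: finite_subset[of _ "Pow {undefined}"])
    then have "locally_finite_in ?X \<U>"
      using U finite_imp_locally_finite_in[of \<U> ?X] by blast
    with U show "\<exists>\<V>. (\<forall>V\<in>\<V>. openin ?X V \<and> (\<exists>U\<in>\<U>. V \<subseteq> U)) \<and> \<Union>\<V> = topspace ?X \<and>
        locally_finite_in ?X \<V>"
      by (intro exI[of _ \<U>]) auto
  qed
  have cov: "(\<Union>c\<in>{c. is_chart ?X 0 c}. fst c) = {undefined}"
  proof
    show "(\<Union>c\<in>{c. is_chart ?X 0 c}. fst c) \<subseteq> {undefined}"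
      using sub by blast
    show "{undefined} \<subseteq> (\<Union>c\<in>{c. is_chart ?X 0 c}. fst c)"
      using ch by (metis UN_upper fst_conv mem_Collect_eq)
  qed
  have "compatible_charts 0 c d" for c d :: "'m chart"
    by (simp add: compatible_charts_def case_prod_beta)
  with pc cov show ?thesis
    by (simp add: smooth_manifold_def one_point_mfd_def)
qed

lemma points_one_point [simp]: "points one_point_mfd = {undefined}"
  by (simp add: one_point_mfd_def)

lemma diffeomorphic_one_point:
  assumes "points N = {a}" "mdim N = 0"
  shows "diffeomorphic one_point_mfd N"
proof -
  have "(\<lambda>x\<in>{undefined}. a) \<in> smooth_maps one_point_mfd N"
    using assms by (auto simp: smooth_maps_def one_point_mfd_def)
  moreover have "(\<lambda>x\<in>{a}. undefined) \<in> smooth_maps N one_point_mfd"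
  proof -
    have "continuous_map (space_of N) (space_of (one_point_mfd :: 'b mfd)) (\<lambda>x\<in>{a}. undefined)"
      by (rule continuous_map_eq[of _ _ "\<lambda>_. undefined"]) (use assms in auto)
    then show ?thesis
      using assms by (auto simp: smooth_maps_def one_point_mfd_def)
  qed
  ultimately show ?thesis
    unfolding diffeomorphic_def using assms by (intro bexI) auto
qed

lemma terminal_one_point:
  assumes "size_conventions \<P> \<S>" "C \<in> {Cart \<P>, Open \<P>, Man \<P>}"
  shows "terminal_in C one_point_mfd"
proof -
  obtain X where X: "X \<in> \<P>" "topspace (Euclidean_space 0) \<lesssim> X"
    using assms(1) unfolding size_conventions_def by blast
  then have "X \<noteq> {}"
    by (auto simp: topspace_Euclidean_space_0)
  then have "{undefined} \<lesssim> X"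
    unfolding lepoll_def by (metis all_not_in_conv image_constant_conv image_is_empty
        inj_on_def insert_subset empty_subsetI singletonD image_insert image_empty)
  then have P: "{undefined} \<in> \<P>"
    using assms(1) X(1) unfolding size_conventions_def by blast
  have dc: "cartesian_mfd one_point_mfd"
    unfolding cartesian_mfd_def
    by (intro conjI exI[of _ 0] smooth_manifold_one_point diffeomorphic_one_point)
       (auto simp: Euclidean_mfd_def topspace_Euclidean_space_0)
  have do: "open_type_mfd one_point_mfd"
    unfolding open_type_mfd_def
    by (intro conjI exI[of _ 0] exI[of _ "topspace (Euclidean_space 0)"]
        smooth_manifold_one_point diffeomorphic_one_point openin_topspace)
       (auto simp: Euclidean_mfd_def open_submanifold_def topspace_Euclidean_space_0)
  have ob: "one_point_mfd \<in> Ob C"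
    using assms(2) P dc do smooth_manifold_one_point
    by (auto simp: Cart_def Open_def Man_def full_subcategory_def)
  have hom: "Hom C = smooth_maps"
    using assms(2) by (auto simp: Cart_def Open_def Man_def full_subcategory_def)
  have "smooth_maps M one_point_mfd = {\<lambda>x\<in>points M. undefined}" for M :: "'a mfd"
  proof -
    have "continuous_map (space_of M) (space_of (one_point_mfd :: 'a mfd)) (\<lambda>x\<in>points M. undefined)"
      by (rule continuous_map_eq[of _ _ "\<lambda>_. undefined"]) auto
    then show ?thesis
      by (auto simp: smooth_maps_def one_point_mfd_def PiE_iff extensional_def fun_eq_iff)
  qed
  then show ?thesis
    unfolding terminal_in_def using ob hom by auto
qed

end

theory Submission
  imports Defs
begin

text \<open>Concreteness makes a section over \<open>M\<close> the same as a map from the points of \<open>M\<close> to \<open>F(*)\<close>, and since every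
  manifold has a good open cover, a concrete sheaf is determined by the set \<open>F(*)\<close> together with the sections over
  cartesian spaces. This data forms a category that does not depend on the site, and assigning it to a sheaf is
  fully faithful and surjective on objects for each of the six sites.

  Good covers are found without Riemannian metrics. Choose a locally finite family of charts and around each
  point a ball in one chart that is so small that it is convex in all charts of the family that it can meet. Then
  the members of a finite intersection are all convex in one common chart. There each of them is the set where some
  convex function \<open>f\<^sub>i\<close> is negative, and \<open>x \<mapsto> (\<Sum>i. 1 / (- f\<^sub>i x)) (x - x0)\<close> is a diffeomorphism from the
  intersection onto \<open>\<real>\<^sup>n\<close>.\<close>

section \<open>Differential calculus with iterated partial derivatives\<close>

text \<open>The predicate \<open>C_diff\<close> only speaks of iterated partial derivatives, so
  there is no total derivative to start from; the difference quotients of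
  \<open>caratheodory\<close> take its place. They serve twice: for the chain rule, and for
  differentiating the function \<tau> that inverts the radial map, at a stage where \<tau> is only
  known to be continuous.

  The obstacle with good covers is that a set convex in one chart need not be convex in another.
  Small balls remain convex under a change of charts, but how small depends on the chart, which is
  why local finiteness is needed. Convexity of the sets alone would not yield an explicit smooth
  diffeomorphism, so each set carries a smooth convex function that tends to zero at its boundary.
  The reciprocals \<open>1 / (- f)\<close> blow up there and may simply be added, so that finite
  intersections cause no trouble with corners.

  The two kinds of covers are compared by refinement: pulling an open cover back to a cartesian
  space and refining it to a good one shows that locality on good covers of cartesian spaces already
  gives the sheaf property for open covers of any manifold.\<close>

definition Rn :: "nat \<Rightarrow> (nat \<Rightarrow> real) set" where
  "Rn n = {x. \<forall>i\<ge>n. x i = 0}"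

lemma topspace_Euclidean_space_Rn [simp]: "topspace (Euclidean_space n) = Rn n"
  by (simp add: Rn_def topspace_Euclidean_space)

lemma Rn_iff: "x \<in> Rn n \<longleftrightarrow> (\<forall>i\<ge>n. x i = 0)"
  by (simp add: Rn_def)

lemma openin_Euclidean_subset: "openin (Euclidean_space n) U \<Longrightarrow> U \<subseteq> Rn n"
  using openin_subset by fastforce

lemma Euclidean_space_eq: "Euclidean_space n = top_of_set (Rn n)"
  by (simp add: Euclidean_space_def euclidean_product_topology Rn_def)

section \<open>Boxes and convergence in \<open>Rn n\<close>\<close>

lemma open_coordinate_box: "open {y::nat \<Rightarrow> real. \<forall>i<n. \<bar>y i - x i\<bar> < d}"
proof -
  have "open {y::nat \<Rightarrow> real. \<bar>y i - x i\<bar> < d}" for i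
    by (intro open_Collect_less continuous_intros continuous_on_product_coordinates)
  then have "open (\<Inter>i\<in>{..<n}. {y::nat \<Rightarrow> real. \<bar>y i - x i\<bar> < d})"
    by (intro open_INT) auto
  moreover have "(\<Inter>i\<in>{..<n}. {y::nat \<Rightarrow> real. \<bar>y i - x i\<bar> < d}) = {y. \<forall>i<n. \<bar>y i - x i\<bar> < d}"
    by auto
  ultimately show ?thesis by simp
qed

text \<open>A basic neighbourhood in the product topology contains an interval around each
  coordinate. Points of \<open>Rn n\<close> can differ in the first \<open>n\<close> coordinates
  only, so finitely many radii matter and one \<open>d\<close> suffices.\<close>

lemma openin_Euclidean_space_iff:
  "openin (Euclidean_space n) U \<longleftrightarrow>
   U \<subseteq> Rn n \<and> (\<forall>x\<in>U. \<exists>d>0. \<forall>y\<in>Rn n. (\<forall>i<n. \<bar>y i - x i\<bar> < d) \<longrightarrow> y \<in> U)"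
proof safe
  fix x assume U: "openin (Euclidean_space n) U" and x: "x \<in> U"
  show "x \<in> Rn n" using U x by (meson openin_Euclidean_subset subsetD)
  obtain T where T: "open T" "U = Rn n \<inter> T"
    using U unfolding Euclidean_space_eq openin_open by blast
  have "openin (product_topology (\<lambda>i. euclidean) UNIV) T"
    using T(1) by (simp add: open_fun_def)
  from product_topology_open_contains_basis[OF this] x T
  obtain X where X: "x \<in> (\<Pi>\<^sub>E i\<in>UNIV. X i)" "\<And>i. open (X i)" "(\<Pi>\<^sub>E i\<in>UNIV. X i) \<subseteq> T"
    by (metis IntD2 open_openin)
  have "\<exists>d>0. ball (x i) d \<subseteq> X i" for i
    using X(1,2) open_contains_ball by blast
  then obtain r where r: "\<And>i. r i > 0" "\<And>i. ball (x i) (r i) \<subseteq> X i" by metis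
  \<comment> \<open>The inserted 1 keeps the minimum meaningful for \<open>n = 0\<close>.\<close>
  define d where "d = Min (insert 1 (r ` {..<n}))"
  have d: "d > 0" "\<And>i. i < n \<Longrightarrow> d \<le> r i"
    using r(1) by (auto simp: d_def)
  have "y \<in> U" if y: "y \<in> Rn n" "\<forall>i<n. \<bar>y i - x i\<bar> < d" for y
  proof -
    have "x \<in> Rn n" using x T by simp
    have "y i \<in> X i" for i
    proof (cases "i < n")
      case True
      then have "y i \<in> ball (x i) (r i)"
        using y(2) d(2)[of i] by (force simp: dist_real_def abs_minus_commute)
      then show ?thesis using r(2) by blast
    next
      case False
      then have "y i = x i" using y(1) \<open>x \<in> Rn n\<close> by (simp add: Rn_iff)
      then show ?thesis using X(1) by auto
    qed
    then have "y \<in> T" using X(3) by auto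
    then show ?thesis using y T by simp
  qed
  with d(1) show "\<exists>d>0. \<forall>y\<in>Rn n. (\<forall>i<n. \<bar>y i - x i\<bar> < d) \<longrightarrow> y \<in> U" by blast
next
  assume U: "U \<subseteq> Rn n" "\<forall>x\<in>U. \<exists>d>0. \<forall>y\<in>Rn n. (\<forall>i<n. \<bar>y i - x i\<bar> < d) \<longrightarrow> y \<in> U"
  show "openin (Euclidean_space n) U"
    unfolding Euclidean_space_eq
  proof (subst openin_subopen, safe)
    fix x assume x: "x \<in> U"
    then obtain d where d: "d > 0" "\<forall>y\<in>Rn n. (\<forall>i<n. \<bar>y i - x i\<bar> < d) \<longrightarrow> y \<in> U"
      using U by blast
    let ?T = "Rn n \<inter> {y. \<forall>i<n. \<bar>y i - x i\<bar> < d}"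
    have "openin (top_of_set (Rn n)) ?T"
      using open_coordinate_box openin_open by blast
    moreover have "x \<in> ?T" using x U d by auto
    ultimately show "\<exists>T. openin (top_of_set (Rn n)) T \<and> x \<in> T \<and> T \<subseteq> U"
      using d(2) by (intro exI[of _ ?T]) auto
  qed
qed

lemma openin_Euclidean_box:
  "openin (Euclidean_space n) {y \<in> Rn n. \<forall>i<n. \<bar>y i - x i\<bar> < d}"
proof -
  have "{y \<in> Rn n. \<forall>i<n. \<bar>y i - x i\<bar> < d} = Rn n \<inter> {y. \<forall>i<n. \<bar>y i - x i\<bar> < d}" by auto
  then show ?thesis
    by (simp add: Euclidean_space_eq openin_open_Int open_coordinate_box)
qed

lemma openin_Euclidean_boxE:
  assumes "openin (Euclidean_space n) U" "x \<in> U"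
  obtains d where "d > 0" "\<And>y. y \<in> Rn n \<Longrightarrow> (\<And>i. i < n \<Longrightarrow> \<bar>y i - x i\<bar> < d) \<Longrightarrow> y \<in> U"
  using assms unfolding openin_Euclidean_space_iff by metis

lemma continuous_map_Euclidean_sub:
  assumes "U \<subseteq> Rn n"
  shows "continuous_map (subtopology (Euclidean_space n) U) euclideanreal f \<longleftrightarrow> continuous_on U f"
  using assms by (simp add: Euclidean_space_eq subtopology_subtopology Int_absorb1)

lemma tendsto_coordinatewise:
  fixes \<gamma> :: "'a \<Rightarrow> nat \<Rightarrow> real"
  assumes "\<And>i. ((\<lambda>s. \<gamma> s i) \<longlongrightarrow> x i) F"
  shows "(\<gamma> \<longlongrightarrow> x) F"
proof -
  have "limitin (product_topology (\<lambda>i. euclideanreal) UNIV) \<gamma> x F"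
    using assms unfolding limitin_componentwise by simp
  then show ?thesis by (simp add: euclidean_product_topology)
qed

lemma fun_upd_in_Rn: "x \<in> Rn n \<Longrightarrow> i < n \<Longrightarrow> x(i := t) \<in> Rn n"
  by (auto simp: Rn_iff)

text \<open>Membership in \<open>Rn n\<close> fixes all coordinates from \<open>n\<close> on, so
  only the others have to converge. This is the form in which openness is applied to changes of one
  coordinate and to rays.\<close>

lemma eventually_in_openin_Euclidean:
  assumes "openin (Euclidean_space n) U" "x \<in> U"
    and "\<And>i. i < n \<Longrightarrow> ((\<lambda>s. \<gamma> s i) \<longlongrightarrow> x i) F" "\<forall>\<^sub>F s in F. \<gamma> s \<in> Rn n"
  shows "\<forall>\<^sub>F s in F. \<gamma> s \<in> U"
proof -
  obtain d where d: "d > 0" "\<And>y. y \<in> Rn n \<Longrightarrow> (\<And>i. i < n \<Longrightarrow> \<bar>y i - x i\<bar> < d) \<Longrightarrow> y \<in> U"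
    using openin_Euclidean_boxE[OF assms(1,2)] by metis
  have "\<forall>\<^sub>F s in F. \<forall>i\<in>{..<n}. \<bar>\<gamma> s i - x i\<bar> < d"
    using tendstoD[OF assms(3) d(1)] by (intro eventually_ball_finite) (auto simp: dist_real_def)
  with assms(4) have "\<forall>\<^sub>F s in F. \<gamma> s \<in> Rn n \<and> (\<forall>i\<in>{..<n}. \<bar>\<gamma> s i - x i\<bar> < d)"
    by (rule eventually_conj)
  then show ?thesis
    by (rule eventually_mono) (simp add: d(2))
qed

lemma eventually_fun_upd_in:
  assumes "openin (Euclidean_space n) U" "x \<in> U" "i < n"
  shows "\<forall>\<^sub>F t in nhds (x i). x(i := t) \<in> U"
proof (rule eventually_in_openin_Euclidean[OF assms(1,2)])
  have x: "x \<in> Rn n" using assms openin_Euclidean_subset by blast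
  show "\<forall>\<^sub>F t in nhds (x i). x(i := t) \<in> Rn n"
    using fun_upd_in_Rn[OF x assms(3)] by simp
  fix j assume "j < n"
  show "((\<lambda>s. (x(i := s)) j) \<longlongrightarrow> x j) (nhds (x i))"
    by (cases "j = i") (simp_all add: filterlim_ident)
qed

section \<open>Locality and algebra of the classes \<open>C_diff\<close>\<close>

lemma C_diff_continuous_on:
  assumes "C_diff n k U f" "U \<subseteq> Rn n" shows "continuous_on U f"
proof -
  have "continuous_map (subtopology (Euclidean_space n) U) euclideanreal f"
    using assms(1) by (cases k) simp_all
  then show ?thesis using continuous_map_Euclidean_sub[OF assms(2)] by blast
qed

lemma C_diff_DERIV:
  assumes "C_diff n (Suc k) U f" "x \<in> U" "i < n"
  shows "((\<lambda>t. f (x(i := t))) has_real_derivative partial_derivative i f x) (at (x i))"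
  using assms by (simp add: partial_derivative_def DERIV_deriv_iff_field_differentiable)

text \<open>Since \<open>U\<close> is open, a small change of one coordinate stays in
  \<open>U\<close>, so functions that agree on \<open>U\<close> have the same partial derivatives
  there, and the induction can proceed with these.\<close>

lemma C_diff_cong:
  assumes "openin (Euclidean_space n) U" "\<And>x. x \<in> U \<Longrightarrow> f x = g x" "C_diff n k U f"
  shows "C_diff n k U g"
  using assms(2,3)
proof (induction k arbitrary: f g)
  case 0
  have "U \<subseteq> Rn n" using assms(1) openin_Euclidean_subset by blast
  then show ?case using 0 by (simp add: continuous_map_Euclidean_sub cong: continuous_on_cong)
next
  case (Suc k)
  have U: "U \<subseteq> Rn n" using assms(1) openin_Euclidean_subset by blast
  have D: "((\<lambda>t. g (x(i := t))) has_real_derivative partial_derivative i f x) (at (x i))"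
    if "x \<in> U" "i < n" for x i
  proof -
    have "\<forall>\<^sub>F t in nhds (x i). f (x(i := t)) = g (x(i := t))"
      using eventually_fun_upd_in[OF assms(1) that] by eventually_elim (rule Suc.prems)
    from DERIV_cong_ev[OF refl this refl] show ?thesis
      using C_diff_DERIV[OF Suc.prems(2) that] by blast
  qed
  have "C_diff n k U (partial_derivative i g)" if "i < n" for i
  proof (rule Suc.IH)
    show "C_diff n k U (partial_derivative i f)" using Suc.prems that by simp
    show "partial_derivative i f x = partial_derivative i g x" if "x \<in> U" for x
      using D[OF that \<open>i < n\<close>] by (simp add: partial_derivative_def DERIV_imp_deriv)
  qed
  moreover have "continuous_on U g"
    using Suc.prems C_diff_continuous_on[OF Suc.prems(2) U] by (simp cong: continuous_on_cong)
  ultimately show ?case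
    using D U by (auto simp: continuous_map_Euclidean_sub field_differentiable_def)
qed

text \<open>The derivatives are given by explicit formulas \<open>D\<close> instead of
  \<open>partial_derivative\<close>, so that the product, quotient and chain rules can be supplied
  directly.\<close>

lemma C_diff_SucI:
  assumes U: "openin (Euclidean_space n) U" and "continuous_on U f"
    and D: "\<And>i x. i < n \<Longrightarrow> x \<in> U \<Longrightarrow> ((\<lambda>t. f (x(i := t))) has_real_derivative D i x) (at (x i))"
    and "\<And>i. i < n \<Longrightarrow> C_diff n k U (D i)"
  shows "C_diff n (Suc k) U f"
proof -
  have "C_diff n k U (partial_derivative i f)" if "i < n" for i
    by (rule C_diff_cong[OF U _ assms(4)[OF that]])
      (simp add: partial_derivative_def DERIV_imp_deriv[OF D[OF that]])
  moreover have "U \<subseteq> Rn n" using U openin_Euclidean_subset by blast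
  moreover have "(\<lambda>t. f (x(i := t))) field_differentiable at (x i)" if "i < n" "x \<in> U" for i x
    using D[OF that] unfolding field_differentiable_def by blast
  ultimately show ?thesis
    using assms(2) by (simp add: continuous_map_Euclidean_sub)
qed

lemma C_diff_SucD: "C_diff n (Suc k) U f \<Longrightarrow> C_diff n k U f"
  by (induction k arbitrary: f) auto

lemma C_diff_mono: "C_diff n k U f \<Longrightarrow> j \<le> k \<Longrightarrow> C_diff n j U f"
proof (induction k)
  case (Suc k)
  then show ?case using C_diff_SucD[OF Suc.prems(1)] by (cases "j = Suc k") auto
qed simp

lemma C_diff_subset:
  assumes "V \<subseteq> U" "U \<subseteq> Rn n" shows "C_diff n k U f \<Longrightarrow> C_diff n k V f"
proof (induction k arbitrary: f)
  case 0 with assms show ?case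
    by (auto simp: continuous_map_Euclidean_sub intro: continuous_on_subset)
next
  case (Suc k)
  have "V \<subseteq> Rn n" using assms by blast
  then have "continuous_on V f"
    using assms continuous_on_subset C_diff_continuous_on[OF Suc.prems assms(2)] by blast
  with Suc assms \<open>V \<subseteq> Rn n\<close> show ?case by (auto simp: continuous_map_Euclidean_sub)
qed

text \<open>Each clause of \<open>C_diff\<close> concerns one point at a time, continuity included,
  because an open \<open>V\<close> contains all points of \<open>U\<close> near \<open>x\<close>.
  Composites of maps between manifolds are later treated near one point in this way.\<close>

lemma C_diff_locally:
  assumes U: "U \<subseteq> Rn n"
    and "\<And>x. x \<in> U \<Longrightarrow> \<exists>V. openin (Euclidean_space n) V \<and> x \<in> V \<and> C_diff n k V f"
  shows "C_diff n k U f"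
  using assms(2)
proof (induction k arbitrary: f)
  have *: "continuous_on U f"
    if loc: "\<And>x. x \<in> U \<Longrightarrow> \<exists>V. openin (Euclidean_space n) V \<and> x \<in> V \<and> C_diff n k V f" for k f
  proof -
    have "continuous (at x within U) f" if x: "x \<in> U" for x
    proof -
      obtain V where V: "openin (Euclidean_space n) V" "x \<in> V" "C_diff n k V f"
        using loc[OF x] by blast
      then have "continuous_on V f" using C_diff_continuous_on openin_Euclidean_subset by blast
      then have c: "continuous (at x within V) f"
        using V(2) continuous_on_eq_continuous_within by blast
      obtain T where T: "open T" "V = Rn n \<inter> T"
        using V(1) unfolding Euclidean_space_eq openin_open by blast
      have "at x within U \<inter> T = at x within U"
        using T V by (intro at_within_nhd[of x T]) auto
      moreover have "continuous (at x within U \<inter> T) f"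
        using c T U by (auto intro: continuous_within_subset)
      ultimately show ?thesis by (simp add: continuous_within)
    qed
    then show ?thesis using continuous_on_eq_continuous_within by blast
  qed
  {
    case 0
    show ?case using *[OF 0] U by (simp add: continuous_map_Euclidean_sub)
  next
    case (Suc k)
    have "C_diff n k U (partial_derivative i f)" if "i < n" for i
      using Suc.prems that by (intro Suc.IH) (meson C_diff.simps(2))
    moreover have "(\<lambda>t. f (x(i := t))) field_differentiable at (x i)" if "x \<in> U" "i < n" for x i
      using Suc.prems[OF that(1)] that(2) by auto
    ultimately show ?case using *[OF Suc.prems] U by (simp add: continuous_map_Euclidean_sub)
  }
qed

lemma C_diff_const: "openin (Euclidean_space n) U \<Longrightarrow> C_diff n k U (\<lambda>x. c)"
proof (induction k arbitrary: c)
  case (Suc k)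
  show ?case by (rule C_diff_SucI[where D="\<lambda>i x. 0"]) (use Suc in auto)
qed simp

lemma C_diff_coord:
  assumes "openin (Euclidean_space n) U" shows "C_diff n k U (\<lambda>x. x j)"
proof (cases k)
  case 0 then show ?thesis using openin_Euclidean_subset[OF assms]
    by (simp add: continuous_map_Euclidean_sub continuous_on_subset[OF continuous_on_product_coordinates])
next
  case (Suc k)
  have "C_diff n (Suc k) U (\<lambda>x. x j)"
  proof (rule C_diff_SucI[where D="\<lambda>i x. if i = j then 1 else 0"])
    show "((\<lambda>t. (x(i := t)) j) has_real_derivative (if i = j then 1 else 0)) (at (x i))" for i x
      by auto
  qed (use assms in \<open>auto intro: C_diff_const continuous_on_subset[OF continuous_on_product_coordinates]\<close>)
  then show ?thesis using Suc by simp
qed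

lemma C_diff_add:
  assumes U: "openin (Euclidean_space n) U"
  shows "C_diff n k U f \<Longrightarrow> C_diff n k U g \<Longrightarrow> C_diff n k U (\<lambda>x. f x + g x)"
proof (induction k arbitrary: f g)
  case 0 then show ?case using U openin_Euclidean_subset[OF U]
    by (auto simp: continuous_map_Euclidean_sub intro: continuous_intros)
next
  case (Suc k)
  show ?case
  proof (rule C_diff_SucI[OF U, where D="\<lambda>i x. partial_derivative i f x + partial_derivative i g x"])
    show "continuous_on U (\<lambda>x. f x + g x)"
      using Suc.prems openin_Euclidean_subset[OF U] by (intro continuous_on_add) (rule C_diff_continuous_on; assumption)+
    show "((\<lambda>t. f (x(i := t)) + g (x(i := t))) has_real_derivative
            partial_derivative i f x + partial_derivative i g x) (at (x i))"
      if "i < n" "x \<in> U" for i x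
      by (rule DERIV_add[OF C_diff_DERIV[OF Suc.prems(1) that(2,1)] C_diff_DERIV[OF Suc.prems(2) that(2,1)]])
  qed (use Suc in auto)
qed

lemma C_diff_mult:
  assumes U: "openin (Euclidean_space n) U"
  shows "C_diff n k U f \<Longrightarrow> C_diff n k U g \<Longrightarrow> C_diff n k U (\<lambda>x. f x * g x)"
proof (induction k arbitrary: f g)
  case 0 then show ?case using U openin_Euclidean_subset[OF U]
    by (auto simp: continuous_map_Euclidean_sub intro: continuous_intros)
next
  case (Suc k)
  note S = C_diff_SucD[OF Suc.prems(1)] C_diff_SucD[OF Suc.prems(2)]
  show ?case
  proof (rule C_diff_SucI[OF U, where D="\<lambda>i x. f x * partial_derivative i g x + partial_derivative i f x * g x"])
    show "continuous_on U (\<lambda>x. f x * g x)"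
      using Suc.prems openin_Euclidean_subset[OF U] by (intro continuous_on_mult) (rule C_diff_continuous_on; assumption)+
    show "C_diff n k U (\<lambda>x. f x * partial_derivative i g x + partial_derivative i f x * g x)"
      if "i < n" for i
      using Suc that S by (intro C_diff_add[OF U] Suc.IH) auto
    show "((\<lambda>t. f (x(i := t)) * g (x(i := t))) has_real_derivative
            f x * partial_derivative i g x + partial_derivative i f x * g x) (at (x i))"
      if "i < n" "x \<in> U" for i x
      by (rule DERIV_cong[OF DERIV_mult[OF C_diff_DERIV[OF Suc.prems(1) that(2,1)]
              C_diff_DERIV[OF Suc.prems(2) that(2,1)]]]) (simp add: algebra_simps)
  qed
qed

lemma C_diff_inverse:
  assumes U: "openin (Euclidean_space n) U" and nz: "\<And>x. x \<in> U \<Longrightarrow> f x \<noteq> 0"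
  shows "C_diff n k U f \<Longrightarrow> C_diff n k U (\<lambda>x. inverse (f x))"
proof (induction k)
  case 0 then show ?case using U openin_Euclidean_subset[OF U] nz
    by (auto simp: continuous_map_Euclidean_sub intro: continuous_intros)
next
  case (Suc k)
  note S = C_diff_SucD[OF Suc.prems]
  show ?case
  \<comment> \<open>The minus sign is a constant factor and the square of the inverse a product, so
    that closure under products applies and the induction hypothesis covers both inverse
    factors.\<close>
  proof (rule C_diff_SucI[OF U, where D="\<lambda>i x. (-1) * (inverse (f x) * partial_derivative i f x * inverse (f x))"])
    show "continuous_on U (\<lambda>x. inverse (f x))"
      using C_diff_continuous_on[OF Suc.prems openin_Euclidean_subset[OF U]] nz
      by (auto intro!: continuous_on_inverse)
    show "C_diff n k U (\<lambda>x. (-1) * (inverse (f x) * partial_derivative i f x * inverse (f x)))"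
      if "i < n" for i
      using Suc that S by (intro C_diff_mult[OF U] Suc.IH C_diff_const[OF U]) auto
    show "((\<lambda>t. inverse (f (x(i := t)))) has_real_derivative
            (-1) * (inverse (f x) * partial_derivative i f x * inverse (f x))) (at (x i))"
      if "i < n" "x \<in> U" for i x
      by (rule DERIV_cong[OF DERIV_inverse'[OF C_diff_DERIV[OF Suc.prems that(2,1)]]])
        (use nz[OF that(2)] in simp_all)
  qed
qed

lemma C_diff_sum:
  assumes U: "openin (Euclidean_space n) U"
  shows "(\<And>a. a \<in> A \<Longrightarrow> C_diff n k U (f a)) \<Longrightarrow> C_diff n k U (\<lambda>x. \<Sum>a\<in>A. f a x)"
proof (induction A rule: infinite_finite_induct)
  case (insert a A)
  then show ?case using C_diff_add[OF U, of k "f a" "\<lambda>x. \<Sum>a\<in>A. f a x"] by simp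
qed (auto intro: C_diff_const[OF U])

lemma C_diff_diff:
  assumes U: "openin (Euclidean_space n) U" "C_diff n k U f" "C_diff n k U g"
  shows "C_diff n k U (\<lambda>x. f x - g x)"
  using C_diff_add[OF U(1,2) C_diff_mult[OF U(1) C_diff_const[OF U(1), of _ "-1"] U(3)]] by simp

section \<open>Mean value theorem, difference quotients and chain rule\<close>

lemma mvt_closed_segment:
  fixes g :: "real \<Rightarrow> real"
  assumes "\<And>t. t \<in> closed_segment a b \<Longrightarrow> (g has_real_derivative g' t) (at t)"
  shows "\<exists>t\<in>closed_segment a b. g b - g a = g' t * (b - a)"
proof -
  consider "a = b" | "a < b" | "b < a" by linarith
  then show ?thesis
  proof cases
    case 2
    then obtain t where "a < t" "t < b" "g b - g a = (b - a) * g' t"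
      using MVT2[of a b g g'] assms by (auto simp: closed_segment_eq_real_ivl)
    with 2 show ?thesis by (intro bexI[of _ t]) (auto simp: closed_segment_eq_real_ivl)
  next
    case 3
    then obtain t where "b < t" "t < a" "g a - g b = (a - b) * g' t"
      using MVT2[of b a g g'] assms by (auto simp: closed_segment_eq_real_ivl)
    with 3 show ?thesis by (intro bexI[of _ t]) (auto simp: closed_segment_eq_real_ivl algebra_simps)
  qed auto
qed

text \<open>The functions \<open>q j\<close> are the difference quotients that arise when the coordinates are changed one at a
  time, so that continuity of the partial derivatives gives their limits.\<close>

lemma caratheodory:
  assumes U: "openin (Euclidean_space n) U" and f: "C_diff n (Suc 0) U f" and x: "x \<in> U"
  obtains q where
    "\<And>y. y \<in> Rn n \<Longrightarrow> f y - f x = (\<Sum>j<n. q j y * (y j - x j))"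
    "\<And>(\<gamma> :: real \<Rightarrow> nat \<Rightarrow> real) F j. (\<And>i. i < n \<Longrightarrow> ((\<lambda>s. \<gamma> s i) \<longlongrightarrow> x i) F) \<Longrightarrow>
       \<forall>\<^sub>F s in F. \<gamma> s \<in> Rn n \<Longrightarrow> j < n \<Longrightarrow> ((\<lambda>s. q j (\<gamma> s)) \<longlongrightarrow> partial_derivative j f x) F"
proof -
  \<comment> \<open>\<open>p j y\<close> has the coordinates of \<open>y\<close> before index
    \<open>j\<close> and those of \<open>x\<close> from \<open>j\<close> on, so the increment of
    \<open>f\<close> telescopes along the path \<open>p 0 y = x\<close>, ...,
    \<open>p n y = y\<close>.\<close>
  define p where "p = (\<lambda>j y i. if i < j then y i else x i :: real)"
  \<comment> \<open>Where the quotient would be 0/0 it is given the value of the limit, so that the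
    limit statement needs no condition that the curve avoids these points.\<close>
  define q where "q = (\<lambda>j y. if y j = x j then partial_derivative j f x
                              else (f (p (Suc j) y) - f (p j y)) / (y j - x j))"
  have xR: "x \<in> Rn n" using U x openin_Euclidean_subset by blast
  have p_Suc: "p (Suc j) y = (p j y)(j := y j)" for j y
    by (auto simp: p_def fun_eq_iff less_Suc_eq)
  have p_same: "p (Suc j) y = p j y" if "y j = x j" for j y
    using that by (auto simp: p_def fun_eq_iff less_Suc_eq)
  have eq: "f y - f x = (\<Sum>j<n. q j y * (y j - x j))" if "y \<in> Rn n" for y
  proof -
    have "p n y = y" using that xR by (auto simp: p_def fun_eq_iff Rn_iff)
    moreover have "p 0 y = x" by (simp add: p_def)
    ultimately have "f y - f x = (\<Sum>j<n. f (p (Suc j) y) - f (p j y))"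
      by (simp add: sum_lessThan_telescope[of "\<lambda>j. f (p j y)"])
    also have "\<dots> = (\<Sum>j<n. q j y * (y j - x j))"
      by (intro sum.cong refl) (auto simp: q_def p_same)
    finally show ?thesis .
  qed
  obtain d where d: "d > 0" "\<And>y. y \<in> Rn n \<Longrightarrow> (\<And>i. i < n \<Longrightarrow> \<bar>y i - x i\<bar> < d) \<Longrightarrow> y \<in> U"
    using openin_Euclidean_boxE[OF U x] by metis
  \<comment> \<open>Changing coordinate \<open>j\<close> alone stays in the box around
    \<open>x\<close>, so the mean value theorem in one variable turns the quotient into a partial
    derivative at a point \<open>z\<close> that is in no coordinate farther from \<open>x\<close>
    than \<open>y\<close> is.\<close>
  have mvt: "\<exists>z\<in>Rn n. (\<forall>i<n. \<bar>z i - x i\<bar> \<le> \<bar>y i - x i\<bar>) \<and> q j y = partial_derivative j f z"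
    if y: "y \<in> Rn n" "\<And>i. i < n \<Longrightarrow> \<bar>y i - x i\<bar> < d" and j: "j < n" for y j
  proof (cases "y j = x j")
    case True then show ?thesis using xR by (intro bexI[of _ x]) (auto simp: q_def)
  next
    case False
    let ?z = "\<lambda>t. (p j y)(j := t)"
    have zR: "?z t \<in> Rn n" for t using xR y j by (auto simp: p_def Rn_iff)
    have zb: "\<bar>?z t i - x i\<bar> \<le> \<bar>y i - x i\<bar>" if "t \<in> closed_segment (x j) (y j)" for t i
      using that by (auto simp: p_def closed_segment_eq_real_ivl split: if_splits)
    have zU: "?z t \<in> U" if "t \<in> closed_segment (x j) (y j)" for t
      using zb[OF that] y(2) by (intro d(2)[OF zR]) (meson le_less_trans)
    have "\<exists>t\<in>closed_segment (x j) (y j). f (?z (y j)) - f (?z (x j)) =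
            partial_derivative j f (?z t) * (y j - x j)"
    proof (rule mvt_closed_segment)
      fix t assume t: "t \<in> closed_segment (x j) (y j)"
      show "((\<lambda>t. f (?z t)) has_real_derivative partial_derivative j f (?z t)) (at t)"
        using C_diff_DERIV[OF f zU[OF t] j] by simp
    qed
    then obtain t where t: "t \<in> closed_segment (x j) (y j)"
      "f (?z (y j)) - f (?z (x j)) = partial_derivative j f (?z t) * (y j - x j)" by blast
    have "?z (x j) = p j y" by (auto simp: p_def)
    then have "q j y = partial_derivative j f (?z t)"
      using t(2) False by (simp add: q_def p_Suc)
    with zR zb[OF t(1)] show ?thesis by blast
  qed
  have lim: "((\<lambda>s. q j (\<gamma> s)) \<longlongrightarrow> partial_derivative j f x) F"
    if \<gamma>: "\<And>i. i < n \<Longrightarrow> ((\<lambda>s. \<gamma> s i) \<longlongrightarrow> x i) F" "\<forall>\<^sub>F s in F. \<gamma> s \<in> Rn n" and j: "j < n"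
    for \<gamma> :: "real \<Rightarrow> nat \<Rightarrow> real" and F j
  proof (rule tendstoI)
    fix e :: real assume e: "e > 0"
    have c: "continuous_on U (partial_derivative j f)"
      using f j openin_Euclidean_subset[OF U] by (simp add: continuous_map_Euclidean_sub)
    have "openin (top_of_set U) (U \<inter> partial_derivative j f -` ball (partial_derivative j f x) e)"
      using c by (intro continuous_openin_preimage_gen) auto
    then have "openin (Euclidean_space n) (U \<inter> partial_derivative j f -` ball (partial_derivative j f x) e)"
      using U unfolding Euclidean_space_eq using openin_trans by blast
    moreover have "x \<in> U \<inter> partial_derivative j f -` ball (partial_derivative j f x) e"
      using x e by auto
    ultimately obtain d' where d': "d' > 0" "\<And>y. y \<in> Rn n \<Longrightarrow> (\<And>i. i < n \<Longrightarrow> \<bar>y i - x i\<bar> < d')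
        \<Longrightarrow> y \<in> U \<inter> partial_derivative j f -` ball (partial_derivative j f x) e"
      using openin_Euclidean_boxE by metis
    have "\<forall>\<^sub>F s in F. \<gamma> s \<in> {y \<in> Rn n. \<forall>i<n. \<bar>y i - x i\<bar> < min d d'}"
      by (rule eventually_in_openin_Euclidean[OF openin_Euclidean_box _ \<gamma>]) (use xR d(1) d'(1) in auto)
    then show "\<forall>\<^sub>F s in F. dist (q j (\<gamma> s)) (partial_derivative j f x) < e"
    proof eventually_elim
      case (elim s)
      then obtain z where z: "z \<in> Rn n" "\<forall>i<n. \<bar>z i - x i\<bar> \<le> \<bar>\<gamma> s i - x i\<bar>"
        "q j (\<gamma> s) = partial_derivative j f z"
        using mvt[of "\<gamma> s" j] j by auto
      with elim have "z \<in> U \<inter> partial_derivative j f -` ball (partial_derivative j f x) e"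
        by (intro d'(2)) (auto intro: le_less_trans)
      then show ?case using z(3) by (simp add: dist_commute)
    qed
  qed
  show ?thesis using that[OF eq lim] by blast
qed

text \<open>Divide the increment formula of \<open>caratheodory\<close> by \<open>s - t\<close> and
  pass to the limit in each summand. The formula holds on all of \<open>Rn n\<close>, so the curve
  need not be confined to \<open>U\<close> beforehand.\<close>

lemma DERIV_along_curve:
  assumes U: "openin (Euclidean_space n) U" and f: "C_diff n (Suc k) U f" and x: "\<gamma> t \<in> U"
    and \<gamma>: "\<And>j. j < n \<Longrightarrow> ((\<lambda>s. \<gamma> s j) has_real_derivative v j) (at t)"
    and R: "\<forall>\<^sub>F s in at t. \<gamma> s \<in> Rn n"
  shows "((\<lambda>s. f (\<gamma> s)) has_real_derivative (\<Sum>j<n. partial_derivative j f (\<gamma> t) * v j)) (at t)"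
proof -
  have f1: "C_diff n (Suc 0) U f" using C_diff_mono[OF f, of "Suc 0"] by (simp del: C_diff.simps)
  obtain q where q: "\<And>y. y \<in> Rn n \<Longrightarrow> f y - f (\<gamma> t) = (\<Sum>j<n. q j y * (y j - \<gamma> t j))"
    "\<And>(\<gamma>' :: real \<Rightarrow> nat \<Rightarrow> real) F j. (\<And>i. i < n \<Longrightarrow> ((\<lambda>s. \<gamma>' s i) \<longlongrightarrow> \<gamma> t i) F) \<Longrightarrow>
       \<forall>\<^sub>F s in F. \<gamma>' s \<in> Rn n \<Longrightarrow> j < n \<Longrightarrow> ((\<lambda>s. q j (\<gamma>' s)) \<longlongrightarrow> partial_derivative j f (\<gamma> t)) F"
    by (rule caratheodory[OF U f1 x]) blast
  have c: "((\<lambda>s. \<gamma> s i) \<longlongrightarrow> \<gamma> t i) (at t)" if "i < n" for i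
    using DERIV_isCont[OF \<gamma>[OF that]] by (simp add: isCont_def)
  have "((\<lambda>s. \<Sum>j<n. q j (\<gamma> s) * ((\<gamma> s j - \<gamma> t j) / (s - t))) \<longlongrightarrow>
          (\<Sum>j<n. partial_derivative j f (\<gamma> t) * v j)) (at t)"
    using \<gamma> by (intro tendsto_sum tendsto_mult q(2) c R) (auto simp: has_field_derivative_iff)
  moreover have "\<forall>\<^sub>F s in at t. (\<Sum>j<n. q j (\<gamma> s) * ((\<gamma> s j - \<gamma> t j) / (s - t))) = (f (\<gamma> s) - f (\<gamma> t)) / (s - t)"
    using R by eventually_elim (simp add: q(1) sum_divide_distrib)
  ultimately show ?thesis
    unfolding has_field_derivative_iff by (rule Lim_transform_eventually)
qed

text \<open>Induction on \<open>k\<close> with \<open>g\<close> fixed: the chain rule expresses each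
  partial derivative as a sum of products of \<open>partial_derivative j f\<close> composed with
  \<open>g\<close> and of partial derivatives of \<open>g\<close>, and the induction hypothesis
  applies to the former.\<close>

lemma C_diff_compose:
  assumes U: "openin (Euclidean_space n) U" and V: "openin (Euclidean_space m) V"
    and gU: "\<And>x. x \<in> V \<Longrightarrow> g x \<in> U"
  shows "C_diff n k U f \<Longrightarrow> (\<And>j. j < n \<Longrightarrow> C_diff m k V (\<lambda>x. g x j)) \<Longrightarrow> C_diff m k V (\<lambda>x. f (g x))"
proof (induction k arbitrary: f)
  have UR: "U \<subseteq> Rn n" and VR: "V \<subseteq> Rn m" using U V openin_Euclidean_subset by blast+
  have *: "continuous_on V (\<lambda>x. f (g x))"
    if f: "C_diff n k U f" and g: "\<And>j. j < n \<Longrightarrow> C_diff m k V (\<lambda>x. g x j)" for f k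
  proof -
    have "continuous_on V (\<lambda>x. g x j)" for j
    proof (cases "j < n")
      case True then show ?thesis using g C_diff_continuous_on VR by blast
    next
      \<comment> \<open>The coordinates of \<open>g x\<close> from \<open>n\<close> on vanish
        because \<open>g\<close> maps into \<open>U\<close>, a subset of
        \<open>Rn n\<close>.\<close>
      case False
      then have "g x j = 0" if "x \<in> V" for x using gU[OF that] UR Rn_iff not_less by blast
      then show ?thesis by (simp cong: continuous_on_cong)
    qed
    then have "continuous_on V g" by (rule continuous_on_coordinatewise_then_product)
    moreover have "continuous_on U f" using f C_diff_continuous_on UR by blast
    ultimately show ?thesis using continuous_on_compose2[of U f V g] gU by blast
  qed
  {
    case 0
    have "continuous_on V (\<lambda>x. f (g x))" by (rule *[OF 0(1)]) (rule 0(2))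
    then show ?case unfolding C_diff.simps continuous_map_Euclidean_sub[OF VR] .
  next
    case (Suc k)
    have c: "continuous_on V (\<lambda>x. f (g x))" by (rule *[OF Suc.prems(1)]) (rule Suc.prems(2))
    show ?case
    proof (rule C_diff_SucI[OF V c, where
          D="\<lambda>i x. \<Sum>j<n. partial_derivative j f (g x) * partial_derivative i (\<lambda>x. g x j) x"])
      fix i assume i: "i < m"
      show "C_diff m k V (\<lambda>x. \<Sum>j<n. partial_derivative j f (g x) * partial_derivative i (\<lambda>x. g x j) x)"
      proof (intro C_diff_sum[OF V] C_diff_mult[OF V])
        fix j assume j: "j \<in> {..<n}"
        show "C_diff m k V (\<lambda>x. partial_derivative j f (g x))"
        proof (rule Suc.IH)
          show "C_diff n k U (partial_derivative j f)" using Suc.prems(1) j by simp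
          show "C_diff m k V (\<lambda>x. g x j)" if "j < n" for j
            using C_diff_SucD[OF Suc.prems(2)[OF that]] .
        qed
        show "C_diff m k V (partial_derivative i (\<lambda>x. g x j))" using Suc.prems(2)[of j] i j by simp
      qed
      fix x assume x: "x \<in> V"
      have xi: "(g (x(i := t)) :: nat \<Rightarrow> real) \<in> Rn n" if "x(i := t) \<in> V" for t
        using gU[OF that] UR by blast
      have "\<forall>\<^sub>F t in at (x i). g (x(i := t)) \<in> Rn n"
        using eventually_fun_upd_in[OF V x i] unfolding eventually_nhds_conv_at
        by (auto elim: eventually_mono intro: xi)
      from DERIV_along_curve[OF U Suc.prems(1) _ _ this, of "\<lambda>j. partial_derivative i (\<lambda>x. g x j) x"]
      show "((\<lambda>t. f (g (x(i := t)))) has_real_derivative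
          (\<Sum>j<n. partial_derivative j f (g x) * partial_derivative i (\<lambda>x. g x j) x)) (at (x i))"
        using gU[OF x] C_diff_DERIV[OF Suc.prems(2) x i] by simp
    qed
  }
qed

section \<open>Smooth functions and maps\<close>

definition C_inf :: "nat \<Rightarrow> (nat \<Rightarrow> real) set \<Rightarrow> ((nat \<Rightarrow> real) \<Rightarrow> real) \<Rightarrow> bool" where
  "C_inf n U f \<longleftrightarrow> (\<forall>k. C_diff n k U f)"

lemma smooth_on_C_inf: "smooth_on n m U f \<longleftrightarrow> (\<forall>j<m. C_inf n U (\<lambda>x. f x j))"
  by (simp add: smooth_on_def C_inf_def)

lemma C_inf_partial_derivative: "C_inf n U f \<Longrightarrow> i < n \<Longrightarrow> C_inf n U (partial_derivative i f)"
  unfolding C_inf_def by (metis C_diff.simps(2))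

lemma C_inf_DERIV:
  "C_inf n U f \<Longrightarrow> x \<in> U \<Longrightarrow> i < n \<Longrightarrow>
   ((\<lambda>t. f (x(i := t))) has_real_derivative partial_derivative i f x) (at (x i))"
  by (rule C_diff_DERIV[of n 0]) (auto simp: C_inf_def simp del: C_diff.simps)

lemma C_inf_continuous_on: "C_inf n U f \<Longrightarrow> U \<subseteq> Rn n \<Longrightarrow> continuous_on U f"
  unfolding C_inf_def by (meson C_diff_continuous_on)

lemma C_inf_subset: "C_inf n U f \<Longrightarrow> V \<subseteq> U \<Longrightarrow> U \<subseteq> Rn n \<Longrightarrow> C_inf n V f"
  unfolding C_inf_def by (meson C_diff_subset)

lemma C_inf_compose:
  assumes "openin (Euclidean_space n) U" "openin (Euclidean_space m) V"
    and "\<And>x. x \<in> V \<Longrightarrow> g x \<in> U" "C_inf n U f" "\<And>j. j < n \<Longrightarrow> C_inf m V (\<lambda>x. g x j)"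
  shows "C_inf m V (\<lambda>x. f (g x))"
  using assms C_diff_compose[of n U m V g] unfolding C_inf_def by blast

lemma smooth_on_compose:
  assumes "openin (Euclidean_space n) U" "openin (Euclidean_space m) V"
    and "\<And>x. x \<in> V \<Longrightarrow> g x \<in> U" "smooth_on n l U f" "smooth_on m n V g"
  shows "smooth_on m l V (f \<circ> g)"
  using assms C_inf_compose[of n U m V g] unfolding smooth_on_C_inf comp_def by blast

lemma smooth_on_subset: "smooth_on n m U f \<Longrightarrow> V \<subseteq> U \<Longrightarrow> U \<subseteq> Rn n \<Longrightarrow> smooth_on n m V f"
  unfolding smooth_on_C_inf by (meson C_inf_subset)

lemma smooth_on_cong:
  assumes "openin (Euclidean_space n) U" "\<And>x. x \<in> U \<Longrightarrow> f x = g x" "smooth_on n m U f"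
  shows "smooth_on n m U g"
proof -
  have "C_diff n k U (\<lambda>x. g x j)" if "j < m" for j k
    by (rule C_diff_cong[OF assms(1), of "\<lambda>x. f x j"]) (use assms that in \<open>auto simp: smooth_on_def\<close>)
  then show ?thesis by (simp add: smooth_on_def)
qed

lemma smooth_on_locally:
  assumes "U \<subseteq> Rn n"
    and "\<And>x. x \<in> U \<Longrightarrow> \<exists>V. openin (Euclidean_space n) V \<and> x \<in> V \<and> smooth_on n m V f"
  shows "smooth_on n m U f"
  unfolding smooth_on_def
proof (intro allI impI)
  fix j k assume "j < m"
  show "C_diff n k U (\<lambda>x. f x j)"
  proof (rule C_diff_locally[OF assms(1)])
    fix x assume "x \<in> U"
    then obtain V where "openin (Euclidean_space n) V" "x \<in> V" "smooth_on n m V f"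
      using assms(2) by blast
    then show "\<exists>V. openin (Euclidean_space n) V \<and> x \<in> V \<and> C_diff n k V (\<lambda>x. f x j)"
      using \<open>j < m\<close> unfolding smooth_on_def by blast
  qed
qed

lemma smooth_on_ident: "openin (Euclidean_space n) U \<Longrightarrow> smooth_on n m U (\<lambda>x. x)"
  by (simp add: smooth_on_def C_diff_coord)

section \<open>First and second order estimates on boxes\<close>

lemma box_common_radius:
  fixes P :: "'a \<Rightarrow> (nat \<Rightarrow> real) \<Rightarrow> bool"
  assumes "finite A"
    and "\<And>a. a \<in> A \<Longrightarrow> \<exists>d>0. \<forall>y\<in>Rn n. (\<forall>i<n. \<bar>y i - x i\<bar> < d) \<longrightarrow> P a y"
  shows "\<exists>d>0. \<forall>y\<in>Rn n. (\<forall>i<n. \<bar>y i - x i\<bar> < d) \<longrightarrow> (\<forall>a\<in>A. P a y)"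
  using assms
proof (induction A)
  case empty show ?case by (auto intro: exI[of _ 1])
next
  case (insert a A)
  obtain d where d: "d > 0" "\<forall>y\<in>Rn n. (\<forall>i<n. \<bar>y i - x i\<bar> < d) \<longrightarrow> (\<forall>a\<in>A. P a y)"
    using insert by blast
  obtain e where e: "e > 0" "\<forall>y\<in>Rn n. (\<forall>i<n. \<bar>y i - x i\<bar> < e) \<longrightarrow> P a y"
    using insert.prems by blast
  show ?case
    using d e by (intro exI[of _ "min d e"]) auto
qed

lemma C_diff_box_close:
  assumes U: "openin (Euclidean_space n) U" and f: "C_diff n k U f" and x: "x \<in> U" and e: "e > 0"
  shows "\<exists>d>0. \<forall>y\<in>Rn n. (\<forall>i<n. \<bar>y i - x i\<bar> < d) \<longrightarrow> y \<in> U \<and> \<bar>f y - f x\<bar> < e"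
proof -
  have "continuous_on U f" using f C_diff_continuous_on openin_Euclidean_subset[OF U] by blast
  then have "openin (top_of_set U) (U \<inter> f -` ball (f x) e)"
    by (intro continuous_openin_preimage_gen) auto
  then have "openin (Euclidean_space n) (U \<inter> f -` ball (f x) e)"
    using U unfolding Euclidean_space_eq using openin_trans by blast
  moreover have "x \<in> U \<inter> f -` ball (f x) e" using x e by auto
  ultimately obtain d where "d > 0" "\<And>y. y \<in> Rn n \<Longrightarrow> (\<And>i. i < n \<Longrightarrow> \<bar>y i - x i\<bar> < d)
      \<Longrightarrow> y \<in> U \<inter> f -` ball (f x) e"
    by (rule openin_Euclidean_boxE) blast
  then show ?thesis by (intro exI[of _ d]) (auto simp: dist_real_def abs_minus_commute)
qed

definition line :: "(nat \<Rightarrow> real) \<Rightarrow> (nat \<Rightarrow> real) \<Rightarrow> real \<Rightarrow> nat \<Rightarrow> real" where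
  "line x y t i = x i + t * (y i - x i)"

lemma line_0 [simp]: "line x y 0 = x" and line_1 [simp]: "line x y 1 = y"
  by (auto simp: line_def)

lemma line_in_Rn: "x \<in> Rn n \<Longrightarrow> y \<in> Rn n \<Longrightarrow> line x y t \<in> Rn n"
  by (auto simp: line_def Rn_iff)

lemma line_abs_diff_less:
  assumes "\<bar>x i - c i\<bar> < d" "\<bar>y i - c i\<bar> < d" "0 \<le> t" "t \<le> 1"
  shows "\<bar>line x y t i - c i\<bar> < d"
proof -
  have "x i \<in> ball (c i) d" "y i \<in> ball (c i) d" using assms by (auto simp: dist_real_def abs_minus_commute)
  then have "(1 - t) *\<^sub>R x i + t *\<^sub>R y i \<in> ball (c i) d"
    using assms by (intro convexD[OF convex_ball]) auto
  then show ?thesis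
    by (simp add: line_def dist_real_def abs_minus_commute algebra_simps)
qed

lemma mvt_line:
  assumes U: "openin (Euclidean_space n) U" and f: "C_diff n (Suc k) U f"
    and xy: "x \<in> Rn n" "y \<in> Rn n" "\<And>t. 0 \<le> t \<Longrightarrow> t \<le> 1 \<Longrightarrow> line x y t \<in> U"
  shows "\<exists>t. 0 \<le> t \<and> t \<le> 1 \<and> f y - f x = (\<Sum>i<n. partial_derivative i f (line x y t) * (y i - x i))"
proof -
  have "\<exists>t\<in>closed_segment 0 1. f (line x y 1) - f (line x y 0) =
          (\<Sum>i<n. partial_derivative i f (line x y t) * (y i - x i)) * (1 - 0)"
  proof (rule mvt_closed_segment)
    fix t :: real assume t: "t \<in> closed_segment 0 1"
    show "((\<lambda>t. f (line x y t)) has_real_derivative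
            (\<Sum>i<n. partial_derivative i f (line x y t) * (y i - x i))) (at t)"
    proof (rule DERIV_along_curve[OF U f])
      show "line x y t \<in> U" using t xy(3) by (simp add: closed_segment_eq_real_ivl)
      show "((\<lambda>s. line x y s j) has_real_derivative y j - x j) (at t)" for j
        unfolding line_def by (auto intro!: derivative_eq_intros)
    qed (simp add: line_in_Rn xy)
  qed
  then show ?thesis by (auto simp: closed_segment_eq_real_ivl)
qed

lemma lipschitz_bound:
  assumes U: "openin (Euclidean_space n) U" and f: "C_diff n (Suc k) U f"
    and xy: "x \<in> Rn n" "y \<in> Rn n" "\<And>t. 0 \<le> t \<Longrightarrow> t \<le> 1 \<Longrightarrow> line x y t \<in> U"
    and M: "\<And>t i. 0 \<le> t \<Longrightarrow> t \<le> 1 \<Longrightarrow> i < n \<Longrightarrow> \<bar>partial_derivative i f (line x y t)\<bar> \<le> M"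
  shows "\<bar>f y - f x\<bar> \<le> M * (\<Sum>i<n. \<bar>y i - x i\<bar>)"
proof -
  obtain t where t: "0 \<le> t" "t \<le> 1"
    "f y - f x = (\<Sum>i<n. partial_derivative i f (line x y t) * (y i - x i))"
    using mvt_line[OF U f xy] by auto
  have "\<bar>f y - f x\<bar> \<le> (\<Sum>i<n. \<bar>partial_derivative i f (line x y t) * (y i - x i)\<bar>)"
    unfolding t(3) by (rule sum_abs)
  also have "\<dots> \<le> (\<Sum>i<n. M * \<bar>y i - x i\<bar>)"
    using M[OF t(1,2)] by (intro sum_mono) (auto simp: abs_mult intro: mult_right_mono)
  finally show ?thesis by (simp add: sum_distrib_left)
qed

text \<open>On a box around \<open>c\<close> the partial derivatives of orders one and two stay
  within 1 of their values at \<open>c\<close>. The mean value theorem for \<open>f\<close> gives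
  the Lipschitz bound; applied again to the partial derivatives it gives the quadratic bound for the
  error of the tangent.\<close>

lemma local_C2_bounds:
  assumes U: "openin (Euclidean_space n) U" and f: "C_inf n U f" and c: "c \<in> U"
  shows "\<exists>M\<ge>0. \<exists>d>0. \<forall>x\<in>Rn n. \<forall>y\<in>Rn n.
      (\<forall>i<n. \<bar>x i - c i\<bar> < d) \<longrightarrow> (\<forall>i<n. \<bar>y i - c i\<bar> < d) \<longrightarrow>
      x \<in> U \<and> \<bar>f y - f x\<bar> \<le> M * (\<Sum>i<n. \<bar>y i - x i\<bar>) \<and>
      \<bar>f y - f x - (\<Sum>i<n. partial_derivative i f x * (y i - x i))\<bar> \<le> M * (\<Sum>i<n. \<bar>y i - x i\<bar>)\<^sup>2"
proof -
  \<comment> \<open>Any number works that exceeds each first and second partial derivative at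
    \<open>c\<close> in absolute value by at least 1; sums also cover \<open>n = 0\<close>.\<close>
  define M where "M = 1 + (\<Sum>i<n. \<bar>partial_derivative i f c\<bar>) +
     (\<Sum>i<n. \<Sum>j<n. \<bar>partial_derivative j (partial_derivative i f) c\<bar>)"
  have M1: "1 + \<bar>partial_derivative i f c\<bar> \<le> M" if "i < n" for i
  proof -
    have "\<bar>partial_derivative i f c\<bar> \<le> (\<Sum>i<n. \<bar>partial_derivative i f c\<bar>)"
      using that by (intro member_le_sum) auto
    moreover have "0 \<le> (\<Sum>i<n. \<Sum>j<n. \<bar>partial_derivative j (partial_derivative i f) c\<bar>)"
      by (intro sum_nonneg) auto
    ultimately show ?thesis by (simp add: M_def)
  qed
  have M2: "1 + \<bar>partial_derivative j (partial_derivative i f) c\<bar> \<le> M" if "i < n" "j < n" for i j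
  proof -
    have "\<bar>partial_derivative j (partial_derivative i f) c\<bar> \<le>
        (\<Sum>j<n. \<bar>partial_derivative j (partial_derivative i f) c\<bar>)"
      using that by (intro member_le_sum) auto
    also have "\<dots> \<le> (\<Sum>i<n. \<Sum>j<n. \<bar>partial_derivative j (partial_derivative i f) c\<bar>)"
      using that by (intro member_le_sum) (auto intro: sum_nonneg)
    finally have "\<bar>partial_derivative j (partial_derivative i f) c\<bar> \<le>
      (\<Sum>i<n. \<Sum>j<n. \<bar>partial_derivative j (partial_derivative i f) c\<bar>)" .
    moreover have "0 \<le> (\<Sum>i<n. \<bar>partial_derivative i f c\<bar>)" by (intro sum_nonneg) auto
    ultimately show ?thesis unfolding M_def by linarith
  qed
  have M0: "M \<ge> 0" by (auto simp: M_def intro!: add_nonneg_nonneg sum_nonneg)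
  have D1: "C_diff n (Suc 0) U (partial_derivative i f)" if "i < n" for i
    using C_inf_partial_derivative[OF f that] unfolding C_inf_def by blast
  have D2: "C_diff n 0 U (partial_derivative j (partial_derivative i f))" if "i < n" "j < n" for i j
    using C_inf_partial_derivative[OF C_inf_partial_derivative[OF f that(1)] that(2)]
    unfolding C_inf_def by blast
  have "\<exists>d>0. \<forall>y\<in>Rn n. (\<forall>i<n. \<bar>y i - c i\<bar> < d) \<longrightarrow>
      (\<forall>i\<in>{..<n}. y \<in> U \<and> \<bar>partial_derivative i f y - partial_derivative i f c\<bar> < 1)"
    by (rule box_common_radius) (use C_diff_box_close[OF U D1 c zero_less_one] in auto)
  then obtain d1 where d1: "d1 > 0" "\<And>y i. y \<in> Rn n \<Longrightarrow> \<forall>i<n. \<bar>y i - c i\<bar> < d1 \<Longrightarrow> i < n \<Longrightarrow>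
      \<bar>partial_derivative i f y - partial_derivative i f c\<bar> < 1" by auto
  have "\<exists>d>0. \<forall>y\<in>Rn n. (\<forall>i<n. \<bar>y i - c i\<bar> < d) \<longrightarrow>
      (\<forall>p\<in>{..<n} \<times> {..<n}. y \<in> U \<and> \<bar>partial_derivative (snd p) (partial_derivative (fst p) f) y -
          partial_derivative (snd p) (partial_derivative (fst p) f) c\<bar> < 1)"
    by (rule box_common_radius) (use C_diff_box_close[OF U D2 c zero_less_one] in auto)
  then obtain d2 where d2: "d2 > 0" "\<And>y i j. y \<in> Rn n \<Longrightarrow> \<forall>i<n. \<bar>y i - c i\<bar> < d2 \<Longrightarrow> i < n \<Longrightarrow> j < n \<Longrightarrow>
      \<bar>partial_derivative j (partial_derivative i f) y - partial_derivative j (partial_derivative i f) c\<bar> < 1"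
    by (auto simp: Ball_def)
  obtain d3 where d3: "d3 > 0" "\<And>y. y \<in> Rn n \<Longrightarrow> (\<And>i. i < n \<Longrightarrow> \<bar>y i - c i\<bar> < d3) \<Longrightarrow> y \<in> U"
    by (rule openin_Euclidean_boxE[OF U c]) blast
  define d where "d = min d1 (min d2 d3)"
  have "d > 0" using d1 d2 d3 by (simp add: d_def)
  moreover have "x \<in> U \<and> \<bar>f y - f x\<bar> \<le> M * (\<Sum>i<n. \<bar>y i - x i\<bar>) \<and>
      \<bar>f y - f x - (\<Sum>i<n. partial_derivative i f x * (y i - x i))\<bar> \<le> M * (\<Sum>i<n. \<bar>y i - x i\<bar>)\<^sup>2"
    if x: "x \<in> Rn n" "\<forall>i<n. \<bar>x i - c i\<bar> < d" and y: "y \<in> Rn n" "\<forall>i<n. \<bar>y i - c i\<bar> < d" for x y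
  proof (intro conjI)
    have b: "\<forall>i<n. \<bar>line x z t i - c i\<bar> < d"
      if "z \<in> Rn n" "\<forall>i<n. \<bar>z i - c i\<bar> < d" "0 \<le> t" "t \<le> 1" for t z
      using line_abs_diff_less[of x _ c d z t] x that by auto
    have lU: "line x z t \<in> U" if "z \<in> Rn n" "\<forall>i<n. \<bar>z i - c i\<bar> < d" "0 \<le> t" "t \<le> 1" for t z
      using b[OF that] line_in_Rn[OF x(1) that(1)] by (intro d3(2)) (auto simp: d_def)
    show "x \<in> U" using lU[OF y, of 0] by simp
    have f1: "C_diff n (Suc 0) U f" using f unfolding C_inf_def by blast
    show "\<bar>f y - f x\<bar> \<le> M * (\<Sum>i<n. \<bar>y i - x i\<bar>)"
    proof (rule lipschitz_bound[OF U f1 x(1) y(1) lU[OF y]])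
      fix t :: real and i assume t: "0 \<le> t" "t \<le> 1" "i < n"
      show "\<bar>partial_derivative i f (line x y t)\<bar> \<le> M"
        using d1(2)[OF line_in_Rn[OF x(1) y(1)], of t i] b[OF y t(1,2)] M1[OF t(3)] t(3)
        by (force simp: d_def)
    qed
    obtain t where t: "0 \<le> t" "t \<le> 1"
      "f y - f x = (\<Sum>i<n. partial_derivative i f (line x y t) * (y i - x i))"
      using mvt_line[OF U f1 x(1) y(1) lU[OF y]] by auto
    let ?z = "line x y t"
    have z: "?z \<in> Rn n" "\<forall>i<n. \<bar>?z i - c i\<bar> < d" using b[OF y t(1,2)] line_in_Rn[OF x(1) y(1)] by auto
    \<comment> \<open>\<open>f y - f x\<close> is the derivative at the intermediate point
      \<open>?z\<close> applied to \<open>y - x\<close>. Replacing \<open>?z\<close> by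
      \<open>x\<close> costs at most this much, which contributes the second factor of the quadratic
      bound.\<close>
    have L: "\<bar>partial_derivative i f ?z - partial_derivative i f x\<bar> \<le> M * (\<Sum>i<n. \<bar>y i - x i\<bar>)"
      if i: "i < n" for i
    proof -
      have "\<bar>partial_derivative i f ?z - partial_derivative i f x\<bar> \<le> M * (\<Sum>i<n. \<bar>?z i - x i\<bar>)"
      proof (rule lipschitz_bound[OF U D1[OF i] x(1) z(1) lU[OF z]])
        fix s :: real and j assume s: "0 \<le> s" "s \<le> 1" "j < n"
        show "\<bar>partial_derivative j (partial_derivative i f) (line x ?z s)\<bar> \<le> M"
          using d2(2)[OF line_in_Rn[OF x(1) z(1)], of s i j] b[OF z s(1,2)] M2[OF i s(3)] s(3) i
          by (force simp: d_def)
      qed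
      also have "\<dots> \<le> M * (\<Sum>i<n. \<bar>y i - x i\<bar>)"
        using t M0 by (intro mult_left_mono sum_mono) (auto simp: line_def abs_mult intro: mult_left_le_one_le)
      finally show ?thesis .
    qed
    have "\<bar>f y - f x - (\<Sum>i<n. partial_derivative i f x * (y i - x i))\<bar> =
        \<bar>\<Sum>i<n. (partial_derivative i f ?z - partial_derivative i f x) * (y i - x i)\<bar>"
      unfolding t(3) by (simp add: sum_subtractf left_diff_distrib)
    also have "\<dots> \<le> (\<Sum>i<n. \<bar>(partial_derivative i f ?z - partial_derivative i f x) * (y i - x i)\<bar>)"
      by (rule sum_abs)
    also have "\<dots> \<le> (\<Sum>i<n. (M * (\<Sum>i<n. \<bar>y i - x i\<bar>)) * \<bar>y i - x i\<bar>)"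
      using L by (intro sum_mono) (auto simp: abs_mult intro!: mult_right_mono)
    also have "\<dots> = M * (\<Sum>i<n. \<bar>y i - x i\<bar>)\<^sup>2"
      by (simp add: power2_eq_square sum_distrib_left[symmetric] mult.assoc)
    finally show "\<bar>f y - f x - (\<Sum>i<n. partial_derivative i f x * (y i - x i))\<bar> \<le> M * (\<Sum>i<n. \<bar>y i - x i\<bar>)\<^sup>2" .
  qed
  ultimately show ?thesis using M0 by blast
qed

section \<open>Cells\<close>

text \<open>Compactness of the sets \<open>{f \<le> - e}\<close> says that \<open>f\<close> tends to zero at the boundary of \<open>B\<close>; convexity of \<open>f\<close>
  is expressed through its tangents.\<close>

definition cell :: "nat \<Rightarrow> (nat \<Rightarrow> real) set \<Rightarrow> ((nat \<Rightarrow> real) \<Rightarrow> real) \<Rightarrow> bool" where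
  "cell n B f \<longleftrightarrow> openin (Euclidean_space n) B \<and> C_inf n B f \<and> (\<forall>x\<in>B. f x < 0) \<and>
     (\<forall>e>0. compact {x \<in> B. f x \<le> - e}) \<and>
     (\<forall>x\<in>B. \<forall>y\<in>B. f x + (\<Sum>i<n. partial_derivative i f x * (y i - x i)) \<le> f y) \<and>
     (\<forall>x\<in>B. \<forall>y\<in>B. \<forall>t. 0 \<le> t \<longrightarrow> t \<le> 1 \<longrightarrow> line x y t \<in> B)"

definition ball_Rn :: "nat \<Rightarrow> (nat \<Rightarrow> real) \<Rightarrow> real \<Rightarrow> (nat \<Rightarrow> real) set" where
  "ball_Rn n c r = {u \<in> Rn n. (\<Sum>i<n. (u i - c i)\<^sup>2) < r\<^sup>2}"

text \<open>The last argument bounds the squared distance. It may be negative, as happens for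
  \<open>r\<^sup>2 - e\<close> below, and the set is then empty.\<close>

definition cball_Rn :: "nat \<Rightarrow> (nat \<Rightarrow> real) \<Rightarrow> real \<Rightarrow> (nat \<Rightarrow> real) set" where
  "cball_Rn n c s = {u \<in> Rn n. (\<Sum>i<n. (u i - c i)\<^sup>2) \<le> s}"

lemma continuous_on_sum_squares: "continuous_on A (\<lambda>u::nat \<Rightarrow> real. \<Sum>i<n. (u i - c i)\<^sup>2)"
  by (intro continuous_intros continuous_on_subset[OF continuous_on_product_coordinates]) auto

lemma openin_ball_Rn: "openin (Euclidean_space n) (ball_Rn n c r)"
proof -
  have "open {u::nat \<Rightarrow> real. (\<Sum>i<n. (u i - c i)\<^sup>2) < r\<^sup>2}"
    by (intro open_Collect_less continuous_on_sum_squares continuous_on_const)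
  moreover have "ball_Rn n c r = Rn n \<inter> {u. (\<Sum>i<n. (u i - c i)\<^sup>2) < r\<^sup>2}"
    by (auto simp: ball_Rn_def)
  ultimately show ?thesis by (simp add: Euclidean_space_eq openin_open_Int)
qed

text \<open>A closed subset of a product of compact intervals, with the single point 0 in all
  coordinates from \<open>n\<close> on. The half-width \<open>s + 1\<close> avoids a square root, as
  \<open>s \<le> (s + 1)\<^sup>2\<close> for nonnegative \<open>s\<close>.\<close>

lemma compact_cball_Rn: "compact (cball_Rn n c s)"
proof -
  define X where "X = (\<lambda>i. if i < n then {c i - (s + 1)..c i + (s + 1)} else {0::real})"
  have "compactin (product_topology (\<lambda>i. euclideanreal) UNIV) (\<Pi>\<^sub>E i\<in>UNIV. X i)"
    by (subst compactin_PiE) (auto simp: X_def)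
  then have "compact (\<Pi>\<^sub>E i\<in>UNIV. X i)" by (simp add: euclidean_product_topology)
  moreover have "closed {u::nat \<Rightarrow> real. (\<Sum>i<n. (u i - c i)\<^sup>2) \<le> s}"
    by (intro closed_Collect_le continuous_on_sum_squares continuous_on_const)
  moreover have "cball_Rn n c s = (\<Pi>\<^sub>E i\<in>UNIV. X i) \<inter> {u. (\<Sum>i<n. (u i - c i)\<^sup>2) \<le> s}"
  proof -
    have "u i \<in> X i" if u: "u \<in> Rn n" "(\<Sum>i<n. (u i - c i)\<^sup>2) \<le> s" for u i
    proof (cases "i < n")
      case True
      then have "(u i - c i)\<^sup>2 \<le> (\<Sum>i<n. (u i - c i)\<^sup>2)" by (intro member_le_sum) auto
      then have 1: "(u i - c i)\<^sup>2 \<le> s" using u by simp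
      have 2: "s \<ge> 0" using 1 by (meson order_trans zero_le_power2)
      have "s \<le> (s + 1)\<^sup>2" using 2 by (simp add: power2_eq_square algebra_simps)
      then have "\<bar>u i - c i\<bar> \<le> s + 1"
        using 1 2 by (intro power2_le_imp_le[of "\<bar>u i - c i\<bar>"]) auto
      then show ?thesis using True by (simp add: X_def abs_le_iff algebra_simps)
    qed (use u in \<open>auto simp: X_def Rn_iff\<close>)
    moreover have "u \<in> Rn n" if "\<forall>i. u i \<in> X i" for u
      using that by (auto simp: Rn_iff X_def) (metis not_less singletonD)
    ultimately show ?thesis by (auto simp: cball_Rn_def PiE_iff)
  qed
  ultimately show ?thesis using compact_Int_closed[of "\<Pi>\<^sub>E i\<in>UNIV. X i"] by simp
qed

lemma in_ball_Rn_box: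
  assumes "u \<in> ball_Rn n c r" "i < n" "r > 0" shows "\<bar>u i - c i\<bar> < r"
proof -
  have "(u i - c i)\<^sup>2 \<le> (\<Sum>i<n. (u i - c i)\<^sup>2)" using assms by (intro member_le_sum) auto
  then have "(u i - c i)\<^sup>2 < r\<^sup>2" using assms by (simp add: ball_Rn_def)
  then show ?thesis using assms(3) power2_less_imp_less[of "\<bar>u i - c i\<bar>" r] by simp
qed

lemma cball_Rn_subset_ball_Rn: "0 \<le> r \<Longrightarrow> r < s \<Longrightarrow> cball_Rn n c (r\<^sup>2) \<subseteq> ball_Rn n c s"
  using power_strict_mono[of r s 2] by (auto simp: cball_Rn_def ball_Rn_def)

definition C2_bound ::
  "nat \<Rightarrow> ((nat \<Rightarrow> real) \<Rightarrow> real) \<Rightarrow> real \<Rightarrow> (nat \<Rightarrow> real) \<Rightarrow> (nat \<Rightarrow> real) \<Rightarrow> bool" where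
  "C2_bound n f M x y \<longleftrightarrow> \<bar>f y - f x\<bar> \<le> M * (\<Sum>i<n. \<bar>y i - x i\<bar>) \<and>
      \<bar>f y - f x - (\<Sum>i<n. partial_derivative i f x * (y i - x i))\<bar> \<le> M * (\<Sum>i<n. \<bar>y i - x i\<bar>)\<^sup>2"

lemma C2_bound_mono:
  assumes "C2_bound n f M x y" "M \<le> M'" shows "C2_bound n f M' x y"
proof -
  have "M * (\<Sum>i<n. \<bar>y i - x i\<bar>) \<le> M' * (\<Sum>i<n. \<bar>y i - x i\<bar>)"
    "M * (\<Sum>i<n. \<bar>y i - x i\<bar>)\<^sup>2 \<le> M' * (\<Sum>i<n. \<bar>y i - x i\<bar>)\<^sup>2"
    using assms(2) by (intro mult_right_mono; simp add: sum_nonneg)+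
  then show ?thesis using assms(1) unfolding C2_bound_def by linarith
qed

lemma smooth_local_C2_bounds:
  assumes U: "openin (Euclidean_space n) U" and f: "smooth_on n m U f" and c: "c \<in> U"
  shows "\<exists>M\<ge>0. \<exists>d>0. \<forall>j<m. \<forall>x\<in>Rn n. \<forall>y\<in>Rn n. (\<forall>i<n. \<bar>x i - c i\<bar> < d) \<longrightarrow>
      (\<forall>i<n. \<bar>y i - c i\<bar> < d) \<longrightarrow> C2_bound n (\<lambda>x. f x j) M x y"
  using f
proof (induction m)
  case 0 show ?case by (auto intro: exI[of _ 1])
next
  case (Suc m)
  then have "smooth_on n m U f" by (simp add: smooth_on_def)
  then obtain M d where M: "M \<ge> 0" "d > 0"
    "\<And>j x y. j < m \<Longrightarrow> x \<in> Rn n \<Longrightarrow> y \<in> Rn n \<Longrightarrow> \<forall>i<n. \<bar>x i - c i\<bar> < d \<Longrightarrow>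
      \<forall>i<n. \<bar>y i - c i\<bar> < d \<Longrightarrow> C2_bound n (\<lambda>x. f x j) M x y"
    using Suc.IH by blast
  have "C_inf n U (\<lambda>x. f x m)" using Suc.prems by (simp add: smooth_on_C_inf)
  from local_C2_bounds[OF U this c]
  obtain M' d' where M': "M' \<ge> 0" "d' > 0"
    "\<And>x y. x \<in> Rn n \<Longrightarrow> y \<in> Rn n \<Longrightarrow> \<forall>i<n. \<bar>x i - c i\<bar> < d' \<Longrightarrow>
      \<forall>i<n. \<bar>y i - c i\<bar> < d' \<Longrightarrow> C2_bound n (\<lambda>x. f x m) M' x y"
    unfolding C2_bound_def by blast
  have "C2_bound n (\<lambda>x. f x j) (max M M') x y"
    if "j < Suc m" "x \<in> Rn n" "y \<in> Rn n" "\<forall>i<n. \<bar>x i - c i\<bar> < min d d'" "\<forall>i<n. \<bar>y i - c i\<bar> < min d d'" for j x y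
  proof (cases "j = m")
    case True then show ?thesis using that by (auto intro!: C2_bound_mono[OF M'(3)])
  next
    case False then show ?thesis using that by (auto intro!: C2_bound_mono[OF M(3)])
  qed
  moreover have "max M M' \<ge> 0" "min d d' > 0" using M(1,2) M'(2) by auto
  ultimately show ?case by blast
qed

text \<open>Convexity of \<open>|h - c|\<^sup>2\<close> near \<open>h\<^sup>-\<^sup>1(c)\<close>: the second order error of \<open>h\<close> is multiplied by the small
  number \<open>|h - c|\<close>, so that the square of the increment of \<open>h\<close> dominates it.\<close>

lemma small_ball_cell:
  assumes X: "openin (Euclidean_space n) X" and Y: "openin (Euclidean_space n) Y"
    and h: "smooth_on n n X h" and k: "smooth_on n n Y k"
    and hX: "\<And>x. x \<in> X \<Longrightarrow> h x \<in> Y" "\<And>x. x \<in> X \<Longrightarrow> k (h x) = x"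
    and kY: "\<And>y. y \<in> Y \<Longrightarrow> k y \<in> X" "\<And>y. y \<in> Y \<Longrightarrow> h (k y) = y"
    and c: "c \<in> Y"
  shows "\<exists>R>0. ball_Rn n c R \<subseteq> Y \<and>
     (\<forall>r. 0 < r \<longrightarrow> r < R \<longrightarrow> (\<exists>f. cell n (k ` ball_Rn n c r) f))"
proof -
  have XR: "X \<subseteq> Rn n" and YR: "Y \<subseteq> Rn n" using X Y openin_Euclidean_subset by blast+
  let ?a = "k c"
  have a: "?a \<in> X" using kY c by blast
  have hC: "C_inf n X (\<lambda>x. h x j)" and kC: "C_inf n Y (\<lambda>x. k x j)" if "j < n" for j
    using h k that by (auto simp: smooth_on_C_inf)
  obtain M1 d1 where h1: "M1 \<ge> 0" "d1 > 0"
    "\<And>j x y. j < n \<Longrightarrow> x \<in> Rn n \<Longrightarrow> y \<in> Rn n \<Longrightarrow> \<forall>i<n. \<bar>x i - ?a i\<bar> < d1 \<Longrightarrow>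
      \<forall>i<n. \<bar>y i - ?a i\<bar> < d1 \<Longrightarrow> C2_bound n (\<lambda>x. h x j) M1 x y"
    using smooth_local_C2_bounds[OF X h a] by blast
  obtain M2 d2 where k1: "M2 \<ge> 0" "d2 > 0"
    "\<And>j x y. j < n \<Longrightarrow> x \<in> Rn n \<Longrightarrow> y \<in> Rn n \<Longrightarrow> \<forall>i<n. \<bar>x i - c i\<bar> < d2 \<Longrightarrow>
      \<forall>i<n. \<bar>y i - c i\<bar> < d2 \<Longrightarrow> C2_bound n (\<lambda>x. k x j) M2 x y"
    using smooth_local_C2_bounds[OF Y k c] by blast
  define M where "M = max M1 M2"
  define d where "d = min d1 d2"
  have d: "d > 0" using h1(2) k1(2) by (simp add: d_def)
  have M0: "M \<ge> 0" using h1(1) by (simp add: M_def)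
  have hB: "C2_bound n (\<lambda>x. h x j) M x y" if "j < n" "x \<in> Rn n" "y \<in> Rn n" "\<forall>i<n. \<bar>x i - ?a i\<bar> < d"
      "\<forall>i<n. \<bar>y i - ?a i\<bar> < d" for j x y
    using that by (intro C2_bound_mono[OF h1(3)]) (auto simp: d_def M_def)
  have kB: "C2_bound n (\<lambda>x. k x j) M x y" if "j < n" "x \<in> Rn n" "y \<in> Rn n" "\<forall>i<n. \<bar>x i - c i\<bar> < d"
      "\<forall>i<n. \<bar>y i - c i\<bar> < d" for j x y
    using that by (intro C2_bound_mono[OF k1(3)]) (auto simp: d_def M_def)
  \<comment> \<open>The number \<eta> bounds \<open>|h - c|\<close> in each coordinate. It is chosen
    to make the factor \<open>2 * n ^ 4 * M ^ 3 * \<eta>\<close> in the last step of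
    \<open>key\<close> at most 1.\<close>
  define \<eta> where "\<eta> = min d (1 / (2 * n ^ 4 * M ^ 3 + 1))"
  have P: "2 * real n ^ 4 * M ^ 3 \<ge> 0" using M0 by simp
  have \<eta>: "\<eta> > 0" "\<eta> \<le> d" "2 * n ^ 4 * M ^ 3 * \<eta> \<le> 1"
  proof -
    have P1: "2 * real n ^ 4 * M ^ 3 + 1 > 0" using P by linarith
    then have "1 / (2 * real n ^ 4 * M ^ 3 + 1) > 0" by simp
    then show "\<eta> > 0" "\<eta> \<le> d" unfolding \<eta>_def using d by simp_all
    have "2 * n ^ 4 * M ^ 3 * \<eta> \<le> 2 * n ^ 4 * M ^ 3 * (1 / (2 * n ^ 4 * M ^ 3 + 1))"
      using P unfolding \<eta>_def by (intro mult_left_mono) simp_all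
    also have "\<dots> \<le> 1" using P1 by (simp add: pos_divide_le_eq)
    finally show "2 * n ^ 4 * M ^ 3 * \<eta> \<le> 1" .
  qed
  have "\<exists>D>0. \<forall>x\<in>Rn n. (\<forall>i<n. \<bar>x i - ?a i\<bar> < D) \<longrightarrow>
      (\<forall>j\<in>{..<n}. x \<in> X \<and> \<bar>h x j - h ?a j\<bar> < \<eta>)"
    by (rule box_common_radius) (use C_diff_box_close[OF X _ a \<eta>(1)] hC in \<open>unfold C_inf_def, blast+\<close>)
  then obtain D0 where D0: "D0 > 0" "\<And>x j. x \<in> Rn n \<Longrightarrow> \<forall>i<n. \<bar>x i - ?a i\<bar> < D0 \<Longrightarrow> j < n \<Longrightarrow>
      \<bar>h x j - h ?a j\<bar> < \<eta>" by (metis lessThan_iff)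
  obtain D1 where D1: "D1 > 0" "\<And>x. x \<in> Rn n \<Longrightarrow> (\<And>i. i < n \<Longrightarrow> \<bar>x i - ?a i\<bar> < D1) \<Longrightarrow> x \<in> X"
    by (rule openin_Euclidean_boxE[OF X a]) blast
  \<comment> \<open>The box \<open>D\<close> of this size around \<open>k c\<close> lies in
    \<open>X\<close>, satisfies the estimates for \<open>h\<close>, and is mapped by
    \<open>h\<close> to within \<eta> of \<open>c\<close>. Being a box, it contains the lines
    between its points.\<close>
  define \<delta> where "\<delta> = min d (min D0 D1)"
  define D where "D = {x \<in> Rn n. \<forall>i<n. \<bar>x i - ?a i\<bar> < \<delta>}"
  have \<delta>: "\<delta> > 0" using d D0(1) D1(1) by (simp add: \<delta>_def)
  have D: "x \<in> Rn n" "x \<in> X" "\<forall>i<n. \<bar>x i - ?a i\<bar> < d" "\<And>j. j < n \<Longrightarrow> \<bar>h x j - c j\<bar> < \<eta>" if "x \<in> D" for x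
    using that D0(2)[of x] D1(2)[of x] kY(2)[OF c] by (auto simp: D_def \<delta>_def)
  have Dline: "line x y t \<in> D" if "x \<in> D" "y \<in> D" "0 \<le> t" "t \<le> 1" for x y t
    using that line_abs_diff_less[of x _ ?a \<delta> y t] by (auto simp: D_def line_in_Rn)
  have "\<exists>R>0. \<forall>y\<in>Rn n. (\<forall>i<n. \<bar>y i - c i\<bar> < R) \<longrightarrow>
      (\<forall>j\<in>{..<n}. y \<in> Y \<and> \<bar>k y j - k c j\<bar> < \<delta>)"
    by (rule box_common_radius) (use C_diff_box_close[OF Y _ c \<delta>] kC in \<open>unfold C_inf_def, blast+\<close>)
  then obtain R0 where R0: "R0 > 0" "\<And>y j. y \<in> Rn n \<Longrightarrow> \<forall>i<n. \<bar>y i - c i\<bar> < R0 \<Longrightarrow> j < n \<Longrightarrow>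
      \<bar>k y j - k c j\<bar> < \<delta>" by (metis lessThan_iff)
  obtain R1 where R1: "R1 > 0" "\<And>y. y \<in> Rn n \<Longrightarrow> (\<And>i. i < n \<Longrightarrow> \<bar>y i - c i\<bar> < R1) \<Longrightarrow> y \<in> Y"
    by (rule openin_Euclidean_boxE[OF Y c]) blast
  \<comment> \<open>Balls of radius at most \<open>R\<close> lie in \<open>Y\<close> and are mapped
    into \<open>D\<close> by \<open>k\<close>.\<close>
  define R where "R = min R0 R1"
  have R: "R > 0" using R0 R1 by (simp add: R_def)
  have RY: "ball_Rn n c R \<subseteq> Y"
    using in_ball_Rn_box[OF _ _ R] R1(2) by (force simp: R_def ball_Rn_def)
  have kD: "k u \<in> D" if "u \<in> ball_Rn n c R" for u
  proof -
    have "\<forall>i<n. \<bar>u i - c i\<bar> < R0" using in_ball_Rn_box[OF that _ R] by (auto simp: R_def)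
    moreover have "u \<in> Y" "u \<in> Rn n" using RY that by (auto simp: ball_Rn_def)
    ultimately show ?thesis using R0(2)[of u] kY(1) XR by (auto simp: D_def)
  qed
  define l where "l = (\<lambda>x y. \<Sum>i<n. \<bar>y i - x i :: real\<bar>)"
  have l_eq: "l x y = (\<Sum>i<n. \<bar>y i - x i\<bar>)" for x y by (simp add: l_def)
  \<comment> \<open>The inverse \<open>k\<close> is Lipschitz, hence the increment of
    \<open>x\<close> is bounded by \<open>n * M\<close> times that of \<open>h\<close>. The
    Cauchy-Schwarz inequality adds another \<open>n\<close>, and the sum over \<open>j\<close> with
    its factors \<open>2 * \<eta> * M\<close> the rest of the constant.\<close>
  have key: "(\<Sum>j<n. \<bar>2 * (h x j - c j)\<bar> * (M * (l x y)\<^sup>2)) \<le> (\<Sum>j<n. (h y j - h x j)\<^sup>2)"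
    if x: "x \<in> D" and y: "y \<in> D" for x y
  proof -
    let ?S = "\<Sum>j<n. (h y j - h x j)\<^sup>2"
    have hx: "h x \<in> Rn n" "h y \<in> Rn n" using D(2)[OF x] D(2)[OF y] hX(1) YR by blast+
    have cl: "\<forall>i<n. \<bar>h x i - c i\<bar> < d" "\<forall>i<n. \<bar>h y i - c i\<bar> < d"
      using D(4)[OF x] D(4)[OF y] \<eta>(2) by force+
    have "\<bar>y j - x j\<bar> \<le> M * l (h x) (h y)" if "j < n" for j
      using kB[OF that hx cl] hX(2)[OF D(2)[OF x]] hX(2)[OF D(2)[OF y]] by (simp add: C2_bound_def l_def)
    then have "l x y \<le> (\<Sum>j<n. M * l (h x) (h y))" by (subst l_eq) (intro sum_mono, auto)
    then have "l x y \<le> n * M * l (h x) (h y)" by simp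
    moreover have "0 \<le> l x y" by (simp add: l_def sum_nonneg)
    ultimately have "(l x y)\<^sup>2 \<le> (n * M * l (h x) (h y))\<^sup>2" by (intro power_mono)
    also have "\<dots> = (n * M)\<^sup>2 * (l (h x) (h y))\<^sup>2" by (simp add: power_mult_distrib)
    also have "\<dots> \<le> (n * M)\<^sup>2 * (n * ?S)"
      unfolding l_def using sum_squared_le_sum_of_squares[where f = "\<lambda>j. \<bar>h y j - h x j\<bar>" and I = "{..<n}"]
      by (intro mult_left_mono) (auto simp: mult.commute)
    finally have 1: "(l x y)\<^sup>2 \<le> n ^ 3 * M\<^sup>2 * ?S"
      by (simp add: power2_eq_square power3_eq_cube algebra_simps)
    have "(\<Sum>j<n. \<bar>2 * (h x j - c j)\<bar> * (M * (l x y)\<^sup>2)) \<le> (\<Sum>j<n. (2 * \<eta>) * (M * (l x y)\<^sup>2))"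
      using D(4)[OF x] M0 by (intro sum_mono mult_right_mono) (auto simp: abs_mult[of 2] less_imp_le simp del: right_diff_distrib_numeral)
    also have "\<dots> = (2 * n * \<eta> * M) * (l x y)\<^sup>2" by simp
    also have "\<dots> \<le> (2 * n * \<eta> * M) * (n ^ 3 * M\<^sup>2 * ?S)"
      using 1 M0 \<eta>(1) by (intro mult_left_mono) auto
    also have "\<dots> = (2 * n ^ 4 * M ^ 3 * \<eta>) * ?S"
      by (simp add: power2_eq_square power3_eq_cube power4_eq_xxxx algebra_simps)
    also have "\<dots> \<le> 1 * ?S" using \<eta>(3) by (intro mult_right_mono) (auto intro: sum_nonneg)
    finally show ?thesis by simp
  qed
  have cell: "\<exists>f. cell n (k ` ball_Rn n c r) f" if r: "0 < r" "r < R" for r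
  proof -
    \<comment> \<open>The function \<open>|h - c|^2 - r^2\<close>, with squares written as products
      to match \<open>C_diff_mult\<close>. It is negative exactly where \<open>h\<close> lies in the
      ball.\<close>
    define g where "g = (\<lambda>x. (\<Sum>j<n. (h x j - c j) * (h x j - c j)) - r\<^sup>2)"
    define g' where "g' = (\<lambda>i x. \<Sum>j<n. 2 * (h x j - c j) * partial_derivative i (\<lambda>x. h x j) x)"
    have gC: "C_inf n X g"
      unfolding C_inf_def g_def
    proof
      fix m
      have 1: "C_diff n m X (\<lambda>x. h x j)" if "j < n" for j using hC[OF that] by (simp add: C_inf_def)
      show "C_diff n m X (\<lambda>x. (\<Sum>j<n. (h x j - c j) * (h x j - c j)) - r\<^sup>2)"
        by (intro C_diff_diff[OF X] C_diff_sum[OF X] C_diff_mult[OF X] C_diff_const[OF X] 1) auto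
    qed
    have gD: "partial_derivative i g x = g' i x" if "x \<in> X" "i < n" for i x
    proof -
      have "((\<lambda>t. g (x(i := t))) has_real_derivative
          (\<Sum>j<n. partial_derivative i (\<lambda>x. h x j) x * (h x j - c j) + partial_derivative i (\<lambda>x. h x j) x * (h x j - c j)) - 0)
          (at (x i))"
        unfolding g_def
      proof (intro DERIV_diff DERIV_sum DERIV_const)
        fix j assume "j \<in> {..<n}"
        then have 1: "((\<lambda>t. h (x(i := t)) j - c j) has_real_derivative partial_derivative i (\<lambda>x. h x j) x) (at (x i))"
          using DERIV_diff[OF C_inf_DERIV[OF hC that] DERIV_const[of "c j"]] by simp
        show "((\<lambda>t. (h (x(i := t)) j - c j) * (h (x(i := t)) j - c j)) has_real_derivative
           partial_derivative i (\<lambda>x. h x j) x * (h x j - c j) + partial_derivative i (\<lambda>x. h x j) x * (h x j - c j)) (at (x i))"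
          by (rule DERIV_cong[OF DERIV_mult[OF 1 1]]) simp
      qed
      then show ?thesis
        unfolding partial_derivative_def[of i g] g'_def
        by (auto dest!: DERIV_imp_deriv intro!: sum.cong simp: algebra_simps)
    qed
    have conv: "g x + (\<Sum>i<n. partial_derivative i g x * (y i - x i)) \<le> g y" if x: "x \<in> D" and y: "y \<in> D" for x y
    proof -
      let ?rem = "\<lambda>j. h y j - h x j - (\<Sum>i<n. partial_derivative i (\<lambda>x. h x j) x * (y i - x i))"
      have "(\<Sum>i<n. partial_derivative i g x * (y i - x i)) =
          (\<Sum>i<n. \<Sum>j<n. 2 * (h x j - c j) * (partial_derivative i (\<lambda>x. h x j) x * (y i - x i)))"
        using gD[OF D(2)[OF x]] by (intro sum.cong refl) (simp add: g'_def sum_distrib_right mult.assoc)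
      also have "\<dots> = (\<Sum>j<n. 2 * (h x j - c j) * (\<Sum>i<n. partial_derivative i (\<lambda>x. h x j) x * (y i - x i)))"
        by (subst sum.swap) (simp add: sum_distrib_left)
      \<comment> \<open>An exact expansion of the squares: apart from the squared increments of
        \<open>h\<close> there remain only the second order errors of \<open>h\<close>, multiplied
        by \<open>2 * (h x j - c j)\<close>. The former dominate the latter by
        \<open>key\<close>.\<close>
      finally have E: "g y - g x - (\<Sum>i<n. partial_derivative i g x * (y i - x i)) =
          (\<Sum>j<n. (h y j - h x j)\<^sup>2 + 2 * (h x j - c j) * ?rem j)"
        by (simp add: g_def sum_subtractf[symmetric] sum.distrib[symmetric] power2_eq_square algebra_simps)
      have "- (\<Sum>j<n. 2 * (h x j - c j) * ?rem j) \<le> (\<Sum>j<n. \<bar>2 * (h x j - c j) * ?rem j\<bar>)"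
        using sum_abs[of "\<lambda>j. 2 * (h x j - c j) * ?rem j" "{..<n}"] by linarith
      also have "\<dots> \<le> (\<Sum>j<n. \<bar>2 * (h x j - c j)\<bar> * (M * (l x y)\<^sup>2))"
      proof (rule sum_mono)
        fix j assume "j \<in> {..<n}"
        then have "\<bar>?rem j\<bar> \<le> M * (l x y)\<^sup>2"
          using hB[OF _ D(1)[OF x] D(1)[OF y] D(3)[OF x] D(3)[OF y]] by (simp add: C2_bound_def l_def)
        then show "\<bar>2 * (h x j - c j) * ?rem j\<bar> \<le> \<bar>2 * (h x j - c j)\<bar> * (M * (l x y)\<^sup>2)"
          by (simp add: abs_mult mult_left_mono)
      qed
      also have "\<dots> \<le> (\<Sum>j<n. (h y j - h x j)\<^sup>2)" by (rule key[OF x y])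
      finally show ?thesis using E by (simp add: sum.distrib)
    qed
    \<comment> \<open>Inside the box \<open>D\<close> the image of the ball is a sublevel set of
      \<open>g\<close>, so openness and convexity can be read off from \<open>g\<close>.\<close>
    define Br where "Br = {x \<in> D. g x < 0}"
    have g_iff: "g x = (\<Sum>j<n. (h x j - c j)\<^sup>2) - r\<^sup>2" for x by (simp add: g_def power2_eq_square)
    have sub: "ball_Rn n c r \<subseteq> ball_Rn n c R"
      using r power_strict_mono[of r R 2] by (auto simp: ball_Rn_def)
    have BrE: "k ` ball_Rn n c r = Br"
    proof (intro equalityI subsetI)
      fix x assume "x \<in> k ` ball_Rn n c r"
      then obtain u where u: "u \<in> ball_Rn n c r" "x = k u" by blast
      then have "h x = u" using kY(2) RY sub by blast
      then show "x \<in> Br" using u kD sub by (auto simp: Br_def g_iff ball_Rn_def)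
    next
      fix x assume x: "x \<in> Br"
      then have "x = k (h x)" "h x \<in> Rn n" using D(2) hX YR by (auto simp: Br_def)
      moreover have "h x \<in> ball_Rn n c r" using x \<open>h x \<in> Rn n\<close> by (auto simp: Br_def g_iff ball_Rn_def)
      ultimately show "x \<in> k ` ball_Rn n c r" by blast
    qed
    have Do: "openin (Euclidean_space n) D" unfolding D_def by (rule openin_Euclidean_box)
    have DX: "D \<subseteq> X" using D(2) by blast
    have gc: "continuous_on D g" using C_inf_continuous_on[OF gC XR] DX continuous_on_subset by blast
    have Bo: "openin (Euclidean_space n) Br"
    proof -
      have "openin (top_of_set D) (D \<inter> g -` {..<0})"
        using gc by (intro continuous_openin_preimage_gen) auto
      then have "openin (Euclidean_space n) (D \<inter> g -` {..<0})"
        using Do unfolding Euclidean_space_eq using openin_trans by blast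
      moreover have "D \<inter> g -` {..<0} = Br" by (auto simp: Br_def)
      ultimately show ?thesis by simp
    qed
    have Bc: "compact {x \<in> Br. g x \<le> - e}" if e: "e > 0" for e
    proof -
      have sub2: "cball_Rn n c (r\<^sup>2 - e) \<subseteq> ball_Rn n c r" using e by (auto simp: cball_Rn_def ball_Rn_def)
      have "continuous_on Y k"
      proof (rule continuous_on_coordinatewise_then_product)
        fix j show "continuous_on Y (\<lambda>x. k x j)"
        proof (cases "j < n")
          case True then show ?thesis using C_inf_continuous_on[OF kC YR] by blast
        next
          case False
          then have "k x j = 0" if "x \<in> Y" for x using kY(1)[OF that] XR Rn_iff not_less by blast
          then show ?thesis by (simp cong: continuous_on_cong)
        qed
      qed
      then have "compact (k ` cball_Rn n c (r\<^sup>2 - e))"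
        using sub2 sub RY by (intro compact_continuous_image compact_cball_Rn) (blast intro: continuous_on_subset)
      moreover have "{x \<in> Br. g x \<le> - e} = k ` cball_Rn n c (r\<^sup>2 - e)"
      proof (intro equalityI subsetI)
        fix x assume x: "x \<in> {x \<in> Br. g x \<le> - e}"
        then have "x \<in> k ` ball_Rn n c r" using BrE by blast
        then obtain u where u: "u \<in> ball_Rn n c r" "x = k u" by blast
        then have "h x = u" using kY(2) RY sub by blast
        then show "x \<in> k ` cball_Rn n c (r\<^sup>2 - e)" using u x by (auto simp: g_iff ball_Rn_def cball_Rn_def)
      next
        fix x assume "x \<in> k ` cball_Rn n c (r\<^sup>2 - e)"
        then obtain u where u: "u \<in> cball_Rn n c (r\<^sup>2 - e)" "x = k u" by blast
        then have "h x = u" "x \<in> Br" using kY(2) RY sub sub2 BrE by blast+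
        then show "x \<in> {x \<in> Br. g x \<le> - e}" using u by (auto simp: g_iff cball_Rn_def)
      qed
      ultimately show ?thesis by simp
    qed
    have Bl: "line x y t \<in> Br" if x: "x \<in> Br" and y: "y \<in> Br" and t: "0 \<le> t" "t \<le> 1" for x y t
    proof -
      let ?z = "line x y t" and ?G = "\<lambda>z v. \<Sum>i<n. partial_derivative i g z * (v i - z i)"
      have z: "?z \<in> D" using Dline x y t by (auto simp: Br_def)
      \<comment> \<open>The tangent inequality at \<open>?z\<close> is used towards both end points;
        with weights \<open>1 - t\<close> and \<open>t\<close> the linear terms cancel.\<close>
      have "g ?z + ?G ?z x \<le> g x" "g ?z + ?G ?z y \<le> g y" using conv[OF z] x y by (auto simp: Br_def)
      then have "(1 - t) * (g ?z + ?G ?z x) + t * (g ?z + ?G ?z y) \<le> (1 - t) * g x + t * g y"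
        using t by (intro add_mono mult_left_mono) auto
      moreover have "(1 - t) * ?G ?z x + t * ?G ?z y = 0"
        unfolding sum_distrib_left sum.distrib[symmetric]
        by (intro sum.neutral ballI) (simp add: line_def algebra_simps)
      ultimately have "g ?z \<le> (1 - t) * g x + t * g y" by (simp add: algebra_simps)
      also have "\<dots> < 0"
      proof (cases "t = 0")
        case False
        then have "t * g y < 0" using t y by (auto simp: Br_def mult_pos_neg)
        moreover have "(1 - t) * g x \<le> 0" using t x by (auto simp: Br_def intro: mult_nonneg_nonpos)
        ultimately show ?thesis by simp
      qed (use x in \<open>simp add: Br_def\<close>)
      finally show ?thesis using z by (simp add: Br_def)
    qed
    have BX: "Br \<subseteq> X" using DX by (auto simp: Br_def)
    have "cell n Br g"
      unfolding cell_def using Bo Bc Bl conv C_inf_subset[OF gC BX XR] by (auto simp: Br_def)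
    then show ?thesis using BrE by auto
  qed
  show ?thesis using R RY cell by blast
qed

section \<open>Cells are diffeomorphic to Euclidean space\<close>

definition ray :: "(nat \<Rightarrow> real) \<Rightarrow> (nat \<Rightarrow> real) \<Rightarrow> real \<Rightarrow> nat \<Rightarrow> real" where
  "ray x0 y t i = x0 i + t * y i"

lemma ray_in_Rn: "x0 \<in> Rn n \<Longrightarrow> y \<in> Rn n \<Longrightarrow> ray x0 y t \<in> Rn n"
  by (auto simp: ray_def Rn_iff)

lemma tendsto_ray:
  "(\<tau> \<longlongrightarrow> t) F \<Longrightarrow> ((\<lambda>s. \<gamma> s i) \<longlongrightarrow> y i) F \<Longrightarrow>
   ((\<lambda>s. ray x0 (\<gamma> s) (\<tau> s) i) \<longlongrightarrow> ray x0 y t i) F"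
  unfolding ray_def by (intro tendsto_intros)

text \<open>The map \<open>x \<mapsto> \<rho>(x) (x - x0)\<close> preserves the rays from \<open>x0\<close> and, by the assumptions below, maps each of them
  monotonically onto a full ray. Its inverse is \<open>y \<mapsto> x0 + \<tau>(y) y\<close>, where \<open>\<tau>\<close> solves a scalar equation,
  so only a one-dimensional implicit function argument is needed.\<close>

locale radial =
  fixes n :: nat and C :: "(nat \<Rightarrow> real) set" and x0 :: "nat \<Rightarrow> real" and \<rho> :: "(nat \<Rightarrow> real) \<Rightarrow> real"
  assumes C: "openin (Euclidean_space n) C" and x0: "x0 \<in> C"
    and star: "\<And>x t. x \<in> C \<Longrightarrow> 0 \<le> t \<Longrightarrow> t \<le> 1 \<Longrightarrow> line x0 x t \<in> C"
    and rho: "C_inf n C \<rho>" and pos: "\<And>x. x \<in> C \<Longrightarrow> \<rho> x > 0"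
    and incr: "\<And>x. x \<in> C \<Longrightarrow> \<rho> x + (\<Sum>i<n. partial_derivative i \<rho> x * (x i - x0 i)) > 0"
    and exit: "\<And>y. y \<in> Rn n \<Longrightarrow> \<exists>t>0. ray x0 y t \<in> C \<and> t * \<rho> (ray x0 y t) = 1"
begin

lemma CR: "C \<subseteq> Rn n" using C openin_Euclidean_subset by blast

lemma x0R: "x0 \<in> Rn n" using x0 CR by blast

lemma ray_below:
  assumes "0 \<le> s" "s \<le> t" "ray x0 y t \<in> C" shows "ray x0 y s \<in> C"
proof (cases "t = 0")
  case True then show ?thesis using assms by simp
next
  case False
  have "ray x0 y s = line x0 (ray x0 y t) (s / t)"
    using False by (auto simp: ray_def line_def fun_eq_iff)
  then show ?thesis using star[OF assms(3), of "s / t"] assms False by (simp add: divide_le_eq)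
qed

lemma DERIV_rho_ray:
  assumes "y \<in> Rn n" "ray x0 y t \<in> C"
  shows "((\<lambda>s. \<rho> (ray x0 y s)) has_real_derivative
          (\<Sum>i<n. partial_derivative i \<rho> (ray x0 y t) * y i)) (at t)"
proof (rule DERIV_along_curve[OF C])
  show "C_diff n (Suc 0) C \<rho>" using rho unfolding C_inf_def by blast
  show "((\<lambda>s. ray x0 y s j) has_real_derivative y j) (at t)" for j
    unfolding ray_def by (auto intro!: derivative_eq_intros)
qed (use assms x0R in \<open>simp_all add: ray_in_Rn\<close>)

text \<open>The derivative of \<open>u * \<rho> (ray x0 y u)\<close> is the expression in
  \<open>incr\<close>, because \<open>u * y i\<close> equals
  \<open>ray x0 y u i - x0 i\<close>.\<close>

lemma ray_strict:
  assumes y: "y \<in> Rn n" and s: "0 \<le> s" "s < t" and t: "ray x0 y t \<in> C"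
  shows "s * \<rho> (ray x0 y s) < t * \<rho> (ray x0 y t)"
proof (rule DERIV_pos_imp_increasing[OF s(2)])
  fix u assume u: "s \<le> u" "u \<le> t"
  have uC: "ray x0 y u \<in> C" using ray_below[OF _ u(2) t] u s by simp
  have "((\<lambda>u. u * \<rho> (ray x0 y u)) has_real_derivative
      1 * \<rho> (ray x0 y u) + (\<Sum>i<n. partial_derivative i \<rho> (ray x0 y u) * y i) * u) (at u)"
    by (intro DERIV_mult DERIV_ident DERIV_rho_ray y uC)
  moreover have "1 * \<rho> (ray x0 y u) + (\<Sum>i<n. partial_derivative i \<rho> (ray x0 y u) * y i) * u =
      \<rho> (ray x0 y u) + (\<Sum>i<n. partial_derivative i \<rho> (ray x0 y u) * (ray x0 y u i - x0 i))"
    by (simp add: ray_def sum_distrib_left sum_distrib_right mult_ac)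
  ultimately show "\<exists>d. ((\<lambda>u. u * \<rho> (ray x0 y u)) has_real_derivative d) (at u) \<and> 0 < d"
    using incr[OF uC] by auto
qed

definition \<tau> :: "(nat \<Rightarrow> real) \<Rightarrow> real" where
  "\<tau> y = (SOME t. 0 < t \<and> ray x0 y t \<in> C \<and> t * \<rho> (ray x0 y t) = 1)"

lemma tau:
  assumes "y \<in> Rn n"
  shows "\<tau> y > 0" "ray x0 y (\<tau> y) \<in> C" "\<tau> y * \<rho> (ray x0 y (\<tau> y)) = 1"
  using someI_ex[OF exit[OF assms]] unfolding \<tau>_def by auto

lemma tau_unique:
  assumes y: "y \<in> Rn n" and t: "t > 0" "ray x0 y t \<in> C" "t * \<rho> (ray x0 y t) = 1"
  shows "\<tau> y = t"
proof (rule linorder_cases)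
  assume "\<tau> y < t"
  with ray_strict[OF y _ this t(2)] tau[OF y] t show ?thesis by simp
next
  assume "t < \<tau> y"
  with ray_strict[OF y _ this tau(2)[OF y]] tau[OF y] t show ?thesis by simp
qed

lemma tendsto_rho:
  assumes "x \<in> C" "\<And>i. ((\<lambda>s. \<gamma> s i) \<longlongrightarrow> x i) F" "\<forall>\<^sub>F s in F. \<gamma> s \<in> Rn n"
  shows "((\<lambda>s. \<rho> (\<gamma> s)) \<longlongrightarrow> \<rho> x) F" "\<forall>\<^sub>F s in F. \<gamma> s \<in> C"
proof -
  show ev: "\<forall>\<^sub>F s in F. \<gamma> s \<in> C"
    by (rule eventually_in_openin_Euclidean[OF C assms(1)]) (use assms in auto)
  show "((\<lambda>s. \<rho> (\<gamma> s)) \<longlongrightarrow> \<rho> x) F"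
    by (rule continuous_on_tendsto_compose[OF C_inf_continuous_on[OF rho CR]
          tendsto_coordinatewise[OF assms(2)] assms(1) ev])
qed

text \<open>Slightly before and slightly after \<open>\<tau> y\<close> the function
  \<open>t * \<rho> (ray x0 y t)\<close> is strictly below and above 1. For fixed \<open>t\<close>
  both inequalities persist when \<open>y\<close> is replaced by a nearby \<open>z\<close>, and
  monotonicity along the ray of \<open>z\<close> then traps \<open>\<tau> z\<close> between the two
  parameters.\<close>

lemma continuous_on_tau: "continuous_on (Rn n) \<tau>"
  unfolding continuous_on_def
proof (intro ballI tendstoI)
  fix y and e :: real assume y: "y \<in> Rn n" and e: "e > 0"
  let ?F = "at y within Rn n"
  have lim: "((\<lambda>z. z i) \<longlongrightarrow> y i) ?F" for i
    using continuous_on_subset[OF continuous_on_product_coordinates subset_UNIV, of "Rn n" i] y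
    unfolding continuous_on_def by blast
  have R: "\<forall>\<^sub>F z in ?F. z \<in> Rn n" by (simp add: eventually_at_filter)
  have "\<forall>\<^sub>F t in nhds (\<tau> y). ray x0 y t \<in> C"
  proof (rule eventually_in_openin_Euclidean[OF C tau(2)[OF y]])
    show "((\<lambda>t. ray x0 y t i) \<longlongrightarrow> ray x0 y (\<tau> y) i) (nhds (\<tau> y))" for i
      by (intro tendsto_ray tendsto_const) (simp add: filterlim_ident)
  qed (use y x0R ray_in_Rn in simp)
  then obtain d where d: "d > 0" "\<And>t. dist t (\<tau> y) < d \<Longrightarrow> ray x0 y t \<in> C"
    unfolding eventually_nhds_metric by blast
  \<comment> \<open>Below \<open>d\<close> so that the ray is in \<open>C\<close> at both test
    parameters, below \<open>\<tau> y\<close> so that the smaller one is positive, and below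
    \<open>e\<close> for the final estimate.\<close>
  define e' where "e' = min (min d e) (\<tau> y) / 2"
  have e': "e' > 0" "e' < d" "e' < e" "e' < \<tau> y" using d e tau(1)[OF y] by (auto simp: e'_def)
  have upper: "\<forall>\<^sub>F z in ?F. \<tau> z < \<tau> y + e'"
  proof -
    let ?t = "\<tau> y + e'"
    have t: "ray x0 y ?t \<in> C" using d(2) e' by (simp add: dist_real_def)
    have r: "((\<lambda>z. ray x0 z ?t i) \<longlongrightarrow> ray x0 y ?t i) ?F" for i
      by (intro tendsto_ray tendsto_const lim)
    have rR: "\<forall>\<^sub>F z in ?F. ray x0 z ?t \<in> Rn n" using R by eventually_elim (rule ray_in_Rn[OF x0R])
    note T = tendsto_rho[OF t r rR]
    have "1 < ?t * \<rho> (ray x0 y ?t)"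
      using ray_strict[OF y _ _ t, of "\<tau> y"] tau[OF y] e' by simp
    then have "\<forall>\<^sub>F z in ?F. 1 < ?t * \<rho> (ray x0 z ?t)"
      using order_tendstoD(1)[OF tendsto_mult_left[OF T(1)]] by blast
    with R T(2) show ?thesis
    proof eventually_elim
      case (elim z)
      show ?case
      proof (rule ccontr)
        assume "\<not> \<tau> z < ?t"
        then have "?t \<le> \<tau> z" by simp
        then have "?t * \<rho> (ray x0 z ?t) \<le> \<tau> z * \<rho> (ray x0 z (\<tau> z))"
          using ray_strict[OF elim(1) _ _ tau(2)[OF elim(1)], of ?t] tau(1)[OF y] e'(1)
          by (cases "?t = \<tau> z") auto
        then show False using elim(3) tau(3)[OF elim(1)] by simp
      qed
    qed
  qed
  have lower: "\<forall>\<^sub>F z in ?F. \<tau> y - e' < \<tau> z"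
  proof -
    let ?t = "\<tau> y - e'"
    have t: "ray x0 y ?t \<in> C" using d(2) e' by (simp add: dist_real_def)
    have r: "((\<lambda>z. ray x0 z ?t i) \<longlongrightarrow> ray x0 y ?t i) ?F" for i
      by (intro tendsto_ray tendsto_const lim)
    have rR: "\<forall>\<^sub>F z in ?F. ray x0 z ?t \<in> Rn n" using R by eventually_elim (rule ray_in_Rn[OF x0R])
    note T = tendsto_rho[OF t r rR]
    have "?t * \<rho> (ray x0 y ?t) < 1"
      using ray_strict[OF y _ _ tau(2)[OF y], of ?t] tau[OF y] e' by simp
    then have "\<forall>\<^sub>F z in ?F. ?t * \<rho> (ray x0 z ?t) < 1"
      using order_tendstoD(2)[OF tendsto_mult_left[OF T(1)]] by blast
    with R T(2) show ?thesis
    proof eventually_elim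
      case (elim z)
      show ?case
      proof (rule ccontr)
        assume "\<not> ?t < \<tau> z"
        then have "\<tau> z \<le> ?t" by simp
        then have "\<tau> z * \<rho> (ray x0 z (\<tau> z)) \<le> ?t * \<rho> (ray x0 z ?t)"
          using ray_strict[OF elim(1) _ _ elim(2), of "\<tau> z"] tau(1)[OF elim(1)]
          by (cases "?t = \<tau> z") auto
        then show False using elim(3) tau(3)[OF elim(1)] by simp
      qed
    qed
  qed
  from upper lower show "\<forall>\<^sub>F z in ?F. dist (\<tau> z) (\<tau> y) < e"
    by eventually_elim (use e' in \<open>auto simp: dist_real_def\<close>)
qed

definition \<Psi> :: "(nat \<Rightarrow> real) \<Rightarrow> nat \<Rightarrow> real" where "\<Psi> y = ray x0 y (\<tau> y)"

text \<open>Implicit differentiation of \<open>\<tau> y * \<rho> (\<Psi> y) = 1\<close>. The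
  difference quotients of \<rho> give an equation that is linear in the increment of \<tau>; its
  coefficient \<open>den\<close> converges by continuity of \<tau> alone, and its limit is positive
  by \<open>incr\<close>.\<close>

lemma DERIV_tau:
  assumes y: "y \<in> Rn n" and k: "k < n"
  shows "((\<lambda>t. \<tau> (y(k := t))) has_real_derivative
     - (\<tau> y * \<tau> y * partial_derivative k \<rho> (\<Psi> y)) *
       inverse (\<rho> (\<Psi> y) + (\<Sum>i<n. partial_derivative i \<rho> (\<Psi> y) * (\<tau> y * y i)))) (at (y k))"
proof -
  let ?F = "at (y k)"
  define \<gamma> where "\<gamma> = (\<lambda>t. y(k := t))"
  define x1 where "x1 = (\<lambda>t. \<Psi> (\<gamma> t))"
  let ?x = "\<Psi> y"
  have x: "?x \<in> C" using tau(2)[OF y] by (simp add: \<Psi>_def)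
  have \<gamma>R: "\<gamma> t \<in> Rn n" for t using fun_upd_in_Rn[OF y k] by (simp add: \<gamma>_def)
  have \<gamma>: "((\<lambda>t. \<gamma> t i) \<longlongrightarrow> y i) ?F" for i by (cases "i = k") (auto simp: \<gamma>_def)
  have \<tau>1: "((\<lambda>t. \<tau> (\<gamma> t)) \<longlongrightarrow> \<tau> y) ?F"
    by (rule continuous_on_tendsto_compose[OF continuous_on_tau tendsto_coordinatewise[OF \<gamma>] y]) (simp add: \<gamma>R)
  have x1: "((\<lambda>t. x1 t i) \<longlongrightarrow> ?x i) ?F" for i
    unfolding x1_def \<Psi>_def by (intro tendsto_ray \<tau>1 \<gamma>)
  have x1C: "x1 t \<in> C" for t using tau(2)[OF \<gamma>R] by (simp add: x1_def \<Psi>_def)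
  then have x1R: "\<forall>\<^sub>F t in ?F. x1 t \<in> Rn n" using CR by (auto intro: always_eventually)
  have r1: "C_diff n (Suc 0) C \<rho>" using rho unfolding C_inf_def by blast
  obtain q where q: "\<And>z. z \<in> Rn n \<Longrightarrow> \<rho> z - \<rho> ?x = (\<Sum>j<n. q j z * (z j - ?x j))"
    "\<And>(\<gamma> :: real \<Rightarrow> nat \<Rightarrow> real) F j. (\<And>i. i < n \<Longrightarrow> ((\<lambda>s. \<gamma> s i) \<longlongrightarrow> ?x i) F) \<Longrightarrow>
       \<forall>\<^sub>F s in F. \<gamma> s \<in> Rn n \<Longrightarrow> j < n \<Longrightarrow> ((\<lambda>s. q j (\<gamma> s)) \<longlongrightarrow> partial_derivative j \<rho> ?x) F"
    by (rule caratheodory[OF C r1 x]) blast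
  have qlim: "((\<lambda>t. q j (x1 t)) \<longlongrightarrow> partial_derivative j \<rho> ?x) ?F" if "j < n" for j
    using q(2)[OF x1 x1R that] .
  define den where "den = (\<lambda>t. \<rho> (x1 t) + (\<Sum>i<n. q i (x1 t) * (\<tau> y * \<gamma> t i)))"
  define E where "E = \<rho> ?x + (\<Sum>i<n. partial_derivative i \<rho> ?x * (\<tau> y * y i))"
  have denlim: "(den \<longlongrightarrow> E) ?F"
    unfolding den_def E_def using tendsto_rho(1)[OF x x1 x1R]
    by (intro tendsto_add tendsto_sum tendsto_mult tendsto_const \<gamma> qlim) auto
  have E: "E > 0" using incr[OF x] by (simp add: E_def \<Psi>_def ray_def)
  \<comment> \<open>The difference of the equations \<open>\<tau> * \<rho> = 1\<close> at
    \<open>\<gamma> t\<close> and at \<open>y\<close>. The increment of \<rho> involves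
    \<open>x1 t - \<Psi> y\<close>, which splits into a multiple of the increment of \<tau> and the
    change of coordinate \<open>k\<close>.\<close>
  have eq: "(\<tau> (\<gamma> t) - \<tau> y) * den t = - (\<tau> y * \<tau> y * q k (x1 t)) * (t - y k)" for t
  proof -
    let ?d = "\<tau> (\<gamma> t) - \<tau> y"
    have dk: "(\<Sum>i<n. q i (x1 t) * (\<gamma> t i - y i)) = q k (x1 t) * (t - y k)"
    proof -
      have "(\<Sum>i<n. q i (x1 t) * (\<gamma> t i - y i)) = (\<Sum>i<n. if i = k then q k (x1 t) * (t - y k) else 0)"
        by (intro sum.cong) (auto simp: \<gamma>_def)
      also have "\<dots> = q k (x1 t) * (t - y k)" using k by simp
      finally show ?thesis .
    qed
    have "\<rho> (x1 t) - \<rho> ?x = (\<Sum>j<n. q j (x1 t) * (x1 t j - ?x j))"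
      using q(1) x1C CR by blast
    also have "\<dots> = (\<Sum>j<n. ?d * (q j (x1 t) * \<gamma> t j) + \<tau> y * (q j (x1 t) * (\<gamma> t j - y j)))"
      by (intro sum.cong) (auto simp: x1_def \<Psi>_def ray_def algebra_simps)
    also have "\<dots> = ?d * (\<Sum>j<n. q j (x1 t) * \<gamma> t j) + \<tau> y * (q k (x1 t) * (t - y k))"
      by (simp only: sum.distrib sum_distrib_left[symmetric] dk)
    finally have r: "\<rho> (x1 t) = \<rho> ?x + (?d * (\<Sum>j<n. q j (x1 t) * \<gamma> t j) + \<tau> y * (q k (x1 t) * (t - y k)))"
      by simp
    have "\<tau> (\<gamma> t) * \<rho> (x1 t) = 1" "\<tau> y * \<rho> ?x = 1"
      using tau(3)[OF \<gamma>R] tau(3)[OF y] by (simp_all add: x1_def \<Psi>_def)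
    then have z: "?d * \<rho> (x1 t) + \<tau> y * (\<rho> (x1 t) - \<rho> ?x) = 0" by (simp add: algebra_simps)
    have "(\<Sum>i<n. q i (x1 t) * (\<tau> y * \<gamma> t i)) = \<tau> y * (\<Sum>j<n. q j (x1 t) * \<gamma> t j)"
      by (simp add: sum_distrib_left mult_ac)
    then have "?d * den t = ?d * \<rho> (x1 t) + \<tau> y * (?d * (\<Sum>j<n. q j (x1 t) * \<gamma> t j))"
      by (simp add: den_def algebra_simps)
    also have "?d * (\<Sum>j<n. q j (x1 t) * \<gamma> t j) = (\<rho> (x1 t) - \<rho> ?x) - \<tau> y * (q k (x1 t) * (t - y k))"
      using r by linarith
    also have "?d * \<rho> (x1 t) + \<tau> y * (\<rho> (x1 t) - \<rho> ?x - \<tau> y * (q k (x1 t) * (t - y k))) =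
        (?d * \<rho> (x1 t) + \<tau> y * (\<rho> (x1 t) - \<rho> ?x)) - \<tau> y * \<tau> y * q k (x1 t) * (t - y k)"
      by (simp add: algebra_simps)
    finally show ?thesis using z by simp
  qed
  have "((\<lambda>t. - (\<tau> y * \<tau> y * q k (x1 t)) * inverse (den t)) \<longlongrightarrow>
      - (\<tau> y * \<tau> y * partial_derivative k \<rho> ?x) * inverse E) ?F"
    using E by (intro tendsto_mult tendsto_minus tendsto_const qlim k tendsto_inverse denlim) auto
  moreover have "\<forall>\<^sub>F t in ?F. - (\<tau> y * \<tau> y * q k (x1 t)) * inverse (den t) = (\<tau> (\<gamma> t) - \<tau> y) / (t - y k)"
  proof -
    have "\<forall>\<^sub>F t in ?F. 0 < den t" using order_tendstoD(1)[OF denlim E] .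
    moreover have "\<forall>\<^sub>F t in ?F. t \<noteq> y k" by (simp add: eventually_at_filter)
    ultimately show ?thesis
    proof eventually_elim
      case (elim t)
      then show ?case using eq[of t] by (simp add: divide_simps)
    qed
  qed
  ultimately have "((\<lambda>t. (\<tau> (\<gamma> t) - \<tau> y) / (t - y k)) \<longlongrightarrow>
      - (\<tau> y * \<tau> y * partial_derivative k \<rho> ?x) * inverse E) ?F"
    by (rule Lim_transform_eventually)
  then show ?thesis unfolding has_field_derivative_iff E_def \<gamma>_def by simp
qed

lemma openin_Rn: "openin (Euclidean_space n) (Rn n)"
  using openin_topspace[of "Euclidean_space n"] by simp

lemma C_diff_Psi: "C_diff n k (Rn n) \<tau> \<Longrightarrow> C_diff n k (Rn n) (\<lambda>y. \<Psi> y j)"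
  unfolding \<Psi>_def ray_def
  by (intro C_diff_add C_diff_mult C_diff_const C_diff_coord openin_Rn)

text \<open>Bootstrapping: the formula of \<open>DERIV_tau\<close> contains only \<tau>,
  coordinates, and smooth functions of \<Psi>, which is as often differentiable as \<tau>. So class
  \<open>k\<close> of \<tau> gives class \<open>k\<close> of its derivatives.\<close>

lemma C_inf_tau: "C_inf n (Rn n) \<tau>"
  unfolding C_inf_def
proof
  fix k show "C_diff n k (Rn n) \<tau>"
  proof (induction k)
    case 0
    show ?case using continuous_on_tau by (simp add: continuous_map_Euclidean_sub)
  next
    case (Suc k)
    have PC: "\<Psi> y \<in> C" if "y \<in> Rn n" for y using tau(2)[OF that] by (simp add: \<Psi>_def)
    have comp: "C_diff n k (Rn n) (\<lambda>y. f (\<Psi> y))" if "C_inf n C f" for f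
      by (rule C_diff_compose[OF C openin_Rn, where g = \<Psi>])
        (use that C_diff_Psi[OF Suc] PC in \<open>simp_all add: C_inf_def\<close>)
    note d = comp[OF C_inf_partial_derivative[OF rho]]
    let ?E = "\<lambda>y. \<rho> (\<Psi> y) + (\<Sum>i<n. partial_derivative i \<rho> (\<Psi> y) * (\<tau> y * y i))"
    have E: "?E y \<noteq> 0" if "y \<in> Rn n" for y
      using incr[OF PC[OF that]] by (simp add: \<Psi>_def ray_def)
    have EC: "C_diff n k (Rn n) ?E"
      by (intro C_diff_add[OF openin_Rn] C_diff_sum[OF openin_Rn] C_diff_mult[OF openin_Rn]
          C_diff_coord[OF openin_Rn] Suc comp[OF rho] d) auto
    show ?case
    proof (rule C_diff_SucI[OF openin_Rn continuous_on_tau DERIV_tau])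
      fix i assume i: "i < n"
      have "C_diff n k (Rn n) (\<lambda>y. (-1) * (\<tau> y * \<tau> y * partial_derivative i \<rho> (\<Psi> y)) * inverse (?E y))"
        by (intro C_diff_mult[OF openin_Rn] C_diff_const[OF openin_Rn] Suc d[OF i]
            C_diff_inverse[OF openin_Rn E EC])
      then show "C_diff n k (Rn n) (\<lambda>y. - (\<tau> y * \<tau> y * partial_derivative i \<rho> (\<Psi> y)) * inverse (?E y))"
        by simp
    qed
  qed
qed

lemma diffeo:
  "\<exists>\<Phi> \<Psi>. (\<forall>x\<in>C. \<Phi> x \<in> Rn n \<and> \<Psi> (\<Phi> x) = x) \<and> (\<forall>y\<in>Rn n. \<Psi> y \<in> C \<and> \<Phi> (\<Psi> y) = y) \<and>
     smooth_on n n C \<Phi> \<and> smooth_on n n (Rn n) \<Psi>"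
proof (intro exI conjI ballI)
  let ?\<Phi> = "\<lambda>x i. \<rho> x * (x i - x0 i)"
  show R: "?\<Phi> x \<in> Rn n" if "x \<in> C" for x using that CR x0R by (auto simp: Rn_iff)
  show "\<Psi> (?\<Phi> x) = x" if x: "x \<in> C" for x
  proof -
    \<comment> \<open>The ray in the direction of the image of \<open>x\<close> passes through
      \<open>x\<close> at the parameter \<open>1 / \<rho> x\<close>, where the equation defining
      \<tau> holds.\<close>
    have r: "ray x0 (?\<Phi> x) (1 / \<rho> x) = x" using pos[OF x] by (auto simp: ray_def fun_eq_iff)
    then have "\<tau> (?\<Phi> x) = 1 / \<rho> x" using pos[OF x] x by (intro tau_unique R) auto
    then show ?thesis using r by (simp add: \<Psi>_def)
  qed
  show "\<Psi> y \<in> C" if "y \<in> Rn n" for y using tau(2)[OF that] by (simp add: \<Psi>_def)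
  show "?\<Phi> (\<Psi> y) = y" if y: "y \<in> Rn n" for y
  proof
    fix i
    have "?\<Phi> (\<Psi> y) i = (\<tau> y * \<rho> (ray x0 y (\<tau> y))) * y i" by (simp add: \<Psi>_def ray_def[of x0 y "\<tau> y" i])
    then show "?\<Phi> (\<Psi> y) i = y i" using tau(3)[OF y] by simp
  qed
  show "smooth_on n n C ?\<Phi>"
    using rho unfolding smooth_on_def C_inf_def
    by (auto intro!: C_diff_mult[OF C] C_diff_diff[OF C] C_diff_coord[OF C] C_diff_const[OF C])
  show "smooth_on n n (Rn n) \<Psi>"
    using C_inf_tau unfolding smooth_on_def C_inf_def by (auto intro!: C_diff_Psi)
qed

end

text \<open>With \<rho> the sum of the functions \<open>1 / (- f i)\<close> the locale
  \<open>radial\<close> applies: convexity of the \<open>f i\<close> gives \<open>incr\<close>, and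
  the compact sublevel sets give \<open>exit\<close>, since a ray leaving \<open>C\<close> must make
  some summand blow up.\<close>

lemma cells_diffeo:
  fixes B :: "'i \<Rightarrow> (nat \<Rightarrow> real) set"
  assumes fin: "finite I" "I \<noteq> {}" and cell: "\<And>i. i \<in> I \<Longrightarrow> cell n (B i) (f i)"
    and C_def: "C = (\<Inter>i\<in>I. B i)" and ne: "C \<noteq> {}"
  shows "\<exists>\<Phi> \<Psi>. (\<forall>x\<in>C. \<Phi> x \<in> Rn n \<and> \<Psi> (\<Phi> x) = x) \<and> (\<forall>y\<in>Rn n. \<Psi> y \<in> C \<and> \<Phi> (\<Psi> y) = y) \<and>
     smooth_on n n C \<Phi> \<and> smooth_on n n (Rn n) \<Psi>"
proof -
  obtain x0 where x0: "x0 \<in> C" using ne by blast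
  define \<rho> where "\<rho> = (\<lambda>x. \<Sum>i\<in>I. inverse (- f i x))"
  have Bo: "openin (Euclidean_space n) (B i)" and fC: "C_inf n (B i) (f i)"
    and neg: "\<And>x. x \<in> B i \<Longrightarrow> f i x < 0" and cmp: "\<And>e. e > 0 \<Longrightarrow> compact {x \<in> B i. f i x \<le> - e}"
    and conv: "\<And>x y. x \<in> B i \<Longrightarrow> y \<in> B i \<Longrightarrow>
      f i x + (\<Sum>j<n. partial_derivative j (f i) x * (y j - x j)) \<le> f i y"
    and Bl: "\<And>x y t. x \<in> B i \<Longrightarrow> y \<in> B i \<Longrightarrow> 0 \<le> t \<Longrightarrow> t \<le> 1 \<Longrightarrow> line x y t \<in> B i"
    if "i \<in> I" for i
    using cell[OF that] unfolding cell_def by blast+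
  have CB: "x \<in> B i" if "x \<in> C" "i \<in> I" for x i using that by (auto simp: C_def)
  have Co: "openin (Euclidean_space n) C"
    unfolding C_def using fin Bo by (intro openin_INT2) auto
  have CR: "C \<subseteq> Rn n" using Co openin_Euclidean_subset by blast
  have x0R: "x0 \<in> Rn n" using x0 CR by blast
  have star: "line x0 x t \<in> C" if "x \<in> C" "0 \<le> t" "t \<le> 1" for x t
    using Bl x0 that by (auto simp: C_def)
  have below: "ray x0 y s \<in> C" if "0 \<le> s" "s \<le> t" "ray x0 y t \<in> C" for y s t
  proof (cases "t = 0")
    case False
    have "ray x0 y s = line x0 (ray x0 y t) (s / t)"
      using False by (auto simp: ray_def line_def fun_eq_iff)
    then show ?thesis using star[OF that(3), of "s / t"] that False by (simp add: divide_le_eq)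
  qed (use that in simp)
  have fC': "C_inf n C (f i)" if "i \<in> I" for i
    using C_inf_subset[OF fC[OF that]] CB[OF _ that] openin_Euclidean_subset[OF Bo[OF that]] by blast
  have rhoC: "C_inf n C \<rho>"
    unfolding C_inf_def \<rho>_def
  proof (intro allI C_diff_sum[OF Co])
    fix k i assume i: "i \<in> I"
    have "C_diff n k C (\<lambda>x. 0 - f i x)"
      using fC'[OF i] unfolding C_inf_def by (intro C_diff_diff[OF Co] C_diff_const[OF Co]) auto
    then have "C_diff n k C (\<lambda>x. - f i x)" by simp
    then show "C_diff n k C (\<lambda>x. inverse (- f i x))"
      using neg[OF i CB[OF _ i]] by (intro C_diff_inverse[OF Co]) force+
  qed
  have ipos: "inverse (- f i x) > 0" if "x \<in> C" "i \<in> I" for x i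
    using neg[OF that(2) CB[OF that]] by simp
  have pos: "\<rho> x > 0" if "x \<in> C" for x
    unfolding \<rho>_def using fin ipos[OF that] by (intro sum_pos) auto
  have D: "partial_derivative j \<rho> x = (\<Sum>i\<in>I. partial_derivative j (f i) x * inverse (f i x ^ 2))"
    if x: "x \<in> C" and j: "j < n" for j x
  proof -
    have "((\<lambda>t. \<rho> (x(j := t))) has_real_derivative
        (\<Sum>i\<in>I. partial_derivative j (f i) x * inverse (f i x ^ 2))) (at (x j))"
      unfolding \<rho>_def
    proof (rule DERIV_sum)
      fix i assume i: "i \<in> I"
      have "((\<lambda>t. - f i (x(j := t))) has_real_derivative - partial_derivative j (f i) x) (at (x j))"
        by (rule DERIV_minus[OF C_inf_DERIV[OF fC'[OF i] x j]])
      moreover have "- f i (x(j := x j)) \<noteq> 0" using neg[OF i CB[OF x i]] by simp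
      ultimately show "((\<lambda>t. inverse (- f i (x(j := t)))) has_real_derivative
          partial_derivative j (f i) x * inverse (f i x ^ 2)) (at (x j))"
        by (rule DERIV_cong[OF DERIV_inverse']) (simp add: power2_eq_square)
    qed
    then show ?thesis unfolding partial_derivative_def[of j \<rho>] by (rule DERIV_imp_deriv)
  qed
  text \<open>Convexity gives \<open>f x0 \<ge> f x + Df(x)(x0 - x)\<close>, hence \<open>t / (- f)\<close> increases along rays from \<open>x0\<close>.\<close>
  have incr: "\<rho> x + (\<Sum>j<n. partial_derivative j \<rho> x * (x j - x0 j)) > 0" if x: "x \<in> C" for x
  proof -
    let ?G = "\<lambda>i. \<Sum>j<n. partial_derivative j (f i) x * (x j - x0 j)"
    have "(\<Sum>j<n. partial_derivative j \<rho> x * (x j - x0 j)) =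
        (\<Sum>j<n. \<Sum>i\<in>I. inverse (f i x ^ 2) * (partial_derivative j (f i) x * (x j - x0 j)))"
      using D[OF x] by (intro sum.cong refl) (simp add: sum_distrib_left mult_ac)
    also have "\<dots> = (\<Sum>i\<in>I. inverse (f i x ^ 2) * ?G i)"
      by (subst sum.swap) (simp add: sum_distrib_left)
    finally have "\<rho> x + (\<Sum>j<n. partial_derivative j \<rho> x * (x j - x0 j)) =
        (\<Sum>i\<in>I. inverse (- f i x) + inverse (f i x ^ 2) * ?G i)"
      by (simp only: \<rho>_def sum.distrib)
    also have "\<dots> > 0"
    proof (rule sum_pos[OF fin])
      fix i assume i: "i \<in> I"
      have n: "f i x < 0" "f i x0 < 0" using neg[OF i] CB[OF _ i] x x0 by blast+
      have "(\<Sum>j<n. partial_derivative j (f i) x * (x0 j - x j)) = - ?G i"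
        by (simp add: sum_negf[symmetric] algebra_simps)
      then have "?G i > f i x" using conv[OF i CB[OF x i] CB[OF x0 i]] n by simp
      then have "inverse (f i x ^ 2) * ?G i > inverse (f i x ^ 2) * f i x"
        using n by (intro mult_strict_left_mono) auto
      moreover have "inverse (f i x ^ 2) * f i x = - inverse (- f i x)"
        using n by (simp add: power2_eq_square field_simps)
      ultimately show "0 < inverse (- f i x) + inverse (f i x ^ 2) * ?G i" by linarith
    qed
    finally show ?thesis .
  qed
  \<comment> \<open>The ray for \<open>y = 0\<close> is constant and is treated first. Otherwise, if
    the value 1 is never reached, the part of the ray in \<open>C\<close> beyond \<delta> is trapped
    in compact sets, so there is a last parameter in \<open>C\<close>, contradicting that
    \<open>C\<close> is open.\<close>
  have exit: "\<exists>t>0. ray x0 y t \<in> C \<and> t * \<rho> (ray x0 y t) = 1" if y: "y \<in> Rn n" for y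
  proof (cases "\<forall>i. y i = 0")
    case True
    then have "ray x0 y t = x0" for t by (auto simp: ray_def)
    then show ?thesis using pos[OF x0] x0 by (intro exI[of _ "1 / \<rho> x0"]) auto
  next
    case False
    then obtain k where k: "y k \<noteq> 0" by blast
    show ?thesis
    proof (rule ccontr)
      assume no: "\<not> ?thesis"
      have rc: "continuous_on A (ray x0 y)" for A
        by (rule continuous_on_coordinatewise_then_product) (simp add: ray_def, intro continuous_intros)
      \<comment> \<open>The product is 0 at parameter 0, so by the intermediate value theorem it
        cannot reach 1 or more without taking the value 1.\<close>
      have lt: "t * \<rho> (ray x0 y t) < 1" if t: "t > 0" "ray x0 y t \<in> C" for t
      proof (rule ccontr)
        assume "\<not> t * \<rho> (ray x0 y t) < 1"
        moreover have "continuous_on {0..t} (\<lambda>s. s * \<rho> (ray x0 y s))"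
          using below[OF _ _ t(2)]
          by (intro continuous_on_mult continuous_on_id
              continuous_on_compose2[OF C_inf_continuous_on[OF rhoC CR] rc]) auto
        ultimately obtain s where "0 \<le> s" "s \<le> t" "s * \<rho> (ray x0 y s) = 1"
          using IVT'[of "\<lambda>s. s * \<rho> (ray x0 y s)" 0 1 t] t by auto
        then show False using no below[OF _ _ t(2), of s] by (cases "s = 0") auto
      qed
      have nb: "\<exists>d>0. \<forall>s. \<bar>s - t\<bar> < d \<longrightarrow> ray x0 y s \<in> C" if t: "ray x0 y t \<in> C" for t
      proof -
        have "\<forall>\<^sub>F s in nhds t. ray x0 y s \<in> C"
        proof (rule eventually_in_openin_Euclidean[OF Co t])
          show "((\<lambda>s. ray x0 y s i) \<longlongrightarrow> ray x0 y t i) (nhds t)" for i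
            by (intro tendsto_ray tendsto_const) (simp add: filterlim_ident)
        qed (use y x0R ray_in_Rn in simp)
        then show ?thesis unfolding eventually_nhds_metric dist_real_def by blast
      qed
      have "ray x0 y 0 = x0" by (auto simp: ray_def)
      then obtain d where d: "d > 0" "\<And>s. \<bar>s - 0\<bar> < d \<Longrightarrow> ray x0 y s \<in> C" using nb[of 0] x0 by auto
      define \<delta> where "\<delta> = d / 2"
      have \<delta>: "\<delta> > 0" "ray x0 y \<delta> \<in> C" using d by (auto simp: \<delta>_def)
      define K where "K = (\<lambda>i. {x \<in> B i. f i x \<le> - \<delta>})"
      \<comment> \<open>Starting at a fixed positive \<delta> makes a uniform bound possible:
        \<open>t \<ge> \<delta>\<close> and \<open>t * \<rho> < 1\<close> bound each summand of
        \<rho> by \<open>1 / \<delta>\<close>, that is \<open>f i \<le> - \<delta>\<close>.\<close>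
      define S where "S = {t. \<delta> \<le> t \<and> ray x0 y t \<in> C}"
      have K: "compact (K i)" if "i \<in> I" for i using cmp[OF that \<delta>(1)] by (simp add: K_def)
      have SK: "S = {\<delta>..} \<inter> (\<Inter>i\<in>I. ray x0 y -` K i)"
      proof (intro equalityI subsetI)
        fix t assume t: "t \<in> S"
        have tp: "t > 0" "\<delta> \<le> t" "ray x0 y t \<in> C" using t \<delta> by (auto simp: S_def)
        have "ray x0 y t \<in> K i" if i: "i \<in> I" for i
        proof -
          let ?x = "ray x0 y t"
          have "\<delta> * inverse (- f i ?x) \<le> t * \<rho> ?x"
          proof (rule mult_mono)
            show "inverse (- f i ?x) \<le> \<rho> ?x"
              unfolding \<rho>_def using fin(1) i ipos[OF tp(3)]
              by (intro member_le_sum[of i I "\<lambda>i. inverse (- f i ?x)"]) (auto intro: less_imp_le)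
          qed (use tp ipos[OF tp(3) i] in auto)
          then have "\<delta> * inverse (- f i ?x) \<le> 1" using lt[OF tp(1,3)] by simp
          then have "\<delta> \<le> - f i ?x" using neg[OF i CB[OF tp(3) i]] by (simp add: field_simps)
          then show ?thesis using CB[OF tp(3) i] by (simp add: K_def)
        qed
        then show "t \<in> {\<delta>..} \<inter> (\<Inter>i\<in>I. ray x0 y -` K i)" using tp by auto
      qed (use fin in \<open>auto simp: S_def K_def C_def\<close>)
      have "closed S"
        unfolding SK using K compact_imp_closed rc[of UNIV]
        by (intro closed_Int closed_INT ballI closed_vimage) (auto)
      moreover have "bounded S"
      proof -
        obtain i where i: "i \<in> I" using fin by blast
        \<comment> \<open>Coordinate \<open>k\<close> moves along the ray with speed
          \<open>y k\<close>, which is not 0, so boundedness of a single \<open>K i\<close> in this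
          coordinate bounds the parameter.\<close>
        have "compact ((\<lambda>x. x k) ` K i)"
          using K[OF i] continuous_on_product_coordinates
          by (intro compact_continuous_image continuous_on_subset[OF continuous_on_product_coordinates]) auto
        then have "bounded ((\<lambda>x. x k) ` K i)" by (rule compact_imp_bounded)
        then obtain b where b: "\<And>x. x \<in> K i \<Longrightarrow> \<bar>x k\<bar> \<le> b"
          unfolding bounded_iff by auto
        have "\<bar>t\<bar> \<le> (b + \<bar>x0 k\<bar>) / \<bar>y k\<bar>" if "t \<in> S" for t
        proof -
          have "\<bar>x0 k + t * y k\<bar> \<le> b" using that b[of "ray x0 y t"] i unfolding SK by (auto simp: ray_def)
          then have "\<bar>t * y k\<bar> \<le> b + \<bar>x0 k\<bar>" by linarith
          then show ?thesis using k by (simp add: abs_mult pos_le_divide_eq)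
        qed
        then show ?thesis unfolding bounded_iff by auto
      qed
      ultimately have "compact S" by (simp add: compact_eq_bounded_closed)
      moreover have "\<delta> \<in> S" using \<delta> by (simp add: S_def)
      ultimately obtain T where T: "T \<in> S" "\<And>t. t \<in> S \<Longrightarrow> t \<le> T"
        using compact_attains_sup[of S] by blast
      then obtain d' where d': "d' > 0" "\<And>s. \<bar>s - T\<bar> < d' \<Longrightarrow> ray x0 y s \<in> C"
        using nb[of T] by (auto simp: S_def)
      have "T + d' / 2 \<in> S" using T(1) d' by (auto simp: S_def)
      then show False using T(2)[of "T + d' / 2"] d'(1) by simp
    qed
  qed
  have "radial n C x0 \<rho>"
    using Co x0 star rhoC pos incr exit by unfold_locales auto
  then show ?thesis by (rule radial.diffeo)
qed

section \<open>Manifolds\<close>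

lemma chart_facts:
  assumes "is_chart X n (U, \<phi>)"
  shows "openin X U" "U \<subseteq> topspace X" "\<phi> \<in> extensional U" "openin (Euclidean_space n) (\<phi> ` U)"
    "\<phi> ` U \<subseteq> Rn n" "inj_on \<phi> U"
    "continuous_map (subtopology X U) (Euclidean_space n) \<phi>"
    "continuous_map (subtopology (Euclidean_space n) (\<phi> ` U)) (subtopology X U) (inv_into U \<phi>)"
proof -
  have a: "openin X U" "\<phi> \<in> extensional U" "openin (Euclidean_space n) (\<phi> ` U)"
    and h: "homeomorphic_map (subtopology X U) (subtopology (Euclidean_space n) (\<phi> ` U)) \<phi>"
    using assms by (auto simp: is_chart_def)
  show "openin X U" "\<phi> \<in> extensional U" "openin (Euclidean_space n) (\<phi> ` U)" by fact+
  show UX: "U \<subseteq> topspace X" and "\<phi> ` U \<subseteq> Rn n"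
    using a openin_subset openin_Euclidean_subset by blast+
  have tU: "topspace (subtopology X U) = U" using UX by auto
  show inj: "inj_on \<phi> U" using homeomorphic_imp_injective_map[OF h] tU by simp
  show "continuous_map (subtopology X U) (Euclidean_space n) \<phi>"
    using homeomorphic_imp_continuous_map[OF h] continuous_map_in_subtopology by blast
  obtain g where g: "homeomorphic_maps (subtopology X U) (subtopology (Euclidean_space n) (\<phi> ` U)) \<phi> g"
    using h homeomorphic_map_maps by blast
  then have "continuous_map (subtopology (Euclidean_space n) (\<phi> ` U)) (subtopology X U) g"
    by (simp add: homeomorphic_maps_def)
  moreover have "g y = inv_into U \<phi> y" if "y \<in> topspace (subtopology (Euclidean_space n) (\<phi> ` U))" for y
  proof -
    have "y \<in> \<phi> ` U" using that by auto
    then obtain x where "x \<in> U" "y = \<phi> x" by blast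
    then show ?thesis using g tU inj unfolding homeomorphic_maps_def by (simp add: inv_into_f_f)
  qed
  ultimately show "continuous_map (subtopology (Euclidean_space n) (\<phi> ` U)) (subtopology X U) (inv_into U \<phi>)"
    by (rule continuous_map_eq)
qed

lemma chart_open_image:
  assumes c: "is_chart X n (U, \<phi>)" and V: "openin X V" "V \<subseteq> U"
  shows "openin (Euclidean_space n) (\<phi> ` V)"
proof -
  note f = chart_facts[OF c]
  have "openin (subtopology X U) V" using V f(1) openin_open_subtopology by blast
  moreover have "homeomorphic_map (subtopology X U) (subtopology (Euclidean_space n) (\<phi> ` U)) \<phi>"
    using c by (auto simp: is_chart_def)
  ultimately have "openin (subtopology (Euclidean_space n) (\<phi> ` U)) (\<phi> ` V)"
    using V f(2) by (subst homeomorphic_map_openness) auto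
  then show ?thesis using f(4) openin_open_subtopology by blast
qed

lemma chart_open_preimage:
  assumes c: "is_chart X n (U, \<phi>)" and W: "openin (Euclidean_space n) W"
  shows "openin X {x \<in> U. \<phi> x \<in> W}"
proof -
  note f = chart_facts[OF c]
  have tU: "topspace (subtopology X U) = U" using f(2) by auto
  have "openin (subtopology X U) {x \<in> U. \<phi> x \<in> W}"
    using openin_continuous_map_preimage[OF f(7) W] unfolding tU .
  then show ?thesis using openin_open_subtopology[OF f(1)] by blast
qed

lemma manifold_chart: "smooth_manifold M \<Longrightarrow> c \<in> atlas M \<Longrightarrow> is_chart (space_of M) (mdim M) c"
  by (simp add: smooth_manifold_def)

lemma manifold_chart_at:
  assumes "smooth_manifold M" "p \<in> points M"
  obtains U \<phi> where "(U, \<phi>) \<in> atlas M" "p \<in> U"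
proof -
  have "(\<Union>c\<in>atlas M. fst c) = points M" using assms(1) unfolding smooth_manifold_def by (elim conjE)
  then obtain c where "c \<in> atlas M" "p \<in> fst c" using assms(2) by blast
  then show ?thesis using that[of "fst c" "snd c"] by simp
qed

lemma manifold_compatible:
  assumes "smooth_manifold M" "(U, \<phi>) \<in> atlas M" "(V, \<psi>) \<in> atlas M"
  shows "smooth_on (mdim M) (mdim M) (\<phi> ` (U \<inter> V)) (\<psi> \<circ> inv_into U \<phi>)"
proof -
  have "\<forall>c\<in>atlas M. \<forall>d\<in>atlas M. compatible_charts (mdim M) c d"
    using assms(1) unfolding smooth_manifold_def by (elim conjE)
  then have "compatible_charts (mdim M) (U, \<phi>) (V, \<psi>)" using assms(2,3) by blast
  then show ?thesis by (simp add: compatible_charts_def)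
qed

lemma manifold_maximal:
  assumes "smooth_manifold M" "is_chart (space_of M) (mdim M) c"
    and "\<And>d. d \<in> atlas M \<Longrightarrow> compatible_charts (mdim M) c d"
  shows "c \<in> atlas M"
proof -
  have "\<forall>c. is_chart (space_of M) (mdim M) c \<and> (\<forall>d\<in>atlas M. compatible_charts (mdim M) c d)
      \<longrightarrow> c \<in> atlas M"
    using assms(1) unfolding smooth_manifold_def by (elim conjE)
  then show ?thesis using assms(2,3) by blast
qed

lemma continuous_on_into_Rn:
  assumes "smooth_on n m A f" "A \<subseteq> Rn n" "f ` A \<subseteq> Rn m"
  shows "continuous_map (subtopology (Euclidean_space n) A) (Euclidean_space m) f"
proof -
  have "continuous_on A f"
  proof (rule continuous_on_coordinatewise_then_product)
    fix j show "continuous_on A (\<lambda>x. f x j)"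
    proof (cases "j < m")
      case True then show ?thesis using assms C_inf_continuous_on by (auto simp: smooth_on_C_inf)
    next
      case False
      then have "f x j = 0" if "x \<in> A" for x using assms(3) that Rn_iff not_less by blast
      then show ?thesis by (simp cong: continuous_on_cong)
    qed
  qed
  then show ?thesis
    using assms by (auto simp: cm_Euclidean_space_iff_continuous_on Int_absorb1 Int_absorb2 Rn_iff)
qed

text \<open>A chart followed by a diffeomorphism of open sets is compatible with all charts by the
  chain rule, hence belongs to the maximal atlas. In this way a cell intersection becomes the domain
  of a chart onto \<open>Rn n\<close>.\<close>

lemma chart_transform:
  assumes M: "smooth_manifold M" and c: "(U, \<phi>) \<in> atlas M" and V: "openin (space_of M) V" "V \<subseteq> U"
    and Y: "openin (Euclidean_space (mdim M)) Y"
    and \<Phi>: "\<And>x. x \<in> \<phi> ` V \<Longrightarrow> \<Phi> x \<in> Y \<and> \<Psi> (\<Phi> x) = x"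
    and \<Psi>: "\<And>y. y \<in> Y \<Longrightarrow> \<Psi> y \<in> \<phi> ` V \<and> \<Phi> (\<Psi> y) = y"
    and smooth: "smooth_on (mdim M) (mdim M) (\<phi> ` V) \<Phi>" "smooth_on (mdim M) (mdim M) Y \<Psi>"
  shows "(V, \<lambda>x\<in>V. \<Phi> (\<phi> x)) \<in> atlas M" "(\<lambda>x\<in>V. \<Phi> (\<phi> x)) ` V = Y"
proof -
  let ?n = "mdim M" and ?X = "space_of M" and ?\<kappa> = "\<lambda>x\<in>V. \<Phi> (\<phi> x)"
  note ch = manifold_chart[OF M c]
  note f = chart_facts[OF ch]
  have fV: "openin (Euclidean_space ?n) (\<phi> ` V)" by (rule chart_open_image[OF ch V])
  note fVR = openin_Euclidean_subset[OF fV] and YR = openin_Euclidean_subset[OF Y]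
  have VX: "V \<subseteq> topspace ?X" using V openin_subset by blast
  have inv: "inv_into U \<phi> (\<phi> x) = x" if "x \<in> U" for x using f(6) that by simp
  show img: "?\<kappa> ` V = Y"
  proof (intro equalityI subsetI)
    fix y assume "y \<in> Y"
    then obtain x where "x \<in> V" "\<Psi> y = \<phi> x" using \<Psi> by blast
    then have "y = ?\<kappa> x" using \<Psi>[OF \<open>y \<in> Y\<close>] by simp
    then show "y \<in> ?\<kappa> ` V" using \<open>x \<in> V\<close> by blast
  qed (use \<Phi> in auto)
  have tV: "topspace (subtopology ?X V) = V" using VX by auto
  have tY: "topspace (subtopology (Euclidean_space ?n) Y) = Y" using YR by auto
  have hm: "homeomorphic_maps (subtopology ?X V) (subtopology (Euclidean_space ?n) Y) ?\<kappa> (\<lambda>y. inv_into U \<phi> (\<Psi> y))"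
    unfolding homeomorphic_maps_def tV tY
  proof (intro conjI ballI)
    have c1: "continuous_map (subtopology ?X V) (subtopology (Euclidean_space ?n) (\<phi> ` V)) \<phi>"
      using continuous_map_from_subtopology_mono[OF f(7) V(2)] tV
      by (auto simp: continuous_map_in_subtopology)
    have c2: "continuous_map (subtopology (Euclidean_space ?n) (\<phi> ` V)) (Euclidean_space ?n) \<Phi>"
      by (rule continuous_on_into_Rn[OF smooth(1) fVR]) (use \<Phi> YR in blast)
    have "continuous_map (subtopology ?X V) (Euclidean_space ?n) (\<Phi> \<circ> \<phi>)"
      by (rule continuous_map_compose[OF c1 c2])
    then have "continuous_map (subtopology ?X V) (Euclidean_space ?n) ?\<kappa>"
      by (rule continuous_map_eq) (simp add: tV)
    then show "continuous_map (subtopology ?X V) (subtopology (Euclidean_space ?n) Y) ?\<kappa>"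
      using img tV by (auto simp: continuous_map_in_subtopology)
    have c3: "continuous_map (subtopology (Euclidean_space ?n) Y) (Euclidean_space ?n) \<Psi>"
      by (rule continuous_on_into_Rn[OF smooth(2) YR]) (use \<Psi> fVR in blast)
    then have c3': "continuous_map (subtopology (Euclidean_space ?n) Y) (subtopology (Euclidean_space ?n) (\<phi> ` U)) \<Psi>"
      using tY by (auto simp: continuous_map_in_subtopology) (use \<Psi> V(2) in blast)
    have "continuous_map (subtopology (Euclidean_space ?n) Y) (subtopology ?X U) (inv_into U \<phi> \<circ> \<Psi>)"
      by (rule continuous_map_compose[OF c3' f(8)])
    then have "continuous_map (subtopology (Euclidean_space ?n) Y) ?X (\<lambda>y. inv_into U \<phi> (\<Psi> y))"
      using continuous_map_in_subtopology by (auto simp: comp_def)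
    moreover have "inv_into U \<phi> (\<Psi> y) \<in> V" if "y \<in> Y" for y
    proof -
      obtain x where "x \<in> V" "\<Psi> y = \<phi> x" using \<Psi>[OF \<open>y \<in> Y\<close>] by blast
      then show ?thesis using inv V(2) by auto
    qed
    ultimately show "continuous_map (subtopology (Euclidean_space ?n) Y) (subtopology ?X V) (\<lambda>y. inv_into U \<phi> (\<Psi> y))"
      using tY by (auto simp: continuous_map_in_subtopology)
    show "inv_into U \<phi> (\<Psi> (?\<kappa> x)) = x" if "x \<in> V" for x using that \<Phi> inv V(2) by auto
    show "?\<kappa> (inv_into U \<phi> (\<Psi> y)) = y" if "y \<in> Y" for y
    proof -
      obtain x where "x \<in> V" "\<Psi> y = \<phi> x" using \<Psi>[OF \<open>y \<in> Y\<close>] by blast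
      then show ?thesis using inv V(2) \<Psi>[OF that] by auto
    qed
  qed
  have chi: "is_chart ?X ?n (V, ?\<kappa>)"
    unfolding is_chart_def split img using V(1) Y hm homeomorphic_map_maps by blast
  have injV: "inj_on ?\<kappa> V" by (rule chart_facts(6)[OF chi])
  show "(V, ?\<kappa>) \<in> atlas M"
  proof (rule manifold_maximal[OF M chi])
    fix d assume d: "d \<in> atlas M"
    obtain W \<psi> where d_eq: "d = (W, \<psi>)" by (cases d)
    have d': "(W, \<psi>) \<in> atlas M" using d d_eq by simp
    note cd = manifold_chart[OF M d']
    note fd = chart_facts[OF cd]
    have o1: "openin ?X (V \<inter> W)" using V(1) fd(1) by blast
    have "smooth_on ?n ?n (?\<kappa> ` (V \<inter> W)) (\<psi> \<circ> inv_into V ?\<kappa>)"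
    proof (rule smooth_on_cong)
      show oc: "openin (Euclidean_space ?n) (?\<kappa> ` (V \<inter> W))" by (rule chart_open_image[OF chi o1]) simp
      show "smooth_on ?n ?n (?\<kappa> ` (V \<inter> W)) ((\<psi> \<circ> inv_into U \<phi>) \<circ> \<Psi>)"
      proof (rule smooth_on_compose[OF _ oc _ manifold_compatible[OF M c d']])
        show "openin (Euclidean_space ?n) (\<phi> ` (U \<inter> W))"
          by (rule chart_open_image[OF ch]) (use f(1) fd(1) in auto)
        show "\<Psi> y \<in> \<phi> ` (U \<inter> W)" if "y \<in> ?\<kappa> ` (V \<inter> W)" for y using that \<Phi> V(2) by auto
        show "smooth_on ?n ?n (?\<kappa> ` (V \<inter> W)) \<Psi>"
          by (rule smooth_on_subset[OF smooth(2) _ YR]) (use img in blast)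
      qed
      fix y assume "y \<in> ?\<kappa> ` (V \<inter> W)"
      then obtain x where x: "x \<in> V" "x \<in> W" "y = ?\<kappa> x" by blast
      then have "inv_into V ?\<kappa> y = x" using inv_into_f_f[OF injV x(1)] by (simp only:)
      then show "((\<psi> \<circ> inv_into U \<phi>) \<circ> \<Psi>) y = (\<psi> \<circ> inv_into V ?\<kappa>) y"
        using x \<Phi> inv V(2) by auto
    qed
    moreover have "smooth_on ?n ?n (\<psi> ` (V \<inter> W)) (?\<kappa> \<circ> inv_into W \<psi>)"
    proof (rule smooth_on_cong)
      show oc: "openin (Euclidean_space ?n) (\<psi> ` (V \<inter> W))" by (rule chart_open_image[OF cd o1]) simp
      have invd: "inv_into W \<psi> (\<psi> x) = x" if "x \<in> W" for x using fd(6) that by simp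
      show "smooth_on ?n ?n (\<psi> ` (V \<inter> W)) (\<Phi> \<circ> (\<phi> \<circ> inv_into W \<psi>))"
      proof (rule smooth_on_compose[OF fV oc _ smooth(1)])
        show "(\<phi> \<circ> inv_into W \<psi>) y \<in> \<phi> ` V" if "y \<in> \<psi> ` (V \<inter> W)" for y using that invd by auto
        show "smooth_on ?n ?n (\<psi> ` (V \<inter> W)) (\<phi> \<circ> inv_into W \<psi>)"
          by (rule smooth_on_subset[OF manifold_compatible[OF M d' c]])
            (use V(2) fd(5) in blast)+
      qed
      show "(\<Phi> \<circ> (\<phi> \<circ> inv_into W \<psi>)) y = (?\<kappa> \<circ> inv_into W \<psi>) y" if "y \<in> \<psi> ` (V \<inter> W)" for y
        using that invd by auto
    qed
    ultimately show "compatible_charts ?n (V, ?\<kappa>) d"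
      unfolding compatible_charts_def d_eq by (simp add: Int_commute)
  qed
qed

lemma chart_restrict:
  assumes M: "smooth_manifold M" and c: "(U, \<phi>) \<in> atlas M" and V: "openin (space_of M) V" "V \<subseteq> U"
  shows "(V, restrict \<phi> V) \<in> atlas M"
proof -
  have o: "openin (Euclidean_space (mdim M)) (\<phi> ` V)"
    by (rule chart_open_image[OF manifold_chart[OF M c] V])
  show ?thesis
    using chart_transform(1)[OF M c V o, of "\<lambda>x. x" "\<lambda>x. x"] smooth_on_ident[OF o] by simp
qed

text \<open>Paracompactness does not pass to open subspaces of general topological spaces. For a
  chart domain it is carried over from its image, a subspace of a metric space.\<close>

lemma paracompact_chart_domain:
  assumes c: "is_chart X n (U, \<phi>)"
  shows "paracompact_space (subtopology X U)"
  unfolding paracompact_space_def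
proof (intro allI impI)
  fix \<U> assume \<U>: "(\<forall>V\<in>\<U>. openin (subtopology X U) V) \<and> \<Union> \<U> = topspace (subtopology X U)"
  note f = chart_facts[OF c]
  have t: "topspace (subtopology X U) = U" using f(2) by auto
  have sub: "openin X V" "V \<subseteq> U" if "V \<in> \<U>" for V
    using \<U> that openin_open_subtopology[OF f(1)] by blast+
  have E: "openin (top_of_set (\<phi> ` U)) W" if "openin (Euclidean_space n) W" "W \<subseteq> \<phi> ` U" for W
    using that f(5) unfolding Euclidean_space_eq by (meson openin_subset_trans openin_subset)
  obtain \<W> where \<W>: "\<phi> ` U \<subseteq> \<Union>\<W>"
    "\<And>W. W \<in> \<W> \<Longrightarrow> openin (top_of_set (\<phi> ` U)) W \<and> (\<exists>T. T \<in> (`) \<phi> ` \<U> \<and> W \<subseteq> T)"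
    "\<And>x. x \<in> \<phi> ` U \<Longrightarrow> \<exists>V. openin (top_of_set (\<phi> ` U)) V \<and> x \<in> V \<and> finite {W. W \<in> \<W> \<and> W \<inter> V \<noteq> {}}"
  proof (rule paracompact_closedin)
    show "closedin (top_of_set (\<phi> ` U)) (\<phi> ` U)" by simp
    show "openin (top_of_set (\<phi> ` U)) T" if T: "T \<in> (`) \<phi> ` \<U>" for T
    proof -
      obtain V where V: "V \<in> \<U>" "T = \<phi> ` V" using T by blast
      then show ?thesis using chart_open_image[OF c sub[OF V(1)]] sub(2)[OF V(1)] by (auto intro!: E)
    qed
    show "\<phi> ` U \<subseteq> \<Union> ((`) \<phi> ` \<U>)" using \<U> t by blast
  qed blast
  have oW: "openin (Euclidean_space n) W" if "openin (top_of_set (\<phi> ` U)) W" for W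
    using that f(4) openin_trans unfolding Euclidean_space_eq by blast
  define p where "p = (\<lambda>W. {x \<in> U. \<phi> x \<in> W})"
  have po: "openin (subtopology X U) (p W)" if "openin (top_of_set (\<phi> ` U)) W" for W
    using chart_open_preimage[OF c oW[OF that]] openin_open_subtopology[OF f(1)] by (auto simp: p_def)
  show "\<exists>\<V>. (\<forall>V\<in>\<V>. openin (subtopology X U) V \<and> (\<exists>U\<in>\<U>. V \<subseteq> U)) \<and>
      \<Union> \<V> = topspace (subtopology X U) \<and> locally_finite_in (subtopology X U) \<V>"
  proof (intro exI[of _ "p ` \<W>"] conjI ballI)
    fix V assume "V \<in> p ` \<W>"
    then obtain W where W: "W \<in> \<W>" "V = p W" by blast
    show "openin (subtopology X U) V" using po \<W>(2)[OF W(1)] W(2) by blast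
    obtain T where T: "T \<in> \<U>" "W \<subseteq> \<phi> ` T" using \<W>(2)[OF W(1)] by blast
    have "V \<subseteq> T"
    proof
      fix x assume "x \<in> V"
      then have "x \<in> U" "\<phi> x \<in> \<phi> ` T" using W T by (auto simp: p_def)
      then show "x \<in> T" using inj_on_image_mem_iff[OF f(6)] sub(2)[OF T(1)] by blast
    qed
    then show "\<exists>U\<in>\<U>. V \<subseteq> U" using T by blast
  next
    show un: "\<Union> (p ` \<W>) = topspace (subtopology X U)" using \<W>(1) t by (auto simp: p_def)
    show "locally_finite_in (subtopology X U) (p ` \<W>)"
      unfolding locally_finite_in_def un
    proof (intro conjI ballI subset_refl)
      fix x assume "x \<in> topspace (subtopology X U)"
      then have x: "x \<in> U" using t by simp
      then obtain V where V: "openin (top_of_set (\<phi> ` U)) V" "\<phi> x \<in> V" "finite {W. W \<in> \<W> \<and> W \<inter> V \<noteq> {}}"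
        using \<W>(3) by blast
      have "{Z \<in> p ` \<W>. Z \<inter> p V \<noteq> {}} \<subseteq> p ` {W. W \<in> \<W> \<and> W \<inter> V \<noteq> {}}"
        by (auto simp: p_def)
      then have "finite {Z \<in> p ` \<W>. Z \<inter> p V \<noteq> {}}" using V(3) finite_subset by blast
      then show "\<exists>V. openin (subtopology X U) V \<and> x \<in> V \<and> finite {Z \<in> p ` \<W>. Z \<inter> V \<noteq> {}}"
        using po[OF V(1)] V(2) x by (intro exI[of _ "p V"]) (auto simp: p_def)
    qed
  qed
qed

lemma open_submanifold_simps [simp]:
  "space_of (open_submanifold M U) = subtopology (space_of M) U" "mdim (open_submanifold M U) = mdim M"
  "atlas (open_submanifold M U) = {c \<in> atlas M. fst c \<subseteq> U}"
  by (simp_all add: open_submanifold_def)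

lemma points_open_submanifold: "openin (space_of M) U \<Longrightarrow> points (open_submanifold M U) = U"
  using openin_subset[of "space_of M" U] by auto

text \<open>The point is maximality. A chart inside \<open>U\<close> that is compatible with the
  charts inside \<open>U\<close> is compatible with any chart of \<open>M\<close>, because the
  overlap does not change when the latter is restricted to \<open>U\<close>, and such restrictions
  are in the atlas.\<close>

lemma smooth_manifold_open_submanifold:
  assumes M: "smooth_manifold M" and U: "openin (space_of M) U"
    and pc: "paracompact_space (subtopology (space_of M) U)"
  shows "smooth_manifold (open_submanifold M U)"
proof -
  let ?X = "space_of M" and ?n = "mdim M"
  have sub: "is_chart (subtopology ?X U) ?n (V, \<phi>) \<longleftrightarrow> is_chart ?X ?n (V, \<phi>) \<and> V \<subseteq> U" for V \<phi>
  proof -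
    have "subtopology (subtopology ?X U) V = subtopology ?X V" if "V \<subseteq> U"
      using that by (simp add: subtopology_subtopology Int_absorb1)
    then show ?thesis
      unfolding is_chart_def split using openin_open_subtopology[OF U] by metis
  qed
  have cov: "(\<Union>c\<in>{c \<in> atlas M. fst c \<subseteq> U}. fst c) = topspace (subtopology ?X U)"
  proof (intro equalityI subsetI)
    fix x assume "x \<in> (\<Union>c\<in>{c \<in> atlas M. fst c \<subseteq> U}. fst c)"
    then obtain V \<phi> where "(V, \<phi>) \<in> atlas M" "V \<subseteq> U" "x \<in> V" by auto
    then show "x \<in> topspace (subtopology ?X U)"
      using chart_facts(2)[OF manifold_chart[OF M]] by auto
  next
    fix x assume x: "x \<in> topspace (subtopology ?X U)"
    then obtain V \<phi> where V: "(V, \<phi>) \<in> atlas M" "x \<in> V"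
      using manifold_chart_at[OF M, of x] by auto
    have "(V \<inter> U, restrict \<phi> (V \<inter> U)) \<in> atlas M"
      using chart_facts(1)[OF manifold_chart[OF M V(1)]] U by (intro chart_restrict[OF M V(1)]) auto
    then show "x \<in> (\<Union>c\<in>{c \<in> atlas M. fst c \<subseteq> U}. fst c)"
      using x V(2) by (intro UN_I[of "(V \<inter> U, restrict \<phi> (V \<inter> U))"]) auto
  qed
  have maxi: "c \<in> atlas M \<and> fst c \<subseteq> U"
    if c: "is_chart (subtopology ?X U) ?n c"
      and comp: "\<And>d. d \<in> atlas M \<Longrightarrow> fst d \<subseteq> U \<Longrightarrow> compatible_charts ?n c d" for c
  proof -
    obtain V \<phi> where ceq: "c = (V, \<phi>)" by (cases c)
    have ch: "is_chart ?X ?n (V, \<phi>)" and VU: "V \<subseteq> U" using c sub ceq by auto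
    note f = chart_facts[OF ch]
    have "(V, \<phi>) \<in> atlas M"
    proof (rule manifold_maximal[OF M ch])
      fix d assume d: "d \<in> atlas M"
      obtain W \<psi> where deq: "d = (W, \<psi>)" by (cases d)
      have d': "(W, \<psi>) \<in> atlas M" using d deq by simp
      note cd = manifold_chart[OF M d']
      note fd = chart_facts[OF cd]
      let ?W = "W \<inter> U" and ?\<psi> = "restrict \<psi> (W \<inter> U)"
      have dU: "(?W, ?\<psi>) \<in> atlas M"
        using fd(1) U by (intro chart_restrict[OF M d']) auto
      note inj = chart_facts(6)[OF manifold_chart[OF M dU]]
      have cc: "smooth_on ?n ?n (\<phi> ` (V \<inter> ?W)) (?\<psi> \<circ> inv_into V \<phi>)"
        "smooth_on ?n ?n (?\<psi> ` (V \<inter> ?W)) (\<phi> \<circ> inv_into ?W ?\<psi>)"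
        using comp[OF dU] ceq by (auto simp: compatible_charts_def Int_commute)
      have VW: "V \<inter> ?W = V \<inter> W" using VU by blast
      have o: "openin ?X (V \<inter> W)" using f(1) fd(1) by blast
      have "smooth_on ?n ?n (\<phi> ` (V \<inter> W)) (\<psi> \<circ> inv_into V \<phi>)"
        by (rule smooth_on_cong[OF chart_open_image[OF ch o] _ cc(1)[unfolded VW]])
          (use f(6) VU in auto)
      moreover have im: "?\<psi> ` (V \<inter> W) = \<psi> ` (V \<inter> W)" using VU by auto
      moreover have "smooth_on ?n ?n (\<psi> ` (V \<inter> W)) (\<phi> \<circ> inv_into W \<psi>)"
      proof (rule smooth_on_cong[OF chart_open_image[OF cd o] _ cc(2)[unfolded VW im]])
        fix y assume "y \<in> \<psi> ` (V \<inter> W)"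
        then obtain x where x: "x \<in> V" "x \<in> W" "x \<in> U" "y = \<psi> x" using VU by blast
        have "inv_into W \<psi> y = x" using x fd(6) by simp
        moreover have "inv_into ?W ?\<psi> y = x" using inv_into_f_f[OF inj, of x] x by simp
        ultimately show "(\<phi> \<circ> inv_into ?W ?\<psi>) y = (\<phi> \<circ> inv_into W \<psi>) y" by simp
      qed simp
      ultimately show "compatible_charts ?n (V, \<phi>) d"
        by (simp add: compatible_charts_def deq Int_commute)
    qed
    then show ?thesis using ceq VU by simp
  qed
  have ch: "is_chart (subtopology ?X U) ?n c" if "c \<in> atlas M" "fst c \<subseteq> U" for c
    using sub[of "fst c" "snd c"] manifold_chart[OF M that(1)] that(2) by simp
  have H: "Hausdorff_space (subtopology ?X U)"
    using M Hausdorff_space_subtopology unfolding smooth_manifold_def by (elim conjE) blast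
  have C: "\<forall>c\<in>atlas M. \<forall>d\<in>atlas M. compatible_charts ?n c d"
    using M unfolding smooth_manifold_def by (elim conjE)
  let ?A = "{c \<in> atlas M. fst c \<subseteq> U}"
  show ?thesis
    unfolding smooth_manifold_def open_submanifold_simps
  proof (intro conjI)
    show "Hausdorff_space (subtopology ?X U)" by (rule H)
    show "paracompact_space (subtopology ?X U)" by (rule pc)
    show "\<forall>c\<in>?A. is_chart (subtopology ?X U) ?n c" using ch by blast
    show "(\<Union>c\<in>?A. fst c) = topspace (subtopology ?X U)" by (rule cov)
    show "\<forall>c\<in>?A. \<forall>d\<in>?A. compatible_charts ?n c d" using C by blast
    show "\<forall>c. is_chart (subtopology ?X U) ?n c \<and> (\<forall>d\<in>?A. compatible_charts ?n c d) \<longrightarrow> c \<in> ?A"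
      using maxi by blast
  qed
qed

section \<open>Smooth maps between manifolds\<close>

lemma smooth_mapsD:
  assumes "f \<in> smooth_maps M N"
  shows "f \<in> extensional (points M)" "\<And>x. x \<in> points M \<Longrightarrow> f x \<in> points N"
    "continuous_map (space_of M) (space_of N) f"
    "\<And>U \<phi> V \<psi>. (U, \<phi>) \<in> atlas M \<Longrightarrow> (V, \<psi>) \<in> atlas N \<Longrightarrow>
       smooth_on (mdim M) (mdim N) (\<phi> ` (U \<inter> f -` V)) (\<psi> \<circ> f \<circ> inv_into U \<phi>)"
  using assms by (auto simp: smooth_maps_def PiE_iff)

lemma smooth_mapsI:
  assumes "f \<in> extensional (points M)" "continuous_map (space_of M) (space_of N) f"
    "\<And>U \<phi> V \<psi>. (U, \<phi>) \<in> atlas M \<Longrightarrow> (V, \<psi>) \<in> atlas N \<Longrightarrow>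
       smooth_on (mdim M) (mdim N) (\<phi> ` (U \<inter> f -` V)) (\<psi> \<circ> f \<circ> inv_into U \<phi>)"
  shows "f \<in> smooth_maps M N"
proof -
  have "f x \<in> points N" if "x \<in> points M" for x
    using assms(2) that unfolding continuous_map_def by blast
  then show ?thesis using assms by (auto simp: smooth_maps_def PiE_iff)
qed

lemma openin_Int_vimage:
  assumes "continuous_map X Y f" "openin X U" "openin Y V"
  shows "openin X (U \<inter> f -` V)"
proof -
  have "openin X (U \<inter> {x \<in> topspace X. f x \<in> V})"
    by (intro openin_Int assms openin_continuous_map_preimage[OF assms(1,3)])
  moreover have "U \<inter> {x \<in> topspace X. f x \<in> V} = U \<inter> f -` V"
    using openin_subset[OF assms(2)] by blast
  ultimately show ?thesis by simp
qed

text \<open>Near a point of \<open>L\<close> the composite factors through a chart of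
  \<open>M\<close> around its image. The intermediate chart varies with the point, hence the appeal
  to \<open>smooth_on_locally\<close>.\<close>

lemma smooth_maps_compose:
  assumes L: "smooth_manifold L" and M: "smooth_manifold M" and N: "smooth_manifold N"
    and f: "f \<in> smooth_maps L M" and g: "g \<in> smooth_maps M N"
  shows "compose (points L) g f \<in> smooth_maps L N"
proof (rule smooth_mapsI)
  let ?h = "compose (points L) g f"
  note fD = smooth_mapsD[OF f] and gD = smooth_mapsD[OF g]
  show "?h \<in> extensional (points L)" by (rule compose_extensional)
  show hc: "continuous_map (space_of L) (space_of N) ?h"
    by (rule continuous_map_eq[OF continuous_map_compose[OF fD(3) gD(3)]]) (simp add: compose_def)
  fix U \<phi> V \<psi> assume U: "(U, \<phi>) \<in> atlas L" and V: "(V, \<psi>) \<in> atlas N"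
  note cU = manifold_chart[OF L U] and cV = manifold_chart[OF N V]
  note fU = chart_facts[OF cU] and fV = chart_facts[OF cV]
  show "smooth_on (mdim L) (mdim N) (\<phi> ` (U \<inter> ?h -` V)) (\<psi> \<circ> ?h \<circ> inv_into U \<phi>)"
  proof (rule smooth_on_locally)
    show "\<phi> ` (U \<inter> ?h -` V) \<subseteq> Rn (mdim L)" using fU(5) by blast
    fix y assume "y \<in> \<phi> ` (U \<inter> ?h -` V)"
    then obtain x where x: "x \<in> U" "?h x \<in> V" "y = \<phi> x" by blast
    have xL: "x \<in> points L" using x fU(2) by blast
    obtain W \<kappa> where W: "(W, \<kappa>) \<in> atlas M" "f x \<in> W"
      using manifold_chart_at[OF M fD(2)[OF xL]] .
    note cW = manifold_chart[OF M W(1)]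
    note fW = chart_facts[OF cW]
    define Z where "Z = W \<inter> g -` V"
    define A where "A = U \<inter> f -` Z"
    have Zo: "openin (space_of M) Z" unfolding Z_def by (rule openin_Int_vimage[OF gD(3) fW(1) fV(1)])
    have Ao: "openin (space_of L) A" unfolding A_def by (rule openin_Int_vimage[OF fD(3) fU(1) Zo])
    have AU: "A \<subseteq> U" and ZW: "Z \<subseteq> W" by (auto simp: A_def Z_def)
    have oA: "openin (Euclidean_space (mdim L)) (\<phi> ` A)" by (rule chart_open_image[OF cU Ao AU])
    have oZ: "openin (Euclidean_space (mdim M)) (\<kappa> ` Z)" by (rule chart_open_image[OF cW Zo ZW])
    have inv: "inv_into U \<phi> (\<phi> z) = z" if "z \<in> U" for z using fU(6) that by simp
    have invW: "inv_into W \<kappa> (\<kappa> z) = z" if "z \<in> W" for z using fW(6) that by simp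
    have "smooth_on (mdim L) (mdim N) (\<phi> ` A) (\<psi> \<circ> ?h \<circ> inv_into U \<phi>)"
    proof (rule smooth_on_cong[OF oA])
      show "smooth_on (mdim L) (mdim N) (\<phi> ` A) ((\<psi> \<circ> g \<circ> inv_into W \<kappa>) \<circ> (\<kappa> \<circ> f \<circ> inv_into U \<phi>))"
      proof (rule smooth_on_compose[OF oZ oA])
        show "(\<kappa> \<circ> f \<circ> inv_into U \<phi>) z \<in> \<kappa> ` Z" if "z \<in> \<phi> ` A" for z
          using that inv AU by (auto simp: A_def)
        show "smooth_on (mdim M) (mdim N) (\<kappa> ` Z) (\<psi> \<circ> g \<circ> inv_into W \<kappa>)"
          using gD(4)[OF W(1) V] by (simp add: Z_def)
        show "smooth_on (mdim L) (mdim M) (\<phi> ` A) (\<kappa> \<circ> f \<circ> inv_into U \<phi>)"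
          by (rule smooth_on_subset[OF fD(4)[OF U W(1)]]) (use fU(5) in \<open>auto simp: A_def Z_def\<close>)
      qed
      fix z assume "z \<in> \<phi> ` A"
      then obtain a where a: "a \<in> U" "f a \<in> W" "z = \<phi> a" by (auto simp: A_def Z_def)
      then show "((\<psi> \<circ> g \<circ> inv_into W \<kappa>) \<circ> (\<kappa> \<circ> f \<circ> inv_into U \<phi>)) z = (\<psi> \<circ> ?h \<circ> inv_into U \<phi>) z"
        using inv invW fU(2) by (auto simp: compose_def)
    qed
    moreover have "y \<in> \<phi> ` A" using x W xL by (auto simp: A_def Z_def compose_def)
    ultimately show "\<exists>V'. openin (Euclidean_space (mdim L)) V' \<and> y \<in> V' \<and>
        smooth_on (mdim L) (mdim N) V' (\<psi> \<circ> ?h \<circ> inv_into U \<phi>)" using oA by blast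
  qed
qed

lemma smooth_maps_inclusion:
  assumes M: "smooth_manifold M" and V: "openin (space_of M) V"
  shows "(\<lambda>x\<in>V. x) \<in> smooth_maps (open_submanifold M V) M"
proof (rule smooth_mapsI)
  have VX: "V \<subseteq> points M" using V openin_subset by blast
  have "continuous_map (subtopology (space_of M) V) (space_of M) (\<lambda>x. x)"
    by (simp add: continuous_map_from_subtopology)
  then have "continuous_map (subtopology (space_of M) V) (space_of M) (\<lambda>x\<in>V. x)"
    by (rule continuous_map_eq) simp
  then show "continuous_map (space_of (open_submanifold M V)) (space_of M) (\<lambda>x\<in>V. x)" by simp
  show "(\<lambda>x\<in>V. x) \<in> extensional (points (open_submanifold M V))"
    using points_open_submanifold[OF V] by simp
  fix U \<phi> W \<psi> assume U: "(U, \<phi>) \<in> atlas (open_submanifold M V)" and W: "(W, \<psi>) \<in> atlas M"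
  then have U': "(U, \<phi>) \<in> atlas M" "U \<subseteq> V" by auto
  note c = manifold_chart[OF M U'(1)]
  note f = chart_facts[OF c]
  have o: "openin (space_of M) (U \<inter> W)" using f(1) chart_facts(1)[OF manifold_chart[OF M W]] by blast
  have eq: "U \<inter> (\<lambda>x\<in>V. x) -` W = U \<inter> W" using U'(2) by auto
  show "smooth_on (mdim (open_submanifold M V)) (mdim M) (\<phi> ` (U \<inter> (\<lambda>x\<in>V. x) -` W)) (\<psi> \<circ> (\<lambda>x\<in>V. x) \<circ> inv_into U \<phi>)"
    unfolding eq open_submanifold_simps
    by (rule smooth_on_cong[OF chart_open_image[OF c o] _ manifold_compatible[OF M U'(1) W]])
      (use f(6) U'(2) in auto)
qed

lemma smooth_maps_ident:
  assumes M: "smooth_manifold M" shows "(\<lambda>x\<in>points M. x) \<in> smooth_maps M M"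
proof -
  have "{c \<in> atlas M. fst c \<subseteq> points M} = atlas M"
    using chart_facts(2)[OF manifold_chart[OF M]] by force
  then have "open_submanifold M (points M) = M" by (simp add: open_submanifold_def)
  then show ?thesis using smooth_maps_inclusion[OF M openin_topspace] by simp
qed

text \<open>Used for a map from a cartesian space, restricted to a member of a cover that refines
  the preimages of an open cover.\<close>

lemma smooth_maps_restrict:
  assumes L: "smooth_manifold L" and M: "smooth_manifold M"
    and B: "openin (space_of L) B" and U: "openin (space_of M) U"
    and f: "f \<in> smooth_maps L M" and fB: "\<And>x. x \<in> B \<Longrightarrow> f x \<in> U"
  shows "restrict f B \<in> smooth_maps (open_submanifold L B) (open_submanifold M U)"
proof (rule smooth_mapsI)
  note fD = smooth_mapsD[OF f]
  note pB = points_open_submanifold[OF B]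
  show "restrict f B \<in> extensional (points (open_submanifold L B))" using pB by simp
  have "continuous_map (subtopology (space_of L) B) (space_of M) (restrict f B)"
    by (rule continuous_map_eq[OF continuous_map_from_subtopology[OF fD(3)]]) auto
  then show "continuous_map (space_of (open_submanifold L B)) (space_of (open_submanifold M U)) (restrict f B)"
    using fB by (auto simp: continuous_map_in_subtopology)
  fix V \<phi> W \<psi> assume VW: "(V, \<phi>) \<in> atlas (open_submanifold L B)" "(W, \<psi>) \<in> atlas (open_submanifold M U)"
  then have V: "(V, \<phi>) \<in> atlas L" "V \<subseteq> B" and W: "(W, \<psi>) \<in> atlas M" "W \<subseteq> U" by auto
  note c = manifold_chart[OF L V(1)]
  note fc = chart_facts[OF c]
  have eq: "V \<inter> restrict f B -` W = V \<inter> f -` W" using V(2) by auto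
  have s: "smooth_on (mdim L) (mdim M) (\<phi> ` (V \<inter> f -` W)) (\<psi> \<circ> f \<circ> inv_into V \<phi>)" by (rule fD(4)[OF V(1) W(1)])
  show "smooth_on (mdim (open_submanifold L B)) (mdim (open_submanifold M U))
      (\<phi> ` (V \<inter> restrict f B -` W)) (\<psi> \<circ> restrict f B \<circ> inv_into V \<phi>)"
    unfolding eq open_submanifold_simps
  proof (rule smooth_on_cong[OF _ _ s])
    have "openin (space_of M) W" by (rule chart_facts(1)[OF manifold_chart[OF M W(1)]])
    then have "openin (space_of L) (V \<inter> f -` W)" by (rule openin_Int_vimage[OF fD(3) fc(1)])
    then show "openin (Euclidean_space (mdim L)) (\<phi> ` (V \<inter> f -` W))" by (rule chart_open_image[OF c]) simp
    show "(\<psi> \<circ> f \<circ> inv_into V \<phi>) y = (\<psi> \<circ> restrict f B \<circ> inv_into V \<phi>) y" if "y \<in> \<phi> ` (V \<inter> f -` W)" for y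
      using that fc(6) V(2) by auto
  qed
qed

text \<open>The only point of the one-point manifold is \<open>undefined\<close>, so this is the
  morphism from the terminal object that names the point \<open>v\<close>.\<close>

definition pt :: "'n \<Rightarrow> 'm \<Rightarrow> 'n" where "pt v = (\<lambda>_\<in>{undefined}. v)"

lemma smooth_maps_point:
  fixes N :: "'n mfd"
  assumes N: "smooth_manifold N" and v: "v \<in> points N"
  shows "pt v \<in> smooth_maps (one_point_mfd :: 'm mfd) N"
proof (rule smooth_mapsI)
  show "pt v \<in> extensional (points (one_point_mfd :: 'm mfd))" by (simp add: pt_def)
  show "continuous_map (space_of (one_point_mfd :: 'm mfd)) (space_of N) (pt v)"
    using v by (simp add: one_point_mfd_def pt_def)
  fix U \<phi> V \<psi> assume "(U, \<phi>) \<in> atlas (one_point_mfd :: 'm mfd)" "(V, \<psi>) \<in> atlas N"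
  \<comment> \<open>In dimension 0 there are no partial derivatives to consider and the space is
    discrete, so every function is smooth.\<close>
  have c: "C_diff 0 k A f" for k A f
  proof -
    have "Rn 0 = {\<lambda>_. 0}" by (auto simp: Rn_def)
    then have "Euclidean_space 0 = discrete_topology {\<lambda>_. 0}"
      using subtopology_eq_discrete_topology_sing topspace_Euclidean_space_Rn by (metis subtopology_topspace)
    then have "continuous_map (subtopology (Euclidean_space 0) A) euclideanreal f"
      by (simp add: continuous_map_from_subtopology)
    then show ?thesis by (cases k) auto
  qed
  show "smooth_on (mdim (one_point_mfd :: 'm mfd)) (mdim N) (\<phi> ` (U \<inter> pt v -` V))
      (\<psi> \<circ> pt v \<circ> inv_into U \<phi>)"
    by (simp add: smooth_on_def one_point_mfd_def c)
qed

text \<open>A chart onto the whole of \<open>Rn n\<close> is itself the required diffeomorphism;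
  both directions reduce to compatibility with the charts of \<open>M\<close> and to
  \<open>sid\<close> for those of \<open>Rn n\<close>.\<close>

lemma cartesian_mfd_chart:
  assumes M: "smooth_manifold M" and c: "(U, \<phi>) \<in> atlas M" and onto: "\<phi> ` U = Rn (mdim M)"
  shows "cartesian_mfd (open_submanifold M U)"
proof -
  let ?n = "mdim M" and ?E = "Euclidean_mfd (mdim M)" and ?MU = "open_submanifold M U" and ?id = "\<lambda>x\<in>Rn (mdim M). x"
  note ch = manifold_chart[OF M c]
  note f = chart_facts[OF ch]
  have pU: "points ?MU = U" by (rule points_open_submanifold[OF f(1)])
  have E: "space_of ?E = Euclidean_space ?n" "mdim ?E = ?n" "points ?E = Rn ?n" by (auto simp: Euclidean_mfd_def)
  have EA: "is_chart (Euclidean_space ?n) ?n (V, \<psi>)" "compatible_charts ?n (V, \<psi>) (Rn ?n, ?id)" if "(V, \<psi>) \<in> atlas ?E" for V \<psi>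
    using that by (auto simp: Euclidean_mfd_def)
  have inv: "inv_into U \<phi> (\<phi> x) = x" if "x \<in> U" for x using f(6) that by simp
  have f2: "\<phi> (inv_into U \<phi> y) = y" "inv_into U \<phi> y \<in> U" if "y \<in> Rn ?n" for y
    using that onto by (auto intro: f_inv_into_f inv_into_into)
  have oR: "openin (Euclidean_space ?n) (Rn ?n)" using openin_topspace[of "Euclidean_space ?n"] by simp
  \<comment> \<open>Compatibility with the identity chart means that a chart of
    \<open>Euclidean_mfd\<close> is smooth in the ordinary sense and has a smooth inverse.\<close>
  have sid: "smooth_on ?n ?n V \<psi>" "smooth_on ?n ?n (\<psi> ` V) (inv_into V \<psi>)" "V \<subseteq> Rn ?n" if "(V, \<psi>) \<in> atlas ?E" for V \<psi>
  proof -
    note cV = chart_facts[OF EA(1)[OF that]]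
    show VR: "V \<subseteq> Rn ?n" using cV(2) by simp
    have injid: "inj_on ?id (Rn ?n)" by (simp add: inj_on_def)
    have iid: "inv_into (Rn ?n) ?id y = y" if "y \<in> Rn ?n" for y using inv_into_f_f[OF injid that] that by simp
    have VE: "V \<inter> Rn ?n = V" "Rn ?n \<inter> V = V" "?id ` V = V" using VR by (auto simp: image_iff)
    have comp: "smooth_on ?n ?n (\<psi> ` V) (?id \<circ> inv_into V \<psi>)" "smooth_on ?n ?n V (\<psi> \<circ> inv_into (Rn ?n) ?id)"
      using EA(2)[OF that] VE by (auto simp: compatible_charts_def)
    show "smooth_on ?n ?n V \<psi>"
      by (rule smooth_on_cong[OF cV(1) _ comp(2)]) (use VR iid in auto)
    show "smooth_on ?n ?n (\<psi> ` V) (inv_into V \<psi>)"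
      by (rule smooth_on_cong[OF cV(4) _ comp(1)]) (use VR inv_into_into[of _ \<psi> V] in auto)
  qed
  have phi: "\<phi> \<in> smooth_maps ?MU ?E"
  proof (rule smooth_mapsI)
    show "\<phi> \<in> extensional (points ?MU)" using f(3) pU by simp
    show cont: "continuous_map (space_of ?MU) (space_of ?E) \<phi>" using f(7) E by simp
    fix V \<kappa> W \<psi> assume "(V, \<kappa>) \<in> atlas ?MU" and W: "(W, \<psi>) \<in> atlas ?E"
    then have V: "(V, \<kappa>) \<in> atlas M" "V \<subseteq> U" by auto
    note cV = manifold_chart[OF M V(1)]
    note fV = chart_facts[OF cV]
    have "openin (space_of ?MU) V" using fV(1) V(2) openin_open_subtopology[OF f(1)] by simp
    then have "openin (space_of ?MU) (V \<inter> \<phi> -` W)"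
      using chart_facts(1)[OF EA(1)[OF W]] E by (intro openin_Int_vimage[OF cont]) auto
    then have o: "openin (space_of M) (V \<inter> \<phi> -` W)" using openin_open_subtopology[OF f(1)] by simp
    have oi: "openin (Euclidean_space ?n) (\<kappa> ` (V \<inter> \<phi> -` W))" by (rule chart_open_image[OF cV o]) simp
    have "smooth_on ?n ?n (\<kappa> ` (V \<inter> \<phi> -` W)) (\<psi> \<circ> (\<phi> \<circ> inv_into V \<kappa>))"
    proof (rule smooth_on_compose[OF _ oi _ sid(1)[OF W]])
      show "openin (Euclidean_space ?n) W" by (rule chart_facts(1)[OF EA(1)[OF W]])
      show "(\<phi> \<circ> inv_into V \<kappa>) y \<in> W" if "y \<in> \<kappa> ` (V \<inter> \<phi> -` W)" for y using that fV(6) by auto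
      show "smooth_on ?n ?n (\<kappa> ` (V \<inter> \<phi> -` W)) (\<phi> \<circ> inv_into V \<kappa>)"
        by (rule smooth_on_subset[OF manifold_compatible[OF M V(1) c]]) (use V(2) fV(5) in blast)+
    qed
    then show "smooth_on (mdim ?MU) (mdim ?E) (\<kappa> ` (V \<inter> \<phi> -` W)) (\<psi> \<circ> \<phi> \<circ> inv_into V \<kappa>)"
      using E by (simp add: comp_assoc)
  qed
  let ?g = "\<lambda>y\<in>Rn ?n. inv_into U \<phi> y"
  have psi: "?g \<in> smooth_maps ?E ?MU"
  proof (rule smooth_mapsI)
    show "?g \<in> extensional (points ?E)" using E by simp
    have "continuous_map (Euclidean_space ?n) (subtopology (space_of M) U) (inv_into U \<phi>)"
      using f(8) onto subtopology_topspace[of "Euclidean_space ?n"] by simp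
    then have "continuous_map (Euclidean_space ?n) (subtopology (space_of M) U) ?g"
      by (rule continuous_map_eq) simp
    then show cont: "continuous_map (space_of ?E) (space_of ?MU) ?g" using E by simp
    fix W \<psi> V \<kappa> assume "(V, \<kappa>) \<in> atlas ?MU" and W: "(W, \<psi>) \<in> atlas ?E"
    then have V: "(V, \<kappa>) \<in> atlas M" "V \<subseteq> U" by auto
    note cV = manifold_chart[OF M V(1)]
    note fV = chart_facts[OF cV]
    note cW = EA(1)[OF W]
    note fW = chart_facts[OF cW]
    have oV: "openin (space_of ?MU) V" using fV(1) V(2) openin_open_subtopology[OF f(1)] by simp
    have "openin (space_of ?E) (W \<inter> ?g -` V)"
      using fW(1) E by (intro openin_Int_vimage[OF cont _ oV]) simp
    then have o: "openin (Euclidean_space ?n) (W \<inter> ?g -` V)" using E by simp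
    have oi: "openin (Euclidean_space ?n) (\<psi> ` (W \<inter> ?g -` V))" by (rule chart_open_image[OF cW o]) simp
    have ov: "openin (Euclidean_space ?n) (\<phi> ` V)" by (rule chart_open_image[OF ch fV(1) V(2)])
    have UV: "U \<inter> V = V" using V(2) by blast
    have WR: "W \<subseteq> Rn ?n" by (rule sid(3)[OF W])
    have iW: "inv_into W \<psi> (\<psi> x) = x" if "x \<in> W" for x using fW(6) that by simp
    have "smooth_on ?n ?n (\<psi> ` (W \<inter> ?g -` V)) ((\<kappa> \<circ> inv_into U \<phi>) \<circ> inv_into W \<psi>)"
    proof (rule smooth_on_compose[OF ov oi])
      show "inv_into W \<psi> y \<in> \<phi> ` V" if y: "y \<in> \<psi> ` (W \<inter> ?g -` V)" for y
      proof -
        obtain z where z: "z \<in> W" "?g z \<in> V" "y = \<psi> z" using y by blast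
        then have "z = \<phi> (?g z)" using f2(1) WR by auto
        then have "z \<in> \<phi> ` V" using z(2) by blast
        then show ?thesis using iW z by simp
      qed
      show "smooth_on ?n ?n (\<phi> ` V) (\<kappa> \<circ> inv_into U \<phi>)"
        using manifold_compatible[OF M c V(1)] by (simp add: UV)
      show "smooth_on ?n ?n (\<psi> ` (W \<inter> ?g -` V)) (inv_into W \<psi>)"
        by (rule smooth_on_subset[OF sid(2)[OF W]]) (use fW(5) in auto)
    qed
    then have "smooth_on ?n ?n (\<psi> ` (W \<inter> ?g -` V)) (\<kappa> \<circ> ?g \<circ> inv_into W \<psi>)"
      by (rule smooth_on_cong[OF oi, rotated]) (use iW WR in auto)
    then show "smooth_on (mdim ?E) (mdim ?MU) (\<psi> ` (W \<inter> ?g -` V)) (\<kappa> \<circ> ?g \<circ> inv_into W \<psi>)"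
      using E by simp
  qed
  have "smooth_manifold ?MU"
    by (rule smooth_manifold_open_submanifold[OF M f(1) paracompact_chart_domain[OF ch]])
  moreover have "diffeomorphic ?MU ?E"
    unfolding diffeomorphic_def
    by (intro bexI[OF _ phi] bexI[OF _ psi] conjI ballI) (use pU E f2 inv onto in auto)
  ultimately show ?thesis unfolding cartesian_mfd_def by blast
qed

lemma cartesian_imp_open_type: "cartesian_mfd M \<Longrightarrow> open_type_mfd M"
proof -
  assume "cartesian_mfd M"
  then obtain n where M: "smooth_manifold M" "diffeomorphic M (Euclidean_mfd n)"
    by (auto simp: cartesian_mfd_def)
  have "fst c \<subseteq> Rn n" if "c \<in> atlas (Euclidean_mfd n)" for c
    using that chart_facts(2)[of "Euclidean_space n" n "fst c" "snd c"] by (auto simp: Euclidean_mfd_def)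
  then have "open_submanifold (Euclidean_mfd n) (Rn n) = Euclidean_mfd n"
    using subtopology_topspace[of "Euclidean_space n"]
    by (auto simp: open_submanifold_def Euclidean_mfd_def)
  moreover have "openin (Euclidean_space n) (Rn n)" using openin_topspace[of "Euclidean_space n"] by simp
  ultimately show ?thesis
    using M unfolding open_type_mfd_def by (metis (no_types, lifting))
qed

section \<open>Good open covers\<close>

lemma chart_ball:
  assumes "openin (Euclidean_space n) Y" "c \<in> Y"
  shows "\<exists>R>0. ball_Rn n c R \<subseteq> Y"
  using small_ball_cell[OF assms(1,1) smooth_on_ident[OF assms(1)] smooth_on_ident[OF assms(1)] _ _ _ _ assms(2)]
  by auto

lemma centre_in_ball_Rn: "c \<in> Rn n \<Longrightarrow> r > 0 \<Longrightarrow> c \<in> ball_Rn n c r"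
  by (simp add: ball_Rn_def)

lemma ball_Rn_mono: "0 \<le> r \<Longrightarrow> r \<le> s \<Longrightarrow> ball_Rn n c r \<subseteq> ball_Rn n c s"
  by (auto simp: ball_Rn_def intro: less_le_trans[OF _ power_mono])

text \<open>A closed ball in a chart is compact, hence closed in the Hausdorff space
  \<open>M\<close>, so the closure of the open ball inside it cannot leave the chart domain.\<close>

lemma small_nbhd_closure_in_chart:
  assumes M: "smooth_manifold M" and p: "p \<in> points M"
  shows "\<exists>W. openin (space_of M) W \<and> p \<in> W \<and> (\<exists>c\<in>atlas M. space_of M closure_of W \<subseteq> fst c)"
proof -
  let ?n = "mdim M" and ?X = "space_of M"
  obtain U \<phi> where U: "(U, \<phi>) \<in> atlas M" "p \<in> U" using manifold_chart_at[OF M p] .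
  note c = manifold_chart[OF M U(1)]
  note f = chart_facts[OF c]
  obtain R where R: "R > 0" "ball_Rn ?n (\<phi> p) R \<subseteq> \<phi> ` U"
    using chart_ball[OF f(4)] U(2) by blast
  define W where "W = {x \<in> U. \<phi> x \<in> ball_Rn ?n (\<phi> p) (R / 2)}"
  define K where "K = inv_into U \<phi> ` cball_Rn ?n (\<phi> p) ((R / 2)\<^sup>2)"
  have sub: "cball_Rn ?n (\<phi> p) ((R / 2)\<^sup>2) \<subseteq> \<phi> ` U"
    using cball_Rn_subset_ball_Rn[of "R / 2" R] R by force
  have "compactin (Euclidean_space ?n) (cball_Rn ?n (\<phi> p) ((R / 2)\<^sup>2))"
    using compact_cball_Rn by (auto simp: Euclidean_space_eq compactin_subtopology cball_Rn_def)
  then have "compactin (subtopology (Euclidean_space ?n) (\<phi> ` U)) (cball_Rn ?n (\<phi> p) ((R / 2)\<^sup>2))"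
    using sub by (simp add: compactin_subtopology)
  then have "compactin (subtopology ?X U) K" unfolding K_def by (rule image_compactin[OF _ f(8)])
  then have K: "compactin ?X K" "K \<subseteq> U" by (auto simp: compactin_subtopology)
  have "Hausdorff_space ?X" using M unfolding smooth_manifold_def by (elim conjE)
  then have "closedin ?X K" using K(1) compactin_imp_closedin by blast
  moreover have "W \<subseteq> K"
  proof
    fix x assume x: "x \<in> W"
    then have "x = inv_into U \<phi> (\<phi> x)" using f(6) by (simp add: W_def)
    moreover have "\<phi> x \<in> cball_Rn ?n (\<phi> p) ((R / 2)\<^sup>2)" using x by (auto simp: W_def ball_Rn_def cball_Rn_def)
    ultimately show "x \<in> K" unfolding K_def by blast
  qed
  ultimately have "?X closure_of W \<subseteq> K" by (simp add: closure_of_minimal)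
  then have "?X closure_of W \<subseteq> fst (U, \<phi>)" using K(2) by simp
  moreover have "openin ?X W" unfolding W_def by (rule chart_open_preimage[OF c openin_ball_Rn])
  moreover have "p \<in> W" using U(2) R(1) f(5) centre_in_ball_Rn[of "\<phi> p" ?n "R / 2"] by (auto simp: W_def)
  ultimately show ?thesis using U(1) by blast
qed

text \<open>Shrinking \<open>B\<close> makes it disjoint from the members of \<open>\<V>\<close> whose closure misses \<open>p\<close>. The remaining ones are
  finitely many, and \<open>p\<close> lies in the domains of their charts.\<close>

lemma multi_chart_cell:
  fixes CU :: "'m set \<Rightarrow> 'm set" and C\<phi> :: "'m set \<Rightarrow> 'm \<Rightarrow> nat \<Rightarrow> real"
  assumes M: "smooth_manifold M" and p: "p \<in> points M"
    and V: "\<And>V. V \<in> \<V> \<Longrightarrow> openin (space_of M) V" "\<And>V. V \<in> \<V> \<Longrightarrow> (CU V, C\<phi> V) \<in> atlas M"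
      "\<And>V. V \<in> \<V> \<Longrightarrow> space_of M closure_of V \<subseteq> CU V"
    and lf: "locally_finite_in (space_of M) \<V>" and V0: "V0 \<in> \<V>" "p \<in> V0"
    and O: "openin (space_of M) N0" "p \<in> N0"
  shows "\<exists>B. openin (space_of M) B \<and> p \<in> B \<and> B \<subseteq> N0 \<and> B \<subseteq> V0 \<and>
     (\<forall>V\<in>\<V>. B \<inter> V \<noteq> {} \<longrightarrow> B \<subseteq> CU V \<and> (\<exists>f. cell (mdim M) (C\<phi> V ` B) f))"
proof -
  let ?n = "mdim M" and ?X = "space_of M"
  have ch: "is_chart ?X ?n (CU V, C\<phi> V)" if "V \<in> \<V>" for V by (rule manifold_chart[OF M V(2)[OF that]])
  have clV: "V \<subseteq> ?X closure_of V" if "V \<in> \<V>" for V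
    using closure_of_subset openin_subset[OF V(1)[OF that]] by blast
  obtain N where N: "openin ?X N" "p \<in> N" "finite {V \<in> \<V>. V \<inter> N \<noteq> {}}"
    using lf p unfolding locally_finite_in_def by blast
  define F where "F = {V \<in> \<V>. V \<inter> N \<noteq> {}}"
  define F1 where "F1 = {V \<in> F. p \<in> ?X closure_of V}"
  define F2 where "F2 = {V \<in> F. p \<notin> ?X closure_of V}"
  have fin: "finite F1" "finite F2" using N(3) unfolding F1_def F2_def F_def[symmetric] by simp_all
  define U0 where "U0 = CU V0"
  define \<phi>0 where "\<phi>0 = C\<phi> V0"
  note c0 = ch[OF V0(1), folded U0_def \<phi>0_def] and a0 = V(2)[OF V0(1), folded U0_def \<phi>0_def]
  note f0 = chart_facts[OF c0]
  have pU0: "p \<in> U0" using V(3)[OF V0(1)] clV[OF V0(1)] V0(2) by (auto simp: U0_def)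
  \<comment> \<open>The change of charts between \<open>C\<phi> V\<close> and the reference chart
    \<phi>0 is put into \<open>small_ball_cell\<close>: balls around \<open>\<phi>0 p\<close> in the
    reference chart are cells when viewed in \<open>C\<phi> V\<close>.\<close>
  have "\<exists>R>0. ball_Rn ?n (\<phi>0 p) R \<subseteq> \<phi>0 ` (CU V \<inter> U0) \<and>
      (\<forall>r. 0 < r \<longrightarrow> r < R \<longrightarrow> (\<exists>f. cell ?n ((C\<phi> V \<circ> inv_into U0 \<phi>0) ` ball_Rn ?n (\<phi>0 p) r) f))"
    if "V \<in> F1" for V
  proof -
    have VV: "V \<in> \<V>" using that by (auto simp: F1_def F_def)
    note cV = ch[OF VV] and aV = V(2)[OF VV]
    note fV = chart_facts[OF cV]
    have pV: "p \<in> CU V" using that V(3)[OF VV] by (auto simp: F1_def)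
    have o: "openin ?X (CU V \<inter> U0)" using fV(1) f0(1) by blast
    have iV: "inv_into (CU V) (C\<phi> V) (C\<phi> V x) = x" if "x \<in> CU V" for x using fV(6) that by simp
    have i0: "inv_into U0 \<phi>0 (\<phi>0 x) = x" if "x \<in> U0" for x using f0(6) that by simp
    show ?thesis
    proof (rule small_ball_cell)
      show "openin (Euclidean_space ?n) (C\<phi> V ` (CU V \<inter> U0))" by (rule chart_open_image[OF cV o]) simp
      show "openin (Euclidean_space ?n) (\<phi>0 ` (CU V \<inter> U0))" by (rule chart_open_image[OF c0 o]) simp
      show "smooth_on ?n ?n (C\<phi> V ` (CU V \<inter> U0)) (\<phi>0 \<circ> inv_into (CU V) (C\<phi> V))"
        by (rule manifold_compatible[OF M aV a0])
      show "smooth_on ?n ?n (\<phi>0 ` (CU V \<inter> U0)) (C\<phi> V \<circ> inv_into U0 \<phi>0)"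
        using manifold_compatible[OF M a0 aV] by (simp add: Int_commute)
      show "\<phi>0 p \<in> \<phi>0 ` (CU V \<inter> U0)" using pV pU0 by blast
    qed (auto simp: iV i0)
  qed
  then obtain Rf where Rf: "\<And>V. V \<in> F1 \<Longrightarrow> Rf V > 0"
    "\<And>V. V \<in> F1 \<Longrightarrow> ball_Rn ?n (\<phi>0 p) (Rf V) \<subseteq> \<phi>0 ` (CU V \<inter> U0)"
    "\<And>V r. V \<in> F1 \<Longrightarrow> 0 < r \<Longrightarrow> r < Rf V \<Longrightarrow>
      \<exists>f. cell ?n ((C\<phi> V \<circ> inv_into U0 \<phi>0) ` ball_Rn ?n (\<phi>0 p) r) f" by metis
  \<comment> \<open>The intersection over \<open>F2\<close> is \<open>UNIV\<close> when
    \<open>F2\<close> is empty, so it is cut down to the space in order to be open.\<close>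
  define G where "G = (N \<inter> V0 \<inter> N0) \<inter> (topspace ?X \<inter> (\<Inter>V\<in>F2. topspace ?X - ?X closure_of V)) \<inter> U0"
  have oF2: "openin ?X (topspace ?X \<inter> (\<Inter>V\<in>F2. topspace ?X - ?X closure_of V))"
  proof (cases "F2 = {}")
    case False
    have "openin ?X (\<Inter>V\<in>F2. topspace ?X - ?X closure_of V)"
      using fin(2) False by (intro openin_INT2) (auto intro: openin_diff)
    then show ?thesis by (intro openin_Int openin_topspace)
  qed simp
  have G: "openin ?X G" unfolding G_def
    by (rule openin_Int[OF openin_Int[OF openin_Int[OF openin_Int[OF N(1) V(1)[OF V0(1)]] O(1)] oF2] f0(1)])
  have pG: "p \<in> G" unfolding G_def using N(2) V0(2) O(2) p pU0 by (auto simp: F2_def)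
  have GU: "G \<subseteq> U0" by (auto simp: G_def)
  obtain R0 where R0: "R0 > 0" "ball_Rn ?n (\<phi>0 p) R0 \<subseteq> \<phi>0 ` G"
    using chart_ball[OF chart_open_image[OF c0 G GU]] pG by blast
  \<comment> \<open>Half the minimum lies strictly below all the radii, as the inequality
    \<open>r < Rf V\<close> has to be strict.\<close>
  define r where "r = Min (insert R0 (Rf ` F1)) / 2"
  have m: "Min (insert R0 (Rf ` F1)) > 0" using fin(1) R0(1) Rf(1) by simp
  have m2: "Min (insert R0 (Rf ` F1)) \<le> R0" "\<And>V. V \<in> F1 \<Longrightarrow> Min (insert R0 (Rf ` F1)) \<le> Rf V"
    using fin(1) by simp_all
  have r: "r > 0" "r < R0" "\<And>V. V \<in> F1 \<Longrightarrow> r < Rf V" using m m2 by (force simp: r_def)+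
  define B where "B = {x \<in> U0. \<phi>0 x \<in> ball_Rn ?n (\<phi>0 p) r}"
  have Bo: "openin ?X B" unfolding B_def by (rule chart_open_preimage[OF c0 openin_ball_Rn])
  have pB: "p \<in> B" using pU0 r(1) f0(5) centre_in_ball_Rn[of "\<phi>0 p" ?n r] by (auto simp: B_def)
  have BG: "B \<subseteq> G"
  proof
    fix x assume x: "x \<in> B"
    then have "\<phi>0 x \<in> \<phi>0 ` G" using ball_Rn_mono[of r R0] r R0(2) by (force simp: B_def)
    then show "x \<in> G" using inj_on_image_mem_iff[OF f0(6) _ GU] x by (auto simp: B_def)
  qed
  have Bim: "inv_into U0 \<phi>0 ` ball_Rn ?n (\<phi>0 p) r = B"
  proof (intro equalityI subsetI)
    fix x assume "x \<in> inv_into U0 \<phi>0 ` ball_Rn ?n (\<phi>0 p) r"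
    then obtain y where y: "y \<in> ball_Rn ?n (\<phi>0 p) r" "x = inv_into U0 \<phi>0 y" by blast
    then have "y \<in> \<phi>0 ` U0" using ball_Rn_mono[of r R0] r R0(2) GU by force
    then show "x \<in> B" using y f_inv_into_f[of y \<phi>0 U0] inv_into_into[of y \<phi>0 U0] by (simp add: B_def)
  next
    fix x assume x: "x \<in> B"
    then have "x = inv_into U0 \<phi>0 (\<phi>0 x)" using f0(6) by (simp add: B_def)
    then show "x \<in> inv_into U0 \<phi>0 ` ball_Rn ?n (\<phi>0 p) r" using x unfolding B_def by blast
  qed
  have "B \<subseteq> CU V \<and> (\<exists>f. cell ?n (C\<phi> V ` B) f)" if VV: "V \<in> \<V>" and meet: "B \<inter> V \<noteq> {}" for V
  proof -
    have F: "V \<in> F" using VV meet BG by (auto simp: F_def G_def)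
    have "p \<in> ?X closure_of V"
    proof (rule ccontr)
      assume "p \<notin> ?X closure_of V"
      then have "V \<in> F2" using F by (simp add: F2_def)
      then have "G \<subseteq> topspace ?X - ?X closure_of V" unfolding G_def by blast
      then have "B \<inter> ?X closure_of V = {}" using BG by blast
      then show False using meet clV[OF VV] by blast
    qed
    then have F1: "V \<in> F1" using F by (simp add: F1_def)
    have "B \<subseteq> CU V"
    proof
      fix x assume x: "x \<in> B"
      then have "\<phi>0 x \<in> \<phi>0 ` (CU V \<inter> U0)"
        using ball_Rn_mono[of r "Rf V"] r(1) r(3)[OF F1] Rf(2)[OF F1] by (force simp: B_def)
      then show "x \<in> CU V" using inj_on_image_mem_iff[OF f0(6), of x "CU V \<inter> U0"] x by (auto simp: B_def)
    qed
    moreover have "\<exists>f. cell ?n (C\<phi> V ` B) f"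
      using Rf(3)[OF F1 r(1) r(3)[OF F1]] Bim by (simp only: image_comp[symmetric])
    ultimately show ?thesis by blast
  qed
  then show ?thesis using Bo pB BG by (intro exI[of _ B]) (auto simp: G_def)
qed

text \<open>Each member of the new cover is a cell in every chart \<open>CU V\<close> whose
  \<open>V\<close> it meets. Finitely many members with a common point share such a chart, where
  \<open>cells_diffeo\<close> applies to their intersection. The refinement clause is what makes
  good covers comparable with open ones.\<close>

theorem good_open_cover_refinement:
  assumes M: "smooth_manifold M" and cov: "open_cover M \<U>"
  obtains \<G> where "good_open_cover M \<G>" "\<And>G. G \<in> \<G> \<Longrightarrow> \<exists>U\<in>\<U>. G \<subseteq> U"
proof -
  let ?n = "mdim M" and ?X = "space_of M"
  \<comment> \<open>The property that the closure lies in one chart domain passes to smaller sets,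
    so the locally finite refinement inherits it.\<close>
  define \<W> where "\<W> = {W. openin ?X W \<and> (\<exists>c\<in>atlas M. ?X closure_of W \<subseteq> fst c)}"
  have "(\<forall>W\<in>\<W>. openin ?X W) \<and> \<Union>\<W> = topspace ?X"
  proof (intro conjI equalityI subsetI)
    fix p assume "p \<in> topspace ?X"
    then show "p \<in> \<Union>\<W>" using small_nbhd_closure_in_chart[OF M, of p] by (auto simp: \<W>_def)
  qed (use openin_subset in \<open>auto simp: \<W>_def\<close>)
  moreover have "paracompact_space ?X" using M unfolding smooth_manifold_def by (elim conjE)
  ultimately obtain \<V> where \<V>: "\<And>V. V \<in> \<V> \<Longrightarrow> openin ?X V \<and> (\<exists>W\<in>\<W>. V \<subseteq> W)"
    "\<Union>\<V> = topspace ?X" "locally_finite_in ?X \<V>"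
    unfolding paracompact_space_def by meson
  have "\<forall>V\<in>\<V>. \<exists>c. c \<in> atlas M \<and> ?X closure_of V \<subseteq> fst c"
  proof
    fix V assume "V \<in> \<V>"
    then obtain W where W: "W \<in> \<W>" "V \<subseteq> W" using \<V>(1) by blast
    then have "?X closure_of V \<subseteq> ?X closure_of W" by (intro closure_of_mono)
    moreover obtain c where "c \<in> atlas M" "?X closure_of W \<subseteq> fst c" using W(1) by (auto simp: \<W>_def)
    ultimately show "\<exists>c. c \<in> atlas M \<and> ?X closure_of V \<subseteq> fst c" by blast
  qed
  from bchoice[OF this] obtain ch where ch: "\<forall>V\<in>\<V>. ch V \<in> atlas M \<and> ?X closure_of V \<subseteq> fst (ch V)"
    by blast
  define CU where "CU = (\<lambda>V. fst (ch V))"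
  define C\<phi> where "C\<phi> = (\<lambda>V. snd (ch V))"
  have chV: "(CU V, C\<phi> V) \<in> atlas M" "?X closure_of V \<subseteq> CU V" if "V \<in> \<V>" for V
    using ch that by (simp_all add: CU_def C\<phi>_def)
  define good where "good = (\<lambda>B. openin ?X B \<and> (\<exists>U\<in>\<U>. B \<subseteq> U) \<and> (\<exists>V0\<in>\<V>. B \<subseteq> V0) \<and>
     (\<forall>V\<in>\<V>. B \<inter> V \<noteq> {} \<longrightarrow> B \<subseteq> CU V \<and> (\<exists>f. cell ?n (C\<phi> V ` B) f)))"
  have ex: "\<exists>B. p \<in> B \<and> good B" if p: "p \<in> points M" for p
  proof -
    obtain V0 where V0: "V0 \<in> \<V>" "p \<in> V0" using \<V>(2) p by blast
    obtain U where U: "U \<in> \<U>" "p \<in> U" "openin ?X U" using cov p unfolding open_cover_def by blast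
    have "openin ?X V" if "V \<in> \<V>" for V using \<V>(1)[OF that] by blast
    from multi_chart_cell[where CU = CU and C\<phi> = C\<phi>, OF M p this chV \<V>(3) V0 U(3,2)]
    show ?thesis unfolding good_def using U(1) V0(1) by blast
  qed
  have good: "openin ?X D" "\<exists>V0\<in>\<V>. D \<subseteq> V0" "\<exists>U\<in>\<U>. D \<subseteq> U"
    "\<And>V. V \<in> \<V> \<Longrightarrow> D \<inter> V \<noteq> {} \<Longrightarrow> D \<subseteq> CU V"
    "\<And>V. V \<in> \<V> \<Longrightarrow> D \<inter> V \<noteq> {} \<Longrightarrow> \<exists>f. cell ?n (C\<phi> V ` D) f" if "good D" for D
    using that unfolding good_def by simp_all
  \<comment> \<open>Empty sets are discarded because each member has to be cartesian and hence
    nonempty.\<close>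
  define \<G> where "\<G> = {B. B \<noteq> {} \<and> good B}"
  have cart: "cartesian_mfd (open_submanifold M (\<Inter>\<D>))"
    if D: "\<D> \<subseteq> \<G>" "finite \<D>" "\<D> \<noteq> {}" "\<Inter>\<D> \<noteq> {}" for \<D>
  proof -
    have gd: "good D" if "D \<in> \<D>" for D using that D(1) by (auto simp: \<G>_def)
    obtain D0 where D0: "D0 \<in> \<D>" using D(3) by blast
    then obtain V where V: "V \<in> \<V>" "D0 \<subseteq> V" using good(2)[OF gd] by blast
    note a = chV(1)[OF V(1)]
    note c = manifold_chart[OF M a]
    note f = chart_facts[OF c]
    \<comment> \<open>A common point of the members lies in \<open>D0\<close> and so in
      \<open>V\<close>. Thus every member meets \<open>V\<close> and is a cell in the chart of
      \<open>V\<close>.\<close>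
    have meet: "D \<inter> V \<noteq> {}" if "D \<in> \<D>" for D using D(4) V(2) D0 that by blast
    have DU: "D \<subseteq> CU V" and "\<exists>f. cell ?n (C\<phi> V ` D) f" if "D \<in> \<D>" for D
      using good(4,5)[OF gd[OF that] V(1) meet[OF that]] by simp_all
    then obtain g where g: "\<And>D. D \<in> \<D> \<Longrightarrow> cell ?n (C\<phi> V ` D) (g D)" by metis
    have img: "C\<phi> V ` (\<Inter>\<D>) = (\<Inter>D\<in>\<D>. C\<phi> V ` D)"
      using image_INT[OF f(6), of \<D> "\<lambda>D. D" D0] DU D0 by simp
    obtain \<Phi> \<Psi> where P: "\<forall>x\<in>C\<phi> V ` (\<Inter>\<D>). \<Phi> x \<in> Rn ?n \<and> \<Psi> (\<Phi> x) = x"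
      "\<forall>y\<in>Rn ?n. \<Psi> y \<in> C\<phi> V ` (\<Inter>\<D>) \<and> \<Phi> (\<Psi> y) = y"
      "smooth_on ?n ?n (C\<phi> V ` (\<Inter>\<D>)) \<Phi>" "smooth_on ?n ?n (Rn ?n) \<Psi>"
      using cells_diffeo[OF D(2,3) g img] D(4) by blast
    have o: "openin ?X (\<Inter>\<D>)" using D(2,3) good(1)[OF gd] by (intro openin_Inter) auto
    have sub: "\<Inter>\<D> \<subseteq> CU V" using DU[OF D0] D0 by blast
    have oR: "openin (Euclidean_space ?n) (Rn ?n)" using openin_topspace[of "Euclidean_space ?n"] by simp
    have t: "(\<Inter>\<D>, \<lambda>x\<in>\<Inter>\<D>. \<Phi> (C\<phi> V x)) \<in> atlas M" "(\<lambda>x\<in>\<Inter>\<D>. \<Phi> (C\<phi> V x)) ` (\<Inter>\<D>) = Rn ?n"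
      using chart_transform[OF M a o sub oR, of \<Phi> \<Psi>] P by blast+
    show ?thesis by (rule cartesian_mfd_chart[OF M t])
  qed
  have "good_open_cover M \<G>"
    unfolding good_open_cover_def open_cover_def
  proof (intro conjI ballI allI impI)
    show "openin ?X U" if "U \<in> \<G>" for U using that good(1) by (simp add: \<G>_def)
    then show "\<Union>\<G> = points M"
    proof (intro equalityI subsetI)
      fix p assume "p \<in> points M"
      then obtain B where "p \<in> B" "good B" using ex by blast
      then show "p \<in> \<Union>\<G>" by (auto simp: \<G>_def)
    qed (use openin_subset in blast)
    show "cartesian_mfd (open_submanifold M U)" if "U \<in> \<G>" for U
      using cart[of "{U}"] that by (simp add: \<G>_def)
    show "cartesian_mfd (open_submanifold M (\<Inter>\<D>))"
      if "\<D> \<subseteq> \<G>" "finite \<D> \<and> \<D> \<noteq> {} \<and> \<Inter>\<D> \<noteq> {}" for \<D> using cart that by blast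
  qed
  moreover have "\<exists>U\<in>\<U>. G \<subseteq> U" if "G \<in> \<G>" for G using that good(3) by (simp add: \<G>_def)
  ultimately show thesis using that by blast
qed

section \<open>Equivalence through a span of functors\<close>

lemma
  assumes "is_category C"
  shows category_Id: "\<And>A. A \<in> Ob C \<Longrightarrow> Id C A \<in> Hom C A A"
    and category_Comp: "\<And>A B D f g. A \<in> Ob C \<Longrightarrow> B \<in> Ob C \<Longrightarrow> D \<in> Ob C \<Longrightarrow> f \<in> Hom C A B \<Longrightarrow>
      g \<in> Hom C B D \<Longrightarrow> Comp C A B D g f \<in> Hom C A D"
    and category_unit: "\<And>A B f. A \<in> Ob C \<Longrightarrow> B \<in> Ob C \<Longrightarrow> f \<in> Hom C A B \<Longrightarrow> Comp C A A B f (Id C A) = f"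
      "\<And>A B f. A \<in> Ob C \<Longrightarrow> B \<in> Ob C \<Longrightarrow> f \<in> Hom C A B \<Longrightarrow> Comp C A B B (Id C B) f = f"
  using assms unfolding is_category_def by blast+

lemma
  assumes "is_functor C D F"
  shows functor_Ob: "\<And>A. A \<in> Ob C \<Longrightarrow> FOb F A \<in> Ob D"
    and functor_Hom: "\<And>A B f. A \<in> Ob C \<Longrightarrow> B \<in> Ob C \<Longrightarrow> f \<in> Hom C A B \<Longrightarrow>
      FMor F A B f \<in> Hom D (FOb F A) (FOb F B)"
    and functor_Id: "\<And>A. A \<in> Ob C \<Longrightarrow> FMor F A A (Id C A) = Id D (FOb F A)"
    and functor_Comp: "\<And>A B E f g. A \<in> Ob C \<Longrightarrow> B \<in> Ob C \<Longrightarrow> E \<in> Ob C \<Longrightarrow> f \<in> Hom C A B \<Longrightarrow>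
      g \<in> Hom C B E \<Longrightarrow> FMor F A E (Comp C A B E g f) =
        Comp D (FOb F A) (FOb F B) (FOb F E) (FMor F B E g) (FMor F A B f)"
  using assms unfolding is_functor_def by blast+

definition fully_faithful ::
  "('o, 'a) category \<Rightarrow> ('p, 'b) category \<Rightarrow> ('o, 'a, 'p, 'b) functor_data \<Rightarrow> bool" where
  "fully_faithful C D F \<longleftrightarrow> is_functor C D F \<and>
     (\<forall>A\<in>Ob C. \<forall>B\<in>Ob C. bij_betw (FMor F A B) (Hom C A B) (Hom D (FOb F A) (FOb F B)))"

lemma fully_faithful_inj:
  "fully_faithful C D F \<Longrightarrow> A \<in> Ob C \<Longrightarrow> B \<in> Ob C \<Longrightarrow> f \<in> Hom C A B \<Longrightarrow> g \<in> Hom C A B \<Longrightarrow>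
   FMor F A B f = FMor F A B g \<Longrightarrow> f = g"
  unfolding fully_faithful_def bij_betw_def inj_on_def by blast

definition lift_mor ::
  "('o, 'a) category \<Rightarrow> ('o, 'a, 'p, 'b) functor_data \<Rightarrow> 'o \<Rightarrow> 'o \<Rightarrow> 'b \<Rightarrow> 'a" where
  "lift_mor C F A B h = inv_into (Hom C A B) (FMor F A B) h"

lemma lift_mor:
  assumes "fully_faithful C D F" "A \<in> Ob C" "B \<in> Ob C" "h \<in> Hom D (FOb F A) (FOb F B)"
  shows "lift_mor C F A B h \<in> Hom C A B" "FMor F A B (lift_mor C F A B h) = h"
proof -
  have "FMor F A B ` Hom C A B = Hom D (FOb F A) (FOb F B)"
    using assms unfolding fully_faithful_def bij_betw_def by blast
  then have "h \<in> FMor F A B ` Hom C A B" using assms(4) by simp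
  then show "lift_mor C F A B h \<in> Hom C A B" "FMor F A B (lift_mor C F A B h) = h"
    unfolding lift_mor_def by (auto intro: inv_into_into f_inv_into_f)
qed

text \<open>The composites with \<open>K\<close> coincide, so the identities of \<open>Q\<close> are
  morphisms between the images and lift along the fully faithful \<open>K\<close>. Naturality can be
  tested after applying \<open>K\<close>, where it becomes a unit law.\<close>

lemma lift_nat_trans:
  assumes cats: "is_category A" "is_category Q" and K: "fully_faithful A Q K"
    and H: "is_functor C A H" "is_functor C A H'"
    and Ob: "\<And>X. X \<in> Ob C \<Longrightarrow> FOb K (FOb H X) = FOb K (FOb H' X)"
    and Mor: "\<And>X Y f. X \<in> Ob C \<Longrightarrow> Y \<in> Ob C \<Longrightarrow> f \<in> Hom C X Y \<Longrightarrow>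
      FMor K (FOb H X) (FOb H Y) (FMor H X Y f) = FMor K (FOb H' X) (FOb H' Y) (FMor H' X Y f)"
  shows "(\<lambda>X\<in>Ob C. lift_mor A K (FOb H X) (FOb H' X) (Id Q (FOb K (FOb H X)))) \<in> nat_trans C A H H'"
proof -
  have KF: "is_functor A Q K" using K by (simp add: fully_faithful_def)
  let ?\<alpha> = "\<lambda>X. lift_mor A K (FOb H X) (FOb H' X) (Id Q (FOb K (FOb H X)))"
  have \<alpha>: "?\<alpha> X \<in> Hom A (FOb H X) (FOb H' X)"
    "FMor K (FOb H X) (FOb H' X) (?\<alpha> X) = Id Q (FOb K (FOb H X))" if X: "X \<in> Ob C" for X
  proof -
    have "Id Q (FOb K (FOb H X)) \<in> Hom Q (FOb K (FOb H X)) (FOb K (FOb H' X))"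
      using category_Id[OF cats(2) functor_Ob[OF KF functor_Ob[OF H(1) X]]] Ob[OF X] by simp
    then show "?\<alpha> X \<in> Hom A (FOb H X) (FOb H' X)"
      "FMor K (FOb H X) (FOb H' X) (?\<alpha> X) = Id Q (FOb K (FOb H X))"
      using lift_mor[OF K functor_Ob[OF H(1) X] functor_Ob[OF H(2) X]] by blast+
  qed
  have "Comp A (FOb H X) (FOb H Y) (FOb H' Y) (?\<alpha> Y) (FMor H X Y f) =
        Comp A (FOb H X) (FOb H' X) (FOb H' Y) (FMor H' X Y f) (?\<alpha> X)"
    if X: "X \<in> Ob C" and Y: "Y \<in> Ob C" and f: "f \<in> Hom C X Y" for X Y f
  proof (rule fully_faithful_inj[OF K])
    note o = functor_Ob[OF H(1) X] functor_Ob[OF H(1) Y] functor_Ob[OF H(2) X] functor_Ob[OF H(2) Y]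
    note m = functor_Hom[OF H(1) X Y f] functor_Hom[OF H(2) X Y f]
    show "FOb H X \<in> Ob A" "FOb H' Y \<in> Ob A" by fact+
    show "Comp A (FOb H X) (FOb H Y) (FOb H' Y) (?\<alpha> Y) (FMor H X Y f) \<in> Hom A (FOb H X) (FOb H' Y)"
      by (rule category_Comp[OF cats(1) o(1,2,4) m(1) \<alpha>(1)[OF Y]])
    show "Comp A (FOb H X) (FOb H' X) (FOb H' Y) (FMor H' X Y f) (?\<alpha> X) \<in> Hom A (FOb H X) (FOb H' Y)"
      by (rule category_Comp[OF cats(1) o(1,3,4) \<alpha>(1)[OF X] m(2)])
    note k = functor_Ob[OF KF o(1)] functor_Ob[OF KF o(2)] functor_Ob[OF KF o(3)] functor_Ob[OF KF o(4)]
    have "FMor K (FOb H X) (FOb H' Y) (Comp A (FOb H X) (FOb H Y) (FOb H' Y) (?\<alpha> Y) (FMor H X Y f)) =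
        FMor K (FOb H X) (FOb H Y) (FMor H X Y f)"
      unfolding functor_Comp[OF KF o(1,2,4) m(1) \<alpha>(1)[OF Y]] \<alpha>(2)[OF Y] Ob[OF Y, symmetric]
      by (rule category_unit(2)[OF cats(2) k(1,2) functor_Hom[OF KF o(1,2) m(1)]])
    also have "\<dots> = FMor K (FOb H' X) (FOb H' Y) (FMor H' X Y f)" by (rule Mor[OF X Y f])
    also have "\<dots> = Comp Q (FOb K (FOb H X)) (FOb K (FOb H' X)) (FOb K (FOb H' Y))
        (FMor K (FOb H' X) (FOb H' Y) (FMor H' X Y f)) (Id Q (FOb K (FOb H X)))"
      unfolding Ob[OF X] by (rule category_unit(1)[OF cats(2) k(3,4) functor_Hom[OF KF o(3,4) m(2)], symmetric])
    also have "\<dots> = FMor K (FOb H X) (FOb H' Y) (Comp A (FOb H X) (FOb H' X) (FOb H' Y) (FMor H' X Y f) (?\<alpha> X))"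
      by (simp only: functor_Comp[OF KF o(1,3,4) \<alpha>(1)[OF X] m(2)] \<alpha>(2)[OF X])
    finally show "FMor K (FOb H X) (FOb H' Y) (Comp A (FOb H X) (FOb H Y) (FOb H' Y) (?\<alpha> Y) (FMor H X Y f)) =
      FMor K (FOb H X) (FOb H' Y) (Comp A (FOb H X) (FOb H' X) (FOb H' Y) (FMor H' X Y f) (?\<alpha> X))" .
  qed
  then show ?thesis using \<alpha>(1) unfolding nat_trans_def by simp
qed

lemma lift_nat_trans_inverse:
  assumes cats: "is_category A" "is_category Q" and K: "fully_faithful A Q K"
    and X: "X \<in> Ob A" "Y \<in> Ob A" "FOb K X = FOb K Y"
  shows "Comp A X Y X (lift_mor A K Y X (Id Q (FOb K Y))) (lift_mor A K X Y (Id Q (FOb K X))) = Id A X"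
proof (rule fully_faithful_inj[OF K X(1,1)])
  have KF: "is_functor A Q K" using K by (simp add: fully_faithful_def)
  note I = category_Id[OF cats(2) functor_Ob[OF KF X(1)]]
  have I': "Id Q (FOb K X) \<in> Hom Q (FOb K X) (FOb K Y)" "Id Q (FOb K Y) \<in> Hom Q (FOb K Y) (FOb K X)"
    using I X(3) by simp_all
  note a = lift_mor[OF K X(1,2) I'(1)] and b = lift_mor[OF K X(2,1) I'(2)]
  show "Comp A X Y X (lift_mor A K Y X (Id Q (FOb K Y))) (lift_mor A K X Y (Id Q (FOb K X))) \<in> Hom A X X"
    by (rule category_Comp[OF cats(1) X(1,2,1) a(1) b(1)])
  show "Id A X \<in> Hom A X X" by (rule category_Id[OF cats(1) X(1)])
  show "FMor K X X (Comp A X Y X (lift_mor A K Y X (Id Q (FOb K Y))) (lift_mor A K X Y (Id Q (FOb K X)))) =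
      FMor K X X (Id A X)"
  proof -
    have "FMor K X X (Comp A X Y X (lift_mor A K Y X (Id Q (FOb K Y))) (lift_mor A K X Y (Id Q (FOb K X)))) =
        Comp Q (FOb K X) (FOb K Y) (FOb K X) (Id Q (FOb K Y)) (Id Q (FOb K X))"
      by (simp only: functor_Comp[OF KF X(1,2,1) a(1) b(1)] a(2) b(2))
    also have "\<dots> = Id Q (FOb K X)"
      unfolding X(3)[symmetric]
      by (rule category_unit(1)[OF cats(2) functor_Ob[OF KF X(1)] functor_Ob[OF KF X(1)] I])
    finally show ?thesis by (simp only: functor_Id[OF KF X(1)])
  qed
qed

lemma isomorphic_functors:
  assumes cats: "is_category A" "is_category Q" and K: "fully_faithful A Q K"
    and H: "is_functor C A H" "is_functor C A H'"
    and Ob: "\<And>X. X \<in> Ob C \<Longrightarrow> FOb K (FOb H X) = FOb K (FOb H' X)"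
    and Mor: "\<And>X Y f. X \<in> Ob C \<Longrightarrow> Y \<in> Ob C \<Longrightarrow> f \<in> Hom C X Y \<Longrightarrow>
      FMor K (FOb H X) (FOb H Y) (FMor H X Y f) = FMor K (FOb H' X) (FOb H' Y) (FMor H' X Y f)"
  shows "isomorphic_in (functor_category C A) H H'"
proof -
  let ?a = "\<lambda>X\<in>Ob C. lift_mor A K (FOb H X) (FOb H' X) (Id Q (FOb K (FOb H X)))"
  let ?b = "\<lambda>X\<in>Ob C. lift_mor A K (FOb H' X) (FOb H X) (Id Q (FOb K (FOb H' X)))"
  have a: "?a \<in> nat_trans C A H H'" by (rule lift_nat_trans[OF cats K H Ob Mor])
  have b: "?b \<in> nat_trans C A H' H" by (rule lift_nat_trans[OF cats K H(2,1) Ob[symmetric] Mor[symmetric]])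
  have e1: "(\<lambda>X\<in>Ob C. Comp A (FOb H X) (FOb H' X) (FOb H X) (?b X) (?a X)) = (\<lambda>X\<in>Ob C. Id A (FOb H X))"
  proof (rule restrict_ext)
    fix X assume X: "X \<in> Ob C"
    show "Comp A (FOb H X) (FOb H' X) (FOb H X) (?b X) (?a X) = Id A (FOb H X)"
      using lift_nat_trans_inverse[OF cats K functor_Ob[OF H(1) X] functor_Ob[OF H(2) X] Ob[OF X]] X by simp
  qed
  have e2: "(\<lambda>X\<in>Ob C. Comp A (FOb H' X) (FOb H X) (FOb H' X) (?a X) (?b X)) = (\<lambda>X\<in>Ob C. Id A (FOb H' X))"
  proof (rule restrict_ext)
    fix X assume X: "X \<in> Ob C"
    show "Comp A (FOb H' X) (FOb H X) (FOb H' X) (?a X) (?b X) = Id A (FOb H' X)"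
      using lift_nat_trans_inverse[OF cats K functor_Ob[OF H(2) X] functor_Ob[OF H(1) X] Ob[OF X, symmetric]] X by simp
  qed
  have "isomorphism_in (functor_category C A) H H' ?a"
    unfolding isomorphism_in_def functor_category_def category.simps
    by (intro conjI bexI[OF _ b] a e1 e2)
  then show ?thesis unfolding isomorphic_in_def functor_category_def using H by auto
qed

lemma is_functor_id: "is_category C \<Longrightarrow> is_functor C C (id_functor C)"
  unfolding is_functor_def id_functor_def
  by (auto simp: category_Id category_Comp)

lemma is_functor_comp:
  assumes F: "is_functor C D F" and G: "is_functor D E G" and C: "is_category C"
  shows "is_functor C E (comp_functor C G F)"
  unfolding is_functor_def comp_functor_def
  by (auto simp: functor_Ob[OF F] functor_Ob[OF G] functor_Hom[OF F] functor_Hom[OF G]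
      functor_Id[OF F] functor_Id[OF G] functor_Comp[OF F] functor_Comp[OF G] category_Id[OF C] category_Comp[OF C])

text \<open>Choose for every object a preimage of its image under \<open>K\<close> and lift the
  morphisms; faithfulness of \<open>L\<close> forces functoriality. As the preimages are strict,
  \<open>F\<close> followed by \<open>L\<close> equals \<open>K\<close> on the nose.\<close>

lemma lift_functor:
  assumes cats: "is_category A" "is_category B" "is_category Q"
    and K: "is_functor A Q K" and L: "fully_faithful B Q L"
    and surj: "\<And>q. q \<in> Ob Q \<Longrightarrow> \<exists>Y\<in>Ob B. FOb L Y = q"
  shows "\<exists>F. is_functor A B F \<and> (\<forall>X\<in>Ob A. FOb L (FOb F X) = FOb K X) \<and>
    (\<forall>X\<in>Ob A. \<forall>Y\<in>Ob A. \<forall>f\<in>Hom A X Y. FMor L (FOb F X) (FOb F Y) (FMor F X Y f) = FMor K X Y f)"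
proof -
  have LF: "is_functor B Q L" using L by (simp add: fully_faithful_def)
  have "\<forall>X\<in>Ob A. \<exists>Y. Y \<in> Ob B \<and> FOb L Y = FOb K X" using surj functor_Ob[OF K] by blast
  from bchoice[OF this] obtain d where d: "\<And>X. X \<in> Ob A \<Longrightarrow> d X \<in> Ob B" "\<And>X. X \<in> Ob A \<Longrightarrow> FOb L (d X) = FOb K X"
    by blast
  define m where "m = (\<lambda>X Y f. lift_mor B L (d X) (d Y) (FMor K X Y f))"
  have m: "m X Y f \<in> Hom B (d X) (d Y)" "FMor L (d X) (d Y) (m X Y f) = FMor K X Y f"
    if X: "X \<in> Ob A" "Y \<in> Ob A" "f \<in> Hom A X Y" for X Y f
  proof -
    have "FMor K X Y f \<in> Hom Q (FOb L (d X)) (FOb L (d Y))"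
      using functor_Hom[OF K X] d(2) X(1,2) by simp
    then show "m X Y f \<in> Hom B (d X) (d Y)" "FMor L (d X) (d Y) (m X Y f) = FMor K X Y f"
      using lift_mor[OF L d(1)[OF X(1)] d(1)[OF X(2)]] unfolding m_def by blast+
  qed
  have mI: "m X X (Id A X) = Id B (d X)" if X: "X \<in> Ob A" for X
  proof (rule fully_faithful_inj[OF L d(1)[OF X] d(1)[OF X]])
    note I = category_Id[OF cats(1) X]
    show "m X X (Id A X) \<in> Hom B (d X) (d X)" by (rule m(1)[OF X X I])
    show "Id B (d X) \<in> Hom B (d X) (d X)" by (rule category_Id[OF cats(2) d(1)[OF X]])
    show "FMor L (d X) (d X) (m X X (Id A X)) = FMor L (d X) (d X) (Id B (d X))"
      unfolding m(2)[OF X X I] functor_Id[OF K X] functor_Id[OF LF d(1)[OF X]] d(2)[OF X] ..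
  qed
  have mC: "m X Z (Comp A X Y Z g f) = Comp B (d X) (d Y) (d Z) (m Y Z g) (m X Y f)"
    if X: "X \<in> Ob A" and Y: "Y \<in> Ob A" and Z: "Z \<in> Ob A" and f: "f \<in> Hom A X Y" and g: "g \<in> Hom A Y Z" for X Y Z f g
  proof (rule fully_faithful_inj[OF L d(1)[OF X] d(1)[OF Z]])
    note c = category_Comp[OF cats(1) X Y Z f g]
    show "m X Z (Comp A X Y Z g f) \<in> Hom B (d X) (d Z)" by (rule m(1)[OF X Z c])
    show "Comp B (d X) (d Y) (d Z) (m Y Z g) (m X Y f) \<in> Hom B (d X) (d Z)"
      by (rule category_Comp[OF cats(2) d(1)[OF X] d(1)[OF Y] d(1)[OF Z] m(1)[OF X Y f] m(1)[OF Y Z g]])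
    show "FMor L (d X) (d Z) (m X Z (Comp A X Y Z g f)) = FMor L (d X) (d Z) (Comp B (d X) (d Y) (d Z) (m Y Z g) (m X Y f))"
      unfolding m(2)[OF X Z c] functor_Comp[OF K X Y Z f g] m(2)[OF X Y f] m(2)[OF Y Z g] d(2)[OF X] d(2)[OF Y] d(2)[OF Z]
        functor_Comp[OF LF d(1)[OF X] d(1)[OF Y] d(1)[OF Z] m(1)[OF X Y f] m(1)[OF Y Z g]] ..
  qed
  let ?F = "\<lparr>FOb = (\<lambda>X\<in>Ob A. d X),
     FMor = (\<lambda>X Y f. if X \<in> Ob A \<and> Y \<in> Ob A \<and> f \<in> Hom A X Y then m X Y f else undefined)\<rparr>"
  have "is_functor A B ?F"
    unfolding is_functor_def
    by (auto simp: d m mI mC category_Id[OF cats(1)] category_Comp[OF cats(1)])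
  then show ?thesis by (intro exI[of _ ?F]) (auto simp: d m)
qed

text \<open>Surjectivity on objects is meant strictly here, which saves all bookkeeping with chosen isomorphisms.\<close>

theorem equivalent_categories_span:
  assumes cats: "is_category A" "is_category B" "is_category Q"
    and K: "fully_faithful A Q K" and L: "fully_faithful B Q L"
    and surjK: "\<And>q. q \<in> Ob Q \<Longrightarrow> \<exists>X\<in>Ob A. FOb K X = q"
    and surjL: "\<And>q. q \<in> Ob Q \<Longrightarrow> \<exists>Y\<in>Ob B. FOb L Y = q"
  shows "equivalent_categories A B"
proof -
  have KF: "is_functor A Q K" and LF: "is_functor B Q L" using K L by (simp_all add: fully_faithful_def)
  obtain F where F: "is_functor A B F" "\<And>X. X \<in> Ob A \<Longrightarrow> FOb L (FOb F X) = FOb K X"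
    "\<And>X Y f. X \<in> Ob A \<Longrightarrow> Y \<in> Ob A \<Longrightarrow> f \<in> Hom A X Y \<Longrightarrow>
      FMor L (FOb F X) (FOb F Y) (FMor F X Y f) = FMor K X Y f"
    using lift_functor[OF cats KF L surjL] by blast
  obtain G where G: "is_functor B A G" "\<And>X. X \<in> Ob B \<Longrightarrow> FOb K (FOb G X) = FOb L X"
    "\<And>X Y f. X \<in> Ob B \<Longrightarrow> Y \<in> Ob B \<Longrightarrow> f \<in> Hom B X Y \<Longrightarrow>
      FMor K (FOb G X) (FOb G Y) (FMor G X Y f) = FMor L X Y f"
    using lift_functor[OF cats(2,1,3) LF K surjK] by blast
  \<comment> \<open>\<open>F\<close> followed by \<open>G\<close> agrees with the identity after
    applying \<open>K\<close>, since \<open>L\<close> after \<open>F\<close> is \<open>K\<close> and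
    \<open>K\<close> after \<open>G\<close> is \<open>L\<close>. This is all that
    \<open>isomorphic_functors\<close> asks for.\<close>
  have "isomorphic_in (functor_category A A) (comp_functor A G F) (id_functor A)"
    by (rule isomorphic_functors[OF cats(1,3) K is_functor_comp[OF F(1) G(1) cats(1)] is_functor_id[OF cats(1)]])
      (simp_all add: comp_functor_def id_functor_def F(2,3) G(2,3) functor_Ob[OF F(1)] functor_Hom[OF F(1)])
  moreover have "isomorphic_in (functor_category B B) (comp_functor B F G) (id_functor B)"
    by (rule isomorphic_functors[OF cats(2,3) L is_functor_comp[OF G(1) F(1) cats(2)] is_functor_id[OF cats(2)]])
      (simp_all add: comp_functor_def id_functor_def F(2,3) G(2,3) functor_Ob[OF G(1)] functor_Hom[OF G(1)])
  ultimately show ?thesis unfolding equivalent_categories_def using cats F(1) G(1) by blast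
qed

section \<open>Concrete sheaves as diffeologies\<close>

text \<open>\<open>A\<close> stands for the set of points of a concrete sheaf, \<open>D V\<close> for the set of those maps from the cartesian
  space \<open>V\<close> to \<open>A\<close> that come from sections.\<close>

definition diffeology ::
  "'m set set \<Rightarrow> 'u set set \<Rightarrow> 'u set \<Rightarrow> ('m mfd \<Rightarrow> ('m \<Rightarrow> 'u) set) \<Rightarrow> bool" where
  "diffeology \<P> \<S> A D \<longleftrightarrow> A \<in> \<S> \<and> D \<in> extensional (Ob (Cart \<P>)) \<and>
     (\<forall>V\<in>Ob (Cart \<P>). D V \<subseteq> points V \<rightarrow>\<^sub>E A) \<and>
     ({undefined} \<rightarrow>\<^sub>E A) \<subseteq> D one_point_mfd \<and>
     (\<forall>V\<in>Ob (Cart \<P>). \<forall>W\<in>Ob (Cart \<P>). \<forall>\<phi>\<in>smooth_maps V W. \<forall>s\<in>D W. compose (points V) s \<phi> \<in> D V) \<and>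
     (\<forall>V\<in>Ob (Cart \<P>). \<forall>\<U> s. good_open_cover V \<U> \<longrightarrow> s \<in> points V \<rightarrow>\<^sub>E A \<longrightarrow>
        (\<forall>U\<in>\<U>. restrict s U \<in> D (open_submanifold V U)) \<longrightarrow> s \<in> D V)"

definition Diff :: "'m set set \<Rightarrow> 'u set set \<Rightarrow>
    ('u set \<times> ('m mfd \<Rightarrow> ('m \<Rightarrow> 'u) set), 'u \<Rightarrow> 'u) category" where
  "Diff \<P> \<S> = \<lparr>Ob = {X. diffeology \<P> \<S> (fst X) (snd X)},
     Hom = (\<lambda>X Y. {h \<in> fst X \<rightarrow>\<^sub>E fst Y. \<forall>V\<in>Ob (Cart \<P>). \<forall>s\<in>snd X V. compose (points V) h s \<in> snd Y V}),
     Id = (\<lambda>X. \<lambda>x\<in>fst X. x), Comp = (\<lambda>X Y Z g f. compose (fst X) g f)\<rparr>"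

lemma compose_ident_right: "s \<in> extensional A \<Longrightarrow> compose A s (\<lambda>x\<in>A. x) = s"
  by (auto simp: compose_def fun_eq_iff extensional_def)

lemma compose_assoc_on:
  "(\<And>x. x \<in> A \<Longrightarrow> f x \<in> B) \<Longrightarrow> compose A h (compose A g f) = compose A (compose B h g) f"
  by (auto simp: compose_def fun_eq_iff)

lemma is_category_Diff: "is_category (Diff \<P> \<S>)"
proof -
  have 1: "compose A (\<lambda>x\<in>B. x) s = s" if "s \<in> A \<rightarrow>\<^sub>E B" for A B and s :: "'x \<Rightarrow> 'y"
    using that by (auto simp: compose_def fun_eq_iff PiE_iff extensional_def)
  have 2: "compose (points V) (compose A g f) s = compose (points V) g (compose (points V) f s)"
    if "s \<in> points V \<rightarrow>\<^sub>E A" for V :: "'x mfd" and A and g f :: "'y \<Rightarrow> 'y" and s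
    using that by (auto simp: compose_def fun_eq_iff PiE_iff)
  have D: "s \<in> points V \<rightarrow>\<^sub>E fst X" if "diffeology \<P> \<S> (fst X) (snd X)" "V \<in> Ob (Cart \<P>)" "s \<in> snd X V" for X V s
    using that unfolding diffeology_def by blast
  show ?thesis
    unfolding is_category_def Diff_def category.simps
  proof (intro conjI ballI)
    fix X assume X: "X \<in> {X. diffeology \<P> \<S> (fst X) (snd X)}"
    show "(\<lambda>x\<in>fst X. x) \<in> {h \<in> fst X \<rightarrow>\<^sub>E fst X. \<forall>V\<in>Ob (Cart \<P>). \<forall>s\<in>snd X V. compose (points V) h s \<in> snd X V}"
    proof -
      have "compose (points V) (\<lambda>x\<in>fst X. x) s = s" if "V \<in> Ob (Cart \<P>)" "s \<in> snd X V" for V s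
        using 1 D[of X V s] X that by blast
      then show ?thesis by auto
    qed
    fix Y assume Y: "Y \<in> {X. diffeology \<P> \<S> (fst X) (snd X)}"
    {
      fix f assume f: "f \<in> {h \<in> fst X \<rightarrow>\<^sub>E fst Y. \<forall>V\<in>Ob (Cart \<P>). \<forall>s\<in>snd X V. compose (points V) h s \<in> snd Y V}"
      show "compose (fst X) f (\<lambda>x\<in>fst X. x) = f" using f by (auto intro!: compose_ident_right simp: PiE_iff)
      show "compose (fst X) (\<lambda>x\<in>fst Y. x) f = f" using f 1 by auto
    }
    fix Z assume Z: "Z \<in> {X. diffeology \<P> \<S> (fst X) (snd X)}"
    fix f g assume f: "f \<in> {h \<in> fst X \<rightarrow>\<^sub>E fst Y. \<forall>V\<in>Ob (Cart \<P>). \<forall>s\<in>snd X V. compose (points V) h s \<in> snd Y V}"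
      and g: "g \<in> {h \<in> fst Y \<rightarrow>\<^sub>E fst Z. \<forall>V\<in>Ob (Cart \<P>). \<forall>s\<in>snd Y V. compose (points V) h s \<in> snd Z V}"
    have "compose (points V) (compose (fst X) g f) s \<in> snd Z V" if "V \<in> Ob (Cart \<P>)" "s \<in> snd X V" for V s
    proof -
      have "s \<in> points V \<rightarrow>\<^sub>E fst X" using D[of X V s] X that by blast
      then show ?thesis using f g that by (subst 2) blast+
    qed
    moreover have "compose (fst X) g f \<in> fst X \<rightarrow>\<^sub>E fst Z"
      using f g by (auto simp: compose_def PiE_iff)
    ultimately show "compose (fst X) g f \<in> {h \<in> fst X \<rightarrow>\<^sub>E fst Z. \<forall>V\<in>Ob (Cart \<P>). \<forall>s\<in>snd X V. compose (points V) h s \<in> snd Z V}"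
      by blast
    fix W assume W: "W \<in> {X. diffeology \<P> \<S> (fst X) (snd X)}"
    fix h assume "h \<in> {h \<in> fst Z \<rightarrow>\<^sub>E fst W. \<forall>V\<in>Ob (Cart \<P>). \<forall>s\<in>snd Z V. compose (points V) h s \<in> snd W V}"
    show "compose (fst X) h (compose (fst X) g f) = compose (fst X) (compose (fst Y) h g) f"
      using f by (intro compose_assoc_on) auto
  qed
qed

lemma good_open_coverD:
  assumes "good_open_cover M \<U>"
  shows "open_cover M \<U>" "\<And>U. U \<in> \<U> \<Longrightarrow> openin (space_of M) U" "\<Union>\<U> = points M"
    "\<And>U. U \<in> \<U> \<Longrightarrow> cartesian_mfd (open_submanifold M U)"
proof -
  have *: "open_cover M \<U>" "\<forall>U\<in>\<U>. cartesian_mfd (open_submanifold M U)"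
    using assms unfolding good_open_cover_def by simp_all
  then show "open_cover M \<U>" "\<And>U. U \<in> \<U> \<Longrightarrow> cartesian_mfd (open_submanifold M U)" by simp_all
  show "\<And>U. U \<in> \<U> \<Longrightarrow> openin (space_of M) U" "\<Union>\<U> = points M"
    using *(1) by (simp_all add: open_cover_def)
qed

section \<open>Sections as maps of points, for one of the three categories of manifolds\<close>

locale manifold_site =
  fixes \<P> :: "'m set set" and \<S> :: "'u set set" and C :: "('m mfd, 'm \<Rightarrow> 'm) category"
  assumes size: "size_conventions \<P> \<S>" and C: "C \<in> {Cart \<P>, Open \<P>, Man \<P>}"
begin

abbreviation pnt :: "'m mfd" where "pnt \<equiv> one_point_mfd"

lemma site_simps: "Hom C = smooth_maps" "Id C = (\<lambda>M. \<lambda>x\<in>points M. x)"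
  "Comp C = (\<lambda>L M N g f. compose (points L) g f)"
  using C by (auto simp: Cart_def Open_def Man_def full_subcategory_def)

lemma site_Ob: assumes "M \<in> Ob C" shows "smooth_manifold M" "points M \<in> \<P>"
  using assms C by (auto simp: Cart_def Open_def Man_def full_subcategory_def)

lemma Cart_Ob: "V \<in> Ob (Cart \<P>) \<longleftrightarrow> cartesian_mfd V \<and> points V \<in> \<P>"
  by (auto simp: Cart_def Man_def full_subcategory_def cartesian_mfd_def)

lemma Cart_sub: "V \<in> Ob (Cart \<P>) \<Longrightarrow> V \<in> Ob C"
  using C cartesian_imp_open_type by (auto simp: Cart_def Open_def Man_def full_subcategory_def)

lemma pnt_Ob: "pnt \<in> Ob C" "pnt \<in> Ob (Cart \<P>)"
  using terminal_one_point[OF size C] terminal_one_point[OF size, of "Cart \<P>"] by (auto simp: terminal_in_def)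

lemma Cart_open_submanifold:
  assumes M: "M \<in> Ob C" and U: "openin (space_of M) U" and c: "cartesian_mfd (open_submanifold M U)"
  shows "open_submanifold M U \<in> Ob (Cart \<P>)"
proof -
  have "U \<lesssim> points M" using openin_subset[OF U] by (rule subset_imp_lepoll)
  then have "U \<in> \<P>" using site_Ob(2)[OF M] size unfolding size_conventions_def by blast
  then show ?thesis using c points_open_submanifold[OF U] by (simp add: Cart_Ob)
qed

lemma good_cover_Cart:
  assumes M: "M \<in> Ob C" and g: "good_open_cover M \<U>" and U: "U \<in> \<U>"
  shows "openin (space_of M) U" "open_submanifold M U \<in> Ob (Cart \<P>)"
  using good_open_coverD(2,4)[OF g U] Cart_open_submanifold[OF M] by simp_all

lemma smooth_pt: "M \<in> Ob C \<Longrightarrow> v \<in> points M \<Longrightarrow> (pt v :: 'm \<Rightarrow> 'm) \<in> smooth_maps pnt M"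
  by (rule smooth_maps_point[OF site_Ob(1)])

lemma pt_apply [simp]: "pt v undefined = v" by (simp add: pt_def)

lemma smooth_pt_eq:
  assumes "f \<in> smooth_maps pnt M" shows "f = pt (f undefined)" "f undefined \<in> points M"
  using smooth_mapsD(1,2)[OF assms] by (auto simp: pt_def fun_eq_iff extensional_def)

lemma smooth_compose:
  assumes "L \<in> Ob C" "M \<in> Ob C" "N \<in> Ob C" "f \<in> smooth_maps L M" "g \<in> smooth_maps M N"
  shows "compose (points L) g f \<in> smooth_maps L N"
  by (rule smooth_maps_compose[OF site_Ob(1)[OF assms(1)] site_Ob(1)[OF assms(2)] site_Ob(1)[OF assms(3)] assms(4,5)])

lemma smooth_id: "M \<in> Ob C \<Longrightarrow> (\<lambda>x\<in>points M. x) \<in> smooth_maps M M"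
  by (rule smooth_maps_ident[OF site_Ob(1)])

abbreviation psh :: "('m mfd, 'm \<Rightarrow> 'm, 'u) presheaf \<Rightarrow> bool" where
  "psh F \<equiv> is_functor (opposite C) (Set_cat \<S>) F"

lemma opp_simps: "Ob (opposite C) = Ob C" "Hom (opposite C) U V = smooth_maps V U"
  "Id (opposite C) U = (\<lambda>x\<in>points U. x)" "Comp (opposite C) U V W g f = compose (points W) f g"
  by (simp_all add: opposite_def site_simps)

lemma Set_simps: "Ob (Set_cat \<S>) = \<S>" "Hom (Set_cat \<S>) A B = A \<rightarrow>\<^sub>E B" "Id (Set_cat \<S>) A = (\<lambda>x\<in>A. x)"
  "Comp (Set_cat \<S>) A B D g f = compose A g f"
  by (simp_all add: Set_cat_def)

lemma
  assumes "psh F"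
  shows psh_Ob: "\<And>U. U \<in> Ob C \<Longrightarrow> FOb F U \<in> \<S>"
    and psh_Mor: "\<And>U V f. U \<in> Ob C \<Longrightarrow> V \<in> Ob C \<Longrightarrow> f \<in> smooth_maps V U \<Longrightarrow>
       FMor F U V f \<in> FOb F U \<rightarrow>\<^sub>E FOb F V"
    and psh_Id: "\<And>U. U \<in> Ob C \<Longrightarrow> FMor F U U (\<lambda>x\<in>points U. x) = (\<lambda>x\<in>FOb F U. x)"
    and psh_Comp: "\<And>U V W f g x. U \<in> Ob C \<Longrightarrow> V \<in> Ob C \<Longrightarrow> W \<in> Ob C \<Longrightarrow> f \<in> smooth_maps V U \<Longrightarrow>
       g \<in> smooth_maps W V \<Longrightarrow> x \<in> FOb F U \<Longrightarrow>
       FMor F U W (compose (points W) f g) x = FMor F V W g (FMor F U V f x)"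
proof -
  show "FOb F U \<in> \<S>" if "U \<in> Ob C" for U
    using functor_Ob[OF assms] that by (simp add: opp_simps Set_simps)
  show "FMor F U V f \<in> FOb F U \<rightarrow>\<^sub>E FOb F V" if "U \<in> Ob C" "V \<in> Ob C" "f \<in> smooth_maps V U" for U V f
    using functor_Hom[OF assms, of U V f] that by (simp add: opp_simps Set_simps)
  show "FMor F U U (\<lambda>x\<in>points U. x) = (\<lambda>x\<in>FOb F U. x)" if "U \<in> Ob C" for U
    using functor_Id[OF assms, of U] that by (simp add: opp_simps Set_simps)
  show "FMor F U W (compose (points W) f g) x = FMor F V W g (FMor F U V f x)"
    if "U \<in> Ob C" "V \<in> Ob C" "W \<in> Ob C" "f \<in> smooth_maps V U" "g \<in> smooth_maps W V" "x \<in> FOb F U" for U V W f g x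
    using functor_Comp[OF assms, of U V W f g] that by (simp add: opp_simps Set_simps compose_def)
qed

definition ev :: "('m mfd, 'm \<Rightarrow> 'm, 'u) presheaf \<Rightarrow> 'm mfd \<Rightarrow> 'u \<Rightarrow> 'm \<Rightarrow> 'u" where
  "ev F M x = (\<lambda>u\<in>points M. FMor F M pnt (pt u) x)"

lemma ev_PiE: "psh F \<Longrightarrow> M \<in> Ob C \<Longrightarrow> x \<in> FOb F M \<Longrightarrow> ev F M x \<in> points M \<rightarrow>\<^sub>E FOb F pnt"
  using psh_Mor[of F M pnt] pnt_Ob(1) smooth_pt by (auto simp: ev_def)

lemma ev_Mor:
  assumes F: "psh F" and U: "U \<in> Ob C" "V \<in> Ob C" "f \<in> smooth_maps V U" and x: "x \<in> FOb F U"
  shows "ev F V (FMor F U V f x) = compose (points V) (ev F U x) f"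
proof
  fix v show "ev F V (FMor F U V f x) v = compose (points V) (ev F U x) f v"
  proof (cases "v \<in> points V")
    case True
    have "compose (points pnt) f (pt v) = pt (f v)" by (auto simp: compose_def pt_def)
    then show ?thesis
      using True psh_Comp[OF F U(1,2) pnt_Ob(1) U(3) smooth_pt[OF U(2) True] x] smooth_mapsD(2)[OF U(3) True]
      by (simp add: ev_def compose_def)
  qed (simp add: ev_def compose_def)
qed

lemma ev_pnt: "psh F \<Longrightarrow> x \<in> FOb F pnt \<Longrightarrow> ev F pnt x = pt x"
proof -
  assume F: "psh F" and x: "x \<in> FOb F pnt"
  have "(pt undefined :: 'm \<Rightarrow> 'm) = (\<lambda>x\<in>points pnt. x)" by (auto simp: pt_def fun_eq_iff)
  then have "FMor F pnt pnt (pt undefined) x = x" using psh_Id[OF F pnt_Ob(1)] x by simp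
  then have "ev F pnt x u = pt x u" for u by (cases "u = undefined") (simp_all add: ev_def pt_def[of x])
  then show ?thesis ..
qed

text \<open>The morphisms from the one-point manifold to \<open>U\<close> are exactly the
  \<open>pt u\<close>, so a function on this hom-set is the same as a function on the points of
  \<open>U\<close>.\<close>

lemma concrete_iff: "is_concrete C pnt F \<longleftrightarrow> (\<forall>U\<in>Ob C. inj_on (ev F U) (FOb F U))"
proof -
  have "(\<lambda>u\<in>smooth_maps pnt U. FMor F U pnt u x) = (\<lambda>u\<in>smooth_maps pnt U. FMor F U pnt u y) \<longleftrightarrow>
      ev F U x = ev F U y" if U: "U \<in> Ob C" for U x y
  proof
    assume e: "(\<lambda>u\<in>smooth_maps pnt U. FMor F U pnt u x) = (\<lambda>u\<in>smooth_maps pnt U. FMor F U pnt u y)"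
    show "ev F U x = ev F U y"
      unfolding ev_def
    proof (rule restrict_ext)
      fix u assume "u \<in> points U"
      then show "FMor F U pnt (pt u) x = FMor F U pnt (pt u) y"
        using fun_cong[OF e, of "pt u"] smooth_pt[OF U] by simp
    qed
  next
    assume e: "ev F U x = ev F U y"
    show "(\<lambda>u\<in>smooth_maps pnt U. FMor F U pnt u x) = (\<lambda>u\<in>smooth_maps pnt U. FMor F U pnt u y)"
    proof (rule restrict_ext)
      fix u assume u: "u \<in> smooth_maps pnt U"
      have "FMor F U pnt (pt (u undefined)) x = FMor F U pnt (pt (u undefined)) y"
        using fun_cong[OF e, of "u undefined"] smooth_pt_eq(2)[OF u] by (simp add: ev_def)
      then show "FMor F U pnt u x = FMor F U pnt u y" using smooth_pt_eq(1)[OF u] by simp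
    qed
  qed
  then show ?thesis unfolding is_concrete_def inj_on_def site_simps by simp
qed

lemma concreteD:
  "is_concrete C pnt F \<Longrightarrow> U \<in> Ob C \<Longrightarrow> x \<in> FOb F U \<Longrightarrow> y \<in> FOb F U \<Longrightarrow> ev F U x = ev F U y \<Longrightarrow> x = y"
  unfolding concrete_iff inj_on_def by blast

text \<open>Choose sections over the members that represent the restrictions of \<open>s\<close>. By
  concreteness they match as soon as their maps of points do, and these are all restrictions of
  \<open>s\<close>. The amalgamation then has \<open>s\<close> as its map of points.\<close>

lemma good_sheaf_glue:
  assumes F: "psh F" and sheaf: "is_sheaf C (j_good C) F" and conc: "is_concrete C pnt F"
    and M: "M \<in> Ob C" and g: "good_open_cover M \<U>" and s: "s \<in> points M \<rightarrow>\<^sub>E FOb F pnt"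
    and loc: "\<And>U. U \<in> \<U> \<Longrightarrow> restrict s U \<in> ev F (open_submanifold M U) ` FOb F (open_submanifold M U)"
  shows "s \<in> ev F M ` FOb F M"
proof -
  let ?R = "inclusions M \<U>"
  \<comment> \<open>Concreteness leaves only one candidate for each member, but a choice operator
    avoids having to say so.\<close>
  define x where "x = (\<lambda>p :: 'm mfd \<times> ('m \<Rightarrow> 'm). SOME y. y \<in> FOb F (fst p) \<and> ev F (fst p) y = restrict s (points (fst p)))"
  note U = good_cover_Cart[OF M g]
  have x: "x (N, r) \<in> FOb F N" "ev F N (x (N, r)) = restrict s (points N)" "N \<in> Ob C"
    "r = (\<lambda>x\<in>points N. x)" "r \<in> smooth_maps N M" if Nr: "(N, r) \<in> ?R" for N r
  proof -
    obtain W where W: "W \<in> \<U>" "N = open_submanifold M W" "r = (\<lambda>x\<in>W. x)" using Nr by (auto simp: inclusions_def)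
    have p: "points N = W" unfolding W(2) by (rule points_open_submanifold[OF U(1)[OF W(1)]])
    have "restrict s (points N) \<in> ev F N ` FOb F N" using loc[OF W(1)] p W(2) by simp
    then obtain y where "y \<in> FOb F N \<and> ev F N y = restrict s (points N)" by auto
    then have "x (N, r) \<in> FOb F N \<and> ev F N (x (N, r)) = restrict s (points N)"
      unfolding x_def fst_conv by (rule someI)
    then show "x (N, r) \<in> FOb F N" "ev F N (x (N, r)) = restrict s (points N)" by auto
    show "N \<in> Ob C" using U(2)[OF W(1)] Cart_sub W(2) by blast
    show "r = (\<lambda>x\<in>points N. x)" using p W(3) by simp
    show "r \<in> smooth_maps N M" unfolding W(2,3) by (rule smooth_maps_inclusion[OF site_Ob(1)[OF M] U(1)[OF W(1)]])
  qed
  have res: "ev F W (FMor F N W f (x (N, r))) = compose (points W) s (compose (points W) r f)"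
    if Nr: "(N, r) \<in> ?R" and W: "W \<in> Ob C" "f \<in> smooth_maps W N" for N r W f
  proof -
    have "ev F W (FMor F N W f (x (N, r))) = compose (points W) (restrict s (points N)) f"
      by (simp only: ev_Mor[OF F x(3)[OF Nr] W x(1)[OF Nr]] x(2)[OF Nr])
    also have "\<dots> = compose (points W) s (compose (points W) r f)"
      using smooth_mapsD(2)[OF W(2)] by (subst x(4)[OF Nr]) (auto simp: compose_def fun_eq_iff)
    finally show ?thesis .
  qed
  have B: "FMor F N W f (x (N, r)) = FMor F N' W g (x (N', r'))"
    if Nr: "(N, r) \<in> ?R" "(N', r') \<in> ?R" and W: "W \<in> Ob C" "f \<in> smooth_maps W N" "g \<in> smooth_maps W N'"
      and eq: "compose (points W) r f = compose (points W) r' g" for N r N' r' W f g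
  proof (rule concreteD[OF conc W(1)])
    show "FMor F N W f (x (N, r)) \<in> FOb F W" "FMor F N' W g (x (N', r')) \<in> FOb F W"
      using psh_Mor[OF F x(3)[OF Nr(1)] W(1,2)] psh_Mor[OF F x(3)[OF Nr(2)] W(1,3)] x(1)[OF Nr(1)] x(1)[OF Nr(2)]
      by blast+
    show "ev F W (FMor F N W f (x (N, r))) = ev F W (FMor F N' W g (x (N', r')))"
      unfolding res[OF Nr(1) W(1,2)] res[OF Nr(2) W(1,3)] eq ..
  qed
  have "matching_family C F M ?R x"
    unfolding matching_family_def site_simps
  proof (intro conjI)
    show "\<forall>(V, r)\<in>?R. x (V, r) \<in> FOb F V" by clarify (rule x(1))
    show "\<forall>(V, r)\<in>?R. \<forall>(V', r')\<in>?R. \<forall>W\<in>Ob C. \<forall>f\<in>smooth_maps W V. \<forall>g\<in>smooth_maps W V'.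
        compose (points W) r f = compose (points W) r' g \<longrightarrow>
        FMor F V W f (x (V, r)) = FMor F V' W g (x (V', r'))"
      by clarify (rule B; assumption)
  qed
  moreover have "?R \<in> j_good C M"
    unfolding j_good_def using g U(2) Cart_sub by blast
  then have "sheaf_on_family C F M ?R" using sheaf M unfolding is_sheaf_def by blast
  ultimately obtain y where y: "y \<in> FOb F M" "\<And>N r. (N, r) \<in> ?R \<Longrightarrow> FMor F M N r y = x (N, r)"
    unfolding sheaf_on_family_def by blast
  have "ev F M y = s"
  proof
    fix u show "ev F M y u = s u"
    proof (cases "u \<in> points M")
      case True
      then obtain W where W: "W \<in> \<U>" "u \<in> W" using good_open_coverD(3)[OF g] by blast
      let ?N = "open_submanifold M W" and ?r = "\<lambda>x\<in>W. x"
      have Nr: "(?N, ?r) \<in> ?R" using W(1) by (auto simp: inclusions_def)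
      have p: "points ?N = W" by (rule points_open_submanifold[OF U(1)[OF W(1)]])
      have "ev F ?N (FMor F M ?N ?r y) u = compose W (ev F M y) ?r u"
        using ev_Mor[OF F M x(3)[OF Nr] x(5)[OF Nr] y(1)] p by simp
      then show ?thesis using True W(2) x(2)[OF Nr] y(2)[OF Nr] p by (simp add: compose_def)
    next
      case False
      then show ?thesis using s by (auto simp: ev_def PiE_iff extensional_def)
    qed
  qed
  then show ?thesis using y(1) by blast
qed

section \<open>The comparison functor and its full faithfulness\<close>

definition K :: "(('m mfd, 'm \<Rightarrow> 'm) category \<Rightarrow> 'm mfd \<Rightarrow> ('m mfd \<times> ('m \<Rightarrow> 'm)) set set) \<Rightarrow>
    (('m mfd, 'm \<Rightarrow> 'm, 'u) presheaf, 'm mfd \<Rightarrow> 'u \<Rightarrow> 'u,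
     'u set \<times> ('m mfd \<Rightarrow> ('m \<Rightarrow> 'u) set), 'u \<Rightarrow> 'u) functor_data" where
  "K j = \<lparr>FOb = (\<lambda>F\<in>Ob (ConSh \<S> C (j C)). (FOb F pnt, \<lambda>V\<in>Ob (Cart \<P>). ev F V ` FOb F V)),
     FMor = (\<lambda>F G \<eta>. if F \<in> Ob (ConSh \<S> C (j C)) \<and> G \<in> Ob (ConSh \<S> C (j C)) \<and>
       \<eta> \<in> Hom (ConSh \<S> C (j C)) F G then \<eta> pnt else undefined)\<rparr>"

lemma ConSh_simps:
  "F \<in> Ob (ConSh \<S> C J) \<longleftrightarrow> psh F \<and> is_sheaf C J F \<and> is_concrete C pnt F"
  "Hom (ConSh \<S> C J) = nat_trans (opposite C) (Set_cat \<S>)"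
  "Id (ConSh \<S> C J) F = (\<lambda>A\<in>Ob C. \<lambda>x\<in>FOb F A. x)"
  "Comp (ConSh \<S> C J) F G H \<theta> \<eta> = (\<lambda>A\<in>Ob C. compose (FOb F A) (\<theta> A) (\<eta> A))"
  by (auto simp: ConSh_def full_subcategory_def PSh_def functor_category_def Set_simps opp_simps)

text \<open>Good covers are among the open covers, so for both choices of \<open>j\<close> the sheaf
  condition on good covers is available. Everything about a given sheaf is derived from this weaker
  condition.\<close>

lemma ConSh_good_sheaf:
  assumes "j \<in> {j_open, j_good}" "F \<in> Ob (ConSh \<S> C (j C))"
  shows "psh F" "is_sheaf C (j_good C) F" "is_concrete C pnt F"
proof -
  show "psh F" "is_concrete C pnt F" using assms ConSh_simps(1) by blast+
  have "j_good C M \<subseteq> j_open C M" for M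
    unfolding j_good_def j_open_def using good_open_coverD(1) by blast
  moreover have "is_sheaf C (j C) F" using assms ConSh_simps(1) by blast
  ultimately show "is_sheaf C (j_good C) F" using assms(1) unfolding is_sheaf_def by blast
qed

text \<open>Closure under composition with smooth maps is \<open>ev_Mor\<close>, the clause on the
  one-point manifold is \<open>ev_pnt\<close>, and locality is \<open>good_sheaf_glue\<close> over a
  cartesian space.\<close>

lemma K_Ob_Diff:
  assumes j: "j \<in> {j_open, j_good}" and F: "F \<in> Ob (ConSh \<S> C (j C))"
  shows "diffeology \<P> \<S> (FOb F pnt) (\<lambda>V\<in>Ob (Cart \<P>). ev F V ` FOb F V)"
proof -
  note P = ConSh_good_sheaf[OF j F]
  have 1: "ev F V ` FOb F V \<subseteq> points V \<rightarrow>\<^sub>E FOb F pnt" if "V \<in> Ob (Cart \<P>)" for V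
    using ev_PiE[OF P(1) Cart_sub[OF that]] by blast
  have 2: "({undefined} \<rightarrow>\<^sub>E FOb F pnt) \<subseteq> ev F pnt ` FOb F pnt"
  proof
    fix s :: "'m \<Rightarrow> 'u" assume s: "s \<in> {undefined} \<rightarrow>\<^sub>E FOb F pnt"
    then have "s = pt (s undefined)" by (auto simp: pt_def fun_eq_iff PiE_iff extensional_def)
    moreover have "s undefined \<in> FOb F pnt" using s by auto
    ultimately show "s \<in> ev F pnt ` FOb F pnt" using ev_pnt[OF P(1)] by (metis image_eqI)
  qed
  have 3: "compose (points V) s \<phi> \<in> ev F V ` FOb F V"
    if VW: "V \<in> Ob (Cart \<P>)" "W \<in> Ob (Cart \<P>)" "\<phi> \<in> smooth_maps V W" "s \<in> ev F W ` FOb F W" for V W \<phi> s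
  proof -
    obtain x where x: "x \<in> FOb F W" "s = ev F W x" using VW(4) by blast
    have "compose (points V) s \<phi> = ev F V (FMor F W V \<phi> x)"
      using ev_Mor[OF P(1) Cart_sub[OF VW(2)] Cart_sub[OF VW(1)] VW(3) x(1)] x(2) by simp
    moreover have "FMor F W V \<phi> x \<in> FOb F V"
      using psh_Mor[OF P(1) Cart_sub[OF VW(2)] Cart_sub[OF VW(1)] VW(3)] x(1) by blast
    ultimately show ?thesis by blast
  qed
  have 4: "s \<in> ev F V ` FOb F V"
    if V: "V \<in> Ob (Cart \<P>)" and g: "good_open_cover V \<U>" and s: "s \<in> points V \<rightarrow>\<^sub>E FOb F pnt"
      and l: "\<forall>U\<in>\<U>. restrict s U \<in> (\<lambda>V\<in>Ob (Cart \<P>). ev F V ` FOb F V) (open_submanifold V U)" for V \<U> s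
    by (rule good_sheaf_glue[OF P Cart_sub[OF V] g s])
      (use l good_cover_Cart(2)[OF Cart_sub[OF V] g] in auto)
  show ?thesis
    unfolding diffeology_def using psh_Ob[OF P(1) pnt_Ob(1)] 1 2 3 4 pnt_Ob(2) by simp
qed

lemma nat_transD:
  assumes "\<eta> \<in> nat_trans (opposite C) (Set_cat \<S>) F G"
  shows "\<eta> \<in> extensional (Ob C)" "\<And>M. M \<in> Ob C \<Longrightarrow> \<eta> M \<in> FOb F M \<rightarrow>\<^sub>E FOb G M"
    "\<And>U V f x. U \<in> Ob C \<Longrightarrow> V \<in> Ob C \<Longrightarrow> f \<in> smooth_maps V U \<Longrightarrow> x \<in> FOb F U \<Longrightarrow>
       \<eta> V (FMor F U V f x) = FMor G U V f (\<eta> U x)"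
proof -
  show "\<eta> \<in> extensional (Ob C)" "\<And>M. M \<in> Ob C \<Longrightarrow> \<eta> M \<in> FOb F M \<rightarrow>\<^sub>E FOb G M"
    using assms by (auto simp: nat_trans_def opp_simps Set_simps)
  fix U V f x assume a: "U \<in> Ob C" "V \<in> Ob C" "f \<in> smooth_maps V U" "x \<in> FOb F U"
  then have "compose (FOb F U) (\<eta> V) (FMor F U V f) = compose (FOb F U) (FMor G U V f) (\<eta> U)"
    using assms by (simp add: nat_trans_def opp_simps Set_simps)
  from fun_cong[OF this, of x] show "\<eta> V (FMor F U V f x) = FMor G U V f (\<eta> U x)"
    using a(4) by (simp add: compose_def)
qed

text \<open>Naturality with respect to the morphisms \<open>pt u\<close>. It shows that on maps of
  points a natural transformation acts by composition with its component at the one-point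
  manifold.\<close>

lemma ev_nat_trans:
  assumes \<eta>: "\<eta> \<in> nat_trans (opposite C) (Set_cat \<S>) F G" and F: "psh F"
    and M: "M \<in> Ob C" and x: "x \<in> FOb F M"
  shows "ev G M (\<eta> M x) = compose (points M) (\<eta> pnt) (ev F M x)"
  using nat_transD(3)[OF \<eta> M pnt_Ob(1) smooth_pt[OF M] x] by (auto simp: ev_def compose_def fun_eq_iff)

lemma is_functor_K:
  assumes j: "j \<in> {j_open, j_good}"
  shows "is_functor (ConSh \<S> C (j C)) (Diff \<P> \<S>) (K j)"
proof -
  let ?E = "ConSh \<S> C (j C)"
  have cat: "is_category ?E" by (rule is_category_ConSh)
  have 1: "\<eta> pnt \<in> {h \<in> FOb F pnt \<rightarrow>\<^sub>E FOb G pnt. \<forall>V\<in>Ob (Cart \<P>). \<forall>s\<in>ev F V ` FOb F V. compose (points V) h s \<in> ev G V ` FOb G V}"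
    if F: "F \<in> Ob ?E" and \<eta>: "\<eta> \<in> Hom ?E F G" for F G \<eta>
  proof -
    have n: "\<eta> \<in> nat_trans (opposite C) (Set_cat \<S>) F G" using \<eta> by (simp add: ConSh_simps)
    have "psh F" using F by (simp add: ConSh_simps)
    have "compose (points V) (\<eta> pnt) (ev F V x) \<in> ev G V ` FOb G V" if V: "V \<in> Ob (Cart \<P>)" and x: "x \<in> FOb F V" for V x
      using ev_nat_trans[OF n \<open>psh F\<close> Cart_sub[OF V] x] nat_transD(2)[OF n Cart_sub[OF V]] x by (metis PiE_mem image_eqI)
    then show ?thesis using nat_transD(2)[OF n pnt_Ob(1)] by blast
  qed
  show ?thesis
    unfolding is_functor_def
  proof (intro conjI ballI allI impI)
    show "FOb (K j) \<in> extensional (Ob ?E)" by (simp add: K_def)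
    show "FMor (K j) F G \<eta> = undefined" if "\<not> (F \<in> Ob ?E \<and> G \<in> Ob ?E \<and> \<eta> \<in> Hom ?E F G)" for F G \<eta>
      using that by (auto simp: K_def)
    show "FOb (K j) F \<in> Ob (Diff \<P> \<S>)" if "F \<in> Ob ?E" for F
      using K_Ob_Diff[OF j that] that by (simp add: K_def Diff_def)
    show "FMor (K j) F G \<eta> \<in> Hom (Diff \<P> \<S>) (FOb (K j) F) (FOb (K j) G)"
      if "F \<in> Ob ?E" "G \<in> Ob ?E" "\<eta> \<in> Hom ?E F G" for F G \<eta>
      using 1[OF that(1,3)] that by (simp add: K_def Diff_def)
    show "FMor (K j) F F (Id ?E F) = Id (Diff \<P> \<S>) (FOb (K j) F)" if F: "F \<in> Ob ?E" for F
      using F category_Id[OF cat F] pnt_Ob(1) by (simp add: K_def Diff_def ConSh_simps(3))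
    show "FMor (K j) F H (Comp ?E F G H \<theta> \<eta>) =
        Comp (Diff \<P> \<S>) (FOb (K j) F) (FOb (K j) G) (FOb (K j) H) (FMor (K j) G H \<theta>) (FMor (K j) F G \<eta>)"
      if "F \<in> Ob ?E" "G \<in> Ob ?E" "H \<in> Ob ?E" "\<eta> \<in> Hom ?E F G" "\<theta> \<in> Hom ?E G H" for F G H \<eta> \<theta>
      using that category_Comp[OF cat that] pnt_Ob(1) by (simp add: K_def Diff_def ConSh_simps(4))
  qed
qed

lemma exists_good_cover: "M \<in> Ob C \<Longrightarrow> \<exists>\<U>. good_open_cover M \<U>"
proof -
  assume M: "M \<in> Ob C"
  have "open_cover M {points M}" by (simp add: open_cover_def)
  then show ?thesis by (rule good_open_cover_refinement[OF site_Ob(1)[OF M]]) blast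
qed

text \<open>By \<open>ev_nat_trans\<close> the component at the one-point manifold determines the
  map of points of \<open>\<eta> M x\<close>, and by concreteness of \<open>G\<close> this
  determines the section.\<close>

lemma K_faithful:
  assumes G: "psh F" "is_concrete C pnt G"
    and \<eta>: "\<eta> \<in> nat_trans (opposite C) (Set_cat \<S>) F G" and \<theta>: "\<theta> \<in> nat_trans (opposite C) (Set_cat \<S>) F G"
    and eq: "\<eta> pnt = \<theta> pnt"
  shows "\<eta> = \<theta>"
proof (rule extensionalityI[OF nat_transD(1)[OF \<eta>] nat_transD(1)[OF \<theta>]])
  fix M assume M: "M \<in> Ob C"
  note e = nat_transD(2)[OF \<eta> M] nat_transD(2)[OF \<theta> M]
  show "\<eta> M = \<theta> M"
  proof (rule PiE_ext[OF e])
    fix x assume x: "x \<in> FOb F M"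
    show "\<eta> M x = \<theta> M x"
    proof (rule concreteD[OF G(2) M])
      show "\<eta> M x \<in> FOb G M" "\<theta> M x \<in> FOb G M" using e x by blast+
      show "ev G M (\<eta> M x) = ev G M (\<theta> M x)"
        unfolding ev_nat_trans[OF \<eta> G(1) M x] ev_nat_trans[OF \<theta> G(1) M x] eq ..
    qed
  qed
qed

text \<open>The assumption only concerns cartesian spaces. For an arbitrary \<open>M\<close>, a good
  cover reduces to this case and \<open>good_sheaf_glue\<close> produces the section of
  \<open>G\<close> over \<open>M\<close>. Concreteness makes it unique, which gives
  naturality.\<close>

lemma K_full:
  assumes F: "psh F" and G: "psh G" "is_sheaf C (j_good C) G" "is_concrete C pnt G"
    and h: "h \<in> FOb F pnt \<rightarrow>\<^sub>E FOb G pnt"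
    and plots: "\<And>V x. V \<in> Ob (Cart \<P>) \<Longrightarrow> x \<in> FOb F V \<Longrightarrow> compose (points V) h (ev F V x) \<in> ev G V ` FOb G V"
  shows "\<exists>\<eta>\<in>nat_trans (opposite C) (Set_cat \<S>) F G. \<eta> pnt = h"
proof -
  have ex: "compose (points M) h (ev F M x) \<in> ev G M ` FOb G M" if M: "M \<in> Ob C" and x: "x \<in> FOb F M" for M x
  proof -
    obtain \<U> where g: "good_open_cover M \<U>" using exists_good_cover[OF M] by blast
    note evx = ev_PiE[OF F M x]
    show ?thesis
    proof (rule good_sheaf_glue[OF G M g])
      show "compose (points M) h (ev F M x) \<in> points M \<rightarrow>\<^sub>E FOb G pnt"
        using evx h by (auto simp: compose_def PiE_iff)
      fix U assume U: "U \<in> \<U>"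
      let ?N = "open_submanifold M U" and ?r = "\<lambda>x\<in>U. x"
      note N = good_cover_Cart[OF M g U]
      have p: "points ?N = U" by (rule points_open_submanifold[OF N(1)])
      have r: "?r \<in> smooth_maps ?N M" by (rule smooth_maps_inclusion[OF site_Ob(1)[OF M] N(1)])
      have UM: "U \<subseteq> points M" by (rule openin_subset[OF N(1)])
      have "FMor F M ?N ?r x \<in> FOb F ?N" using psh_Mor[OF F M Cart_sub[OF N(2)] r] x by blast
      from plots[OF N(2) this] have "compose U h (compose U (ev F M x) ?r) \<in> ev G ?N ` FOb G ?N"
        unfolding ev_Mor[OF F M Cart_sub[OF N(2)] r x] p .
      moreover have "compose U h (compose U (ev F M x) ?r) = restrict (compose (points M) h (ev F M x)) U"
        using UM by (auto simp: compose_def fun_eq_iff)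
      ultimately show "restrict (compose (points M) h (ev F M x)) U \<in> ev G ?N ` FOb G ?N" by simp
    qed
  qed
  define \<eta> where "\<eta> = (\<lambda>M\<in>Ob C. \<lambda>x\<in>FOb F M. inv_into (FOb G M) (ev G M) (compose (points M) h (ev F M x)))"
  have \<eta>: "\<eta> M x \<in> FOb G M" "ev G M (\<eta> M x) = compose (points M) h (ev F M x)"
    if "M \<in> Ob C" "x \<in> FOb F M" for M x
    using ex[OF that] that by (auto simp: \<eta>_def inv_into_into f_inv_into_f)
  have ext: "\<eta> M \<in> extensional (FOb F M)" if "M \<in> Ob C" for M using that by (simp add: \<eta>_def)
  have PiE: "\<eta> M \<in> FOb F M \<rightarrow>\<^sub>E FOb G M" if "M \<in> Ob C" for M
    using \<eta>(1)[OF that] ext[OF that] by (auto simp: PiE_iff)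
  have nat: "\<eta> V (FMor F U V f x) = FMor G U V f (\<eta> U x)"
    if U: "U \<in> Ob C" and V: "V \<in> Ob C" and f: "f \<in> smooth_maps V U" and x: "x \<in> FOb F U" for U V f x
  proof (rule concreteD[OF G(3) V])
    have fx: "FMor F U V f x \<in> FOb F V" using psh_Mor[OF F U V f] x by blast
    show "\<eta> V (FMor F U V f x) \<in> FOb G V" by (rule \<eta>(1)[OF V fx])
    show "FMor G U V f (\<eta> U x) \<in> FOb G V" using psh_Mor[OF G(1) U V f] \<eta>(1)[OF U x] by blast
    show "ev G V (\<eta> V (FMor F U V f x)) = ev G V (FMor G U V f (\<eta> U x))"
      unfolding \<eta>(2)[OF V fx] ev_Mor[OF F U V f x] ev_Mor[OF G(1) U V f \<eta>(1)[OF U x]] \<eta>(2)[OF U x]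
      by (rule compose_assoc_on) (rule smooth_mapsD(2)[OF f])
  qed
  have "\<eta> \<in> nat_trans (opposite C) (Set_cat \<S>) F G"
    unfolding nat_trans_def opp_simps Set_simps
  proof (intro CollectI conjI ballI)
    show "\<eta> \<in> extensional (Ob C)" by (simp add: \<eta>_def)
    show "\<eta> M \<in> FOb F M \<rightarrow>\<^sub>E FOb G M" if "M \<in> Ob C" for M by (rule PiE[OF that])
    show "compose (FOb F U) (\<eta> V) (FMor F U V f) = compose (FOb F U) (FMor G U V f) (\<eta> U)"
      if "U \<in> Ob C" "V \<in> Ob C" "f \<in> smooth_maps V U" for U V f
      using nat[OF that] by (auto simp: compose_def fun_eq_iff)
  qed
  moreover have "\<eta> pnt = h"
  proof (rule PiE_ext[OF PiE[OF pnt_Ob(1)] h])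
    fix x assume x: "x \<in> FOb F pnt"
    have "pt (\<eta> pnt x) = compose {undefined} h (pt x :: 'm \<Rightarrow> 'u)"
      using \<eta>(2)[OF pnt_Ob(1) x] ev_pnt[OF F x] ev_pnt[OF G(1) \<eta>(1)[OF pnt_Ob(1) x]] by simp
    from fun_cong[OF this, of undefined] show "\<eta> pnt x = h x" by (simp add: compose_def)
  qed
  ultimately show ?thesis by blast
qed

lemma fully_faithful_K:
  assumes j: "j \<in> {j_open, j_good}"
  shows "fully_faithful (ConSh \<S> C (j C)) (Diff \<P> \<S>) (K j)"
  unfolding fully_faithful_def
proof (intro conjI ballI is_functor_K[OF j])
  let ?E = "ConSh \<S> C (j C)"
  fix F G assume F: "F \<in> Ob ?E" and G: "G \<in> Ob ?E"
  note FD = ConSh_good_sheaf[OF j F] and GD = ConSh_good_sheaf[OF j G]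
  have K: "FMor (K j) F G \<eta> = \<eta> pnt" if "\<eta> \<in> Hom ?E F G" for \<eta> using F G that by (simp add: K_def)
  show "bij_betw (FMor (K j) F G) (Hom ?E F G) (Hom (Diff \<P> \<S>) (FOb (K j) F) (FOb (K j) G))"
    unfolding bij_betw_def
  proof (intro conjI equalityI subsetI)
    show "inj_on (FMor (K j) F G) (Hom ?E F G)"
    proof (rule inj_onI)
      fix \<eta> \<theta> assume a: "\<eta> \<in> Hom ?E F G" "\<theta> \<in> Hom ?E F G" "FMor (K j) F G \<eta> = FMor (K j) F G \<theta>"
      then have "\<eta> pnt = \<theta> pnt" using K by simp
      then show "\<eta> = \<theta>" using K_faithful[OF FD(1) GD(3)] a(1,2) unfolding ConSh_simps(2) by blast
    qed
    show "h \<in> Hom (Diff \<P> \<S>) (FOb (K j) F) (FOb (K j) G)" if "h \<in> FMor (K j) F G ` Hom ?E F G" for h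
      using that functor_Hom[OF is_functor_K[OF j] F G] by blast
    fix h assume "h \<in> Hom (Diff \<P> \<S>) (FOb (K j) F) (FOb (K j) G)"
    then have h: "h \<in> FOb F pnt \<rightarrow>\<^sub>E FOb G pnt"
      "\<And>V x. V \<in> Ob (Cart \<P>) \<Longrightarrow> x \<in> FOb F V \<Longrightarrow> compose (points V) h (ev F V x) \<in> ev G V ` FOb G V"
      using F G by (auto simp: K_def Diff_def)
    obtain \<eta> where "\<eta> \<in> nat_trans (opposite C) (Set_cat \<S>) F G" "\<eta> pnt = h"
      using K_full[OF FD(1) GD h] by blast
    then show "h \<in> FMor (K j) F G ` Hom ?E F G"
      using K[of \<eta>] by (intro image_eqI[of _ _ \<eta>]) (simp_all add: ConSh_simps(2))
  qed
qed

section \<open>Reconstruction of a sheaf from a diffeology\<close>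

definition plots :: "'u set \<Rightarrow> ('m mfd \<Rightarrow> ('m \<Rightarrow> 'u) set) \<Rightarrow> 'm mfd \<Rightarrow> ('m \<Rightarrow> 'u) set" where
  "plots A D M = {s \<in> points M \<rightarrow>\<^sub>E A. \<forall>V\<in>Ob (Cart \<P>). \<forall>\<phi>\<in>smooth_maps V M. compose (points V) s \<phi> \<in> D V}"

text \<open>Sections have to be elements of \<open>'u\<close>, so maps are encoded by a chosen injection. On the one-point
  manifold it is evaluation, so that the set of points of the sheaf is \<open>A\<close> itself.\<close>

definition enc :: "'u set \<Rightarrow> 'm mfd \<Rightarrow> ('m \<Rightarrow> 'u) \<Rightarrow> 'u" where
  "enc A M = (if M = pnt then (\<lambda>s. s undefined)
     else (SOME e. inj_on e (points M \<rightarrow>\<^sub>E A) \<and> (\<exists>B\<in>\<S>. e ` (points M \<rightarrow>\<^sub>E A) \<subseteq> B)))"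

definition dec :: "'u set \<Rightarrow> 'm mfd \<Rightarrow> 'u \<Rightarrow> 'm \<Rightarrow> 'u" where
  "dec A M = inv_into (points M \<rightarrow>\<^sub>E A) (enc A M)"

text \<open>Up to the encoding of maps as elements of \<open>'u\<close>, this is the right Kan
  extension of \<open>D\<close> along the inclusion of cartesian spaces: a compatible family indexed
  by all smooth maps from cartesian spaces to \<open>M\<close> amounts to one map on the points of
  \<open>M\<close>.\<close>

definition diff_sheaf :: "'u set \<Rightarrow> ('m mfd \<Rightarrow> ('m \<Rightarrow> 'u) set) \<Rightarrow> ('m mfd, 'm \<Rightarrow> 'm, 'u) presheaf" where
  "diff_sheaf A D = \<lparr>FOb = (\<lambda>M\<in>Ob C. enc A M ` plots A D M),
     FMor = (\<lambda>U V f. if U \<in> Ob C \<and> V \<in> Ob C \<and> f \<in> smooth_maps V U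
       then (\<lambda>x\<in>enc A U ` plots A D U. enc A V (compose (points V) (dec A U x) f)) else undefined)\<rparr>"

lemma enc:
  assumes M: "M \<in> Ob C" and A: "A \<in> \<S>"
  shows "inj_on (enc A M) (points M \<rightarrow>\<^sub>E A)" "\<exists>B\<in>\<S>. enc A M ` (points M \<rightarrow>\<^sub>E A) \<subseteq> B"
proof -
  have "inj_on (enc A M) (points M \<rightarrow>\<^sub>E A) \<and> (\<exists>B\<in>\<S>. enc A M ` (points M \<rightarrow>\<^sub>E A) \<subseteq> B)"
  proof (cases "M = pnt")
    case True
    have "inj_on (\<lambda>s. s undefined) ({undefined} \<rightarrow>\<^sub>E A)"
      by (rule inj_onI) (auto intro: PiE_ext)
    moreover have "(\<lambda>s. s undefined) ` ({undefined} \<rightarrow>\<^sub>E A) \<subseteq> A" by auto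
    ultimately show ?thesis using True A unfolding enc_def by auto
  next
    case False
    have "\<forall>X\<in>\<P>. \<forall>A\<in>\<S>. \<exists>B\<in>\<S>. (X \<rightarrow>\<^sub>E A) \<lesssim> B" using size unfolding size_conventions_def by (elim conjE)
    \<comment> \<open>Here the requirement is used that the maps from a small set of points to a
      small set fit into a small set.\<close>
    then obtain B where B: "B \<in> \<S>" "(points M \<rightarrow>\<^sub>E A) \<lesssim> B" using site_Ob(2)[OF M] A by blast
    then have "\<exists>e. inj_on e (points M \<rightarrow>\<^sub>E A) \<and> (\<exists>B\<in>\<S>. e ` (points M \<rightarrow>\<^sub>E A) \<subseteq> B)"
      unfolding lepoll_def by blast
    from someI_ex[OF this] show ?thesis using False unfolding enc_def by simp
  qed
  then show "inj_on (enc A M) (points M \<rightarrow>\<^sub>E A)" "\<exists>B\<in>\<S>. enc A M ` (points M \<rightarrow>\<^sub>E A) \<subseteq> B" by blast+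
qed

lemma small_image:
  assumes "B \<in> \<S>" "X \<subseteq> B" shows "X \<in> \<S>"
  using size assms subset_imp_lepoll unfolding size_conventions_def by blast

context
  fixes A D assumes AD: "diffeology \<P> \<S> A D"
begin

lemma
  shows A: "A \<in> \<S>" and D_ext: "D \<in> extensional (Ob (Cart \<P>))"
    and D_PiE: "\<And>V. V \<in> Ob (Cart \<P>) \<Longrightarrow> D V \<subseteq> points V \<rightarrow>\<^sub>E A"
    and D_pnt: "({undefined} \<rightarrow>\<^sub>E A) \<subseteq> D pnt"
    and D_compose: "\<And>V W \<phi> s. V \<in> Ob (Cart \<P>) \<Longrightarrow> W \<in> Ob (Cart \<P>) \<Longrightarrow> \<phi> \<in> smooth_maps V W \<Longrightarrow> s \<in> D W \<Longrightarrow>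
      compose (points V) s \<phi> \<in> D V"
    and D_local: "\<And>V \<U> s. V \<in> Ob (Cart \<P>) \<Longrightarrow> good_open_cover V \<U> \<Longrightarrow> s \<in> points V \<rightarrow>\<^sub>E A \<Longrightarrow>
      (\<And>U. U \<in> \<U> \<Longrightarrow> restrict s U \<in> D (open_submanifold V U)) \<Longrightarrow> s \<in> D V"
  using AD unfolding diffeology_def by simp_all

abbreviation F where "F \<equiv> diff_sheaf A D"

lemma plotsD: "s \<in> plots A D M \<Longrightarrow> s \<in> points M \<rightarrow>\<^sub>E A"
  by (simp add: plots_def)

lemma dec_enc: "M \<in> Ob C \<Longrightarrow> s \<in> plots A D M \<Longrightarrow> dec A M (enc A M s) = s"
  unfolding dec_def using enc(1)[OF _ A] plotsD by simp

lemma plots_compose: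
  assumes "U \<in> Ob C" "V \<in> Ob C" "f \<in> smooth_maps V U" "s \<in> plots A D U"
  shows "compose (points V) s f \<in> plots A D V"
  unfolding plots_def
proof (intro CollectI conjI ballI)
  note f = smooth_mapsD(2)[OF assms(3)]
  show "compose (points V) s f \<in> points V \<rightarrow>\<^sub>E A"
    using f plotsD[OF assms(4)] by (auto simp: compose_def PiE_iff)
  fix W \<phi> assume W: "W \<in> Ob (Cart \<P>)" and \<phi>: "\<phi> \<in> smooth_maps W V"
  have "compose (points W) (compose (points V) s f) \<phi> = compose (points W) s (compose (points W) f \<phi>)"
    using compose_assoc_on[of "points W" \<phi> "points V" s f] smooth_mapsD(2)[OF \<phi>] by simp
  moreover have "compose (points W) f \<phi> \<in> smooth_maps W U"
    by (rule smooth_compose[OF Cart_sub[OF W] assms(2,1) \<phi> assms(3)])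
  ultimately show "compose (points W) (compose (points V) s f) \<phi> \<in> D W"
    using assms(4) W unfolding plots_def by simp
qed

lemma FOb_F: "M \<in> Ob C \<Longrightarrow> FOb F M = enc A M ` plots A D M" by (simp add: diff_sheaf_def)

lemma FMor_F:
  "U \<in> Ob C \<Longrightarrow> V \<in> Ob C \<Longrightarrow> f \<in> smooth_maps V U \<Longrightarrow> s \<in> plots A D U \<Longrightarrow>
   FMor F U V f (enc A U s) = enc A V (compose (points V) s f)"
  by (simp add: diff_sheaf_def dec_enc)

lemma psh_F: "psh F"
  unfolding is_functor_def opp_simps Set_simps
proof (intro conjI ballI allI impI)
  show "FOb F \<in> extensional (Ob C)" by (simp add: diff_sheaf_def)
  show "FMor F U V f = undefined" if "\<not> (U \<in> Ob C \<and> V \<in> Ob C \<and> f \<in> smooth_maps V U)" for U V f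
    using that by (auto simp: diff_sheaf_def)
  show "FOb F M \<in> \<S>" if M: "M \<in> Ob C" for M
  proof -
    obtain B where B: "B \<in> \<S>" "enc A M ` (points M \<rightarrow>\<^sub>E A) \<subseteq> B" using enc(2)[OF M A] by blast
    have "plots A D M \<subseteq> points M \<rightarrow>\<^sub>E A" by (rule subsetI) (rule plotsD)
    then have "FOb F M \<subseteq> B" unfolding FOb_F[OF M] using B(2) by (meson image_mono order_trans)
    then show ?thesis by (rule small_image[OF B(1)])
  qed
  show "FMor F U V f \<in> FOb F U \<rightarrow>\<^sub>E FOb F V"
    if U: "U \<in> Ob C" and V: "V \<in> Ob C" and f: "f \<in> smooth_maps V U" for U V f
  proof
    show "FMor F U V f x \<in> FOb F V" if x: "x \<in> FOb F U" for x
    proof -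
      obtain s where s: "s \<in> plots A D U" "x = enc A U s" using x by (auto simp: FOb_F[OF U])
      then show ?thesis using FMor_F[OF U V f s(1)] plots_compose[OF U V f s(1)] by (simp add: FOb_F[OF V])
    qed
    show "FMor F U V f x = undefined" if "x \<notin> FOb F U" for x
      using that U V f by (simp add: diff_sheaf_def)
  qed
  show "FMor F U U (\<lambda>x\<in>points U. x) = (\<lambda>x\<in>FOb F U. x)" if U: "U \<in> Ob C" for U
  proof
    fix x show "FMor F U U (\<lambda>x\<in>points U. x) x = (\<lambda>x\<in>FOb F U. x) x"
    proof (cases "x \<in> FOb F U")
      case True
      then obtain s where s: "s \<in> plots A D U" "x = enc A U s" by (auto simp: FOb_F[OF U])
      have "compose (points U) s (\<lambda>x\<in>points U. x) = s"
        using plotsD[OF s(1)] by (intro compose_ident_right) (auto simp: PiE_iff)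
      then show ?thesis using FMor_F[OF U U smooth_id[OF U] s(1)] s(2) True by simp
    next
      case False
      then show ?thesis using U smooth_id[OF U] by (simp add: diff_sheaf_def)
    qed
  qed
  show "FMor F U W (compose (points W) f g) = compose (FOb F U) (FMor F V W g) (FMor F U V f)"
    if U: "U \<in> Ob C" and V: "V \<in> Ob C" and W: "W \<in> Ob C" and f: "f \<in> smooth_maps V U" and g: "g \<in> smooth_maps W V"
    for U V W f g
  proof
    fix x
    have fg: "compose (points W) f g \<in> smooth_maps W U" by (rule smooth_compose[OF W V U g f])
    show "FMor F U W (compose (points W) f g) x = compose (FOb F U) (FMor F V W g) (FMor F U V f) x"
    proof (cases "x \<in> FOb F U")
      case True
      then obtain s where s: "s \<in> plots A D U" "x = enc A U s" by (auto simp: FOb_F[OF U])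
      have "compose (points W) (compose (points V) s f) g = compose (points W) s (compose (points W) f g)"
        using compose_assoc_on[of "points W" g "points V" s f] smooth_mapsD(2)[OF g] by simp
      then show ?thesis
        using True FMor_F[OF U W fg s(1)] FMor_F[OF U V f s(1)] FMor_F[OF V W g plots_compose[OF U V f s(1)]] s(2)
        by (simp add: compose_def)
    next
      case False
      then show ?thesis using U W fg by (simp add: diff_sheaf_def compose_def)
    qed
  qed
qed

text \<open>Restriction to a point yields an encoded map on the one-point manifold, and
  \<open>enc\<close> is evaluation there, so the value of \<open>s\<close> itself is
  recovered.\<close>

lemma ev_enc:
  assumes M: "M \<in> Ob C" and s: "s \<in> plots A D M"
  shows "ev F M (enc A M s) = s"
proof
  fix u show "ev F M (enc A M s) u = s u"
  proof (cases "u \<in> points M")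
    case True
    then show ?thesis
      using FMor_F[OF M pnt_Ob(1) smooth_pt[OF M True] s] by (simp add: ev_def enc_def compose_def)
  next
    case False
    then show ?thesis using plotsD[OF s] by (auto simp: ev_def PiE_iff extensional_def)
  qed
qed

lemma ev_FOb: "M \<in> Ob C \<Longrightarrow> ev F M ` FOb F M = plots A D M"
  using ev_enc by (auto simp: FOb_F image_image)

lemma concrete_F: "is_concrete C pnt F"
  unfolding concrete_iff using ev_enc by (auto simp: FOb_F inj_on_def)

text \<open>One inclusion tests with the identity of \<open>V\<close>, the other is closure of
  \<open>D\<close> under composition with smooth maps.\<close>

lemma plots_Cart: "V \<in> Ob (Cart \<P>) \<Longrightarrow> plots A D V = D V"
proof (intro equalityI subsetI)
  fix s assume V: "V \<in> Ob (Cart \<P>)"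
  {
    assume "s \<in> plots A D V"
    then have "compose (points V) s (\<lambda>x\<in>points V. x) \<in> D V" "s \<in> points V \<rightarrow>\<^sub>E A"
      using smooth_id[OF Cart_sub[OF V]] V by (auto simp: plots_def)
    then show "s \<in> D V" using compose_ident_right[of s "points V"] by (simp add: PiE_iff)
  next
    assume "s \<in> D V"
    then show "s \<in> plots A D V" using D_PiE[OF V] D_compose[OF _ V] by (auto simp: plots_def)
  }
qed

lemma FOb_pnt: "FOb F pnt = A"
proof -
  have "plots A D pnt = {undefined} \<rightarrow>\<^sub>E A"
    using plots_Cart[OF pnt_Ob(2)] D_pnt D_PiE[OF pnt_Ob(2)] by auto
  moreover have "a \<in> (\<lambda>s. s undefined) ` ({undefined :: 'm} \<rightarrow>\<^sub>E A)" if "a \<in> A" for a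
    using that by (intro image_eqI[of _ _ "pt a"]) (auto simp: pt_def)
  ultimately show ?thesis using FOb_F[OF pnt_Ob(1)] by (auto simp: enc_def)
qed

text \<open>Matching sections agree at points and so glue to one map \<open>s\<close>. To see that
  \<open>s\<close> is a plot, compose it with a map from a cartesian space \<open>V\<close>;
  locality of \<open>D\<close> on a good cover of \<open>V\<close> that refines the preimages of the
  given cover settles the matter. The topology \<open>j_open\<close> is treated since it has the
  larger family of covers.\<close>

lemma sheaf_F: "is_sheaf C (j_open C) F"
  unfolding is_sheaf_def
proof (intro ballI)
  fix M R assume M: "M \<in> Ob C" and "R \<in> j_open C M"
  then obtain \<U> where R: "R = inclusions M \<U>" and cov: "open_cover M \<U>"
    and UC: "\<And>U. U \<in> \<U> \<Longrightarrow> open_submanifold M U \<in> Ob C"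
    unfolding j_open_def by blast
  have Uo: "openin (space_of M) U" if "U \<in> \<U>" for U using cov that by (simp add: open_cover_def)
  have Uun: "\<Union>\<U> = points M" using cov by (simp add: open_cover_def)
  let ?N = "open_submanifold M" and ?r = "\<lambda>U. \<lambda>x\<in>U. x :: 'm"
  have p: "points (?N U) = U" if "U \<in> \<U>" for U by (rule points_open_submanifold[OF Uo[OF that]])
  have r: "?r U \<in> smooth_maps (?N U) M" if "U \<in> \<U>" for U
    by (rule smooth_maps_inclusion[OF site_Ob(1)[OF M] Uo[OF that]])
  have Rr: "(?N U, ?r U) \<in> R" if "U \<in> \<U>" for U using that by (auto simp: R inclusions_def)
  show "sheaf_on_family C F M R"
    unfolding sheaf_on_family_def
  proof (intro allI impI)
    fix x assume mf: "matching_family C F M R x"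
    define t where "t = (\<lambda>U. ev F (?N U) (x (?N U, ?r U)))"
    have xF: "x (?N U, ?r U) \<in> FOb F (?N U)" if "U \<in> \<U>" for U
      using mf Rr[OF that] unfolding matching_family_def by blast
    have t: "t U \<in> plots A D (?N U)" "x (?N U, ?r U) = enc A (?N U) (t U)" if U: "U \<in> \<U>" for U
    proof -
      obtain s where "s \<in> plots A D (?N U)" "x (?N U, ?r U) = enc A (?N U) s"
        using xF[OF U] FOb_F[OF UC[OF U]] by blast
      then show "t U \<in> plots A D (?N U)" "x (?N U, ?r U) = enc A (?N U) (t U)"
        using ev_enc[OF UC[OF U]] by (simp_all add: t_def)
    qed
    have match: "\<forall>(V, r)\<in>R. \<forall>(V', r')\<in>R. \<forall>W\<in>Ob C. \<forall>f\<in>smooth_maps W V. \<forall>g\<in>smooth_maps W V'.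
        compose (points W) r f = compose (points W) r' g \<longrightarrow>
        FMor F V W f (x (V, r)) = FMor F V' W g (x (V', r'))"
      using mf unfolding matching_family_def site_simps by (elim conjE)
    \<comment> \<open>The matching condition is applied to the two morphisms from the one-point
      manifold that name \<open>u\<close> in \<open>U\<close> and in \<open>U'\<close>.\<close>
    have agree: "t U u = t U' u" if U: "U \<in> \<U>" "u \<in> U" and U': "U' \<in> \<U>" "u \<in> U'" for U U' u
    proof -
      have s: "pt u \<in> smooth_maps pnt (?N U)" "pt u \<in> smooth_maps pnt (?N U')"
        by (rule smooth_pt[OF UC[OF U(1)], unfolded p[OF U(1)], OF U(2)],
            rule smooth_pt[OF UC[OF U'(1)], unfolded p[OF U'(1)], OF U'(2)])
      have c: "compose (points pnt) (?r U) (pt u) = compose (points pnt) (?r U') (pt u)"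
        using U(2) U'(2) by (auto simp: compose_def pt_def fun_eq_iff)
      note bspec[OF bspec[OF match Rr[OF U(1)], unfolded split] Rr[OF U'(1)], unfolded split]
      from mp[OF bspec[OF bspec[OF bspec[OF this pnt_Ob(1)] s(1)] s(2)] c]
      have "FMor F (?N U) pnt (pt u) (x (?N U, ?r U)) = FMor F (?N U') pnt (pt u) (x (?N U', ?r U'))" .
      then show ?thesis using U U' p by (simp add: t_def ev_def)
    qed
    define s where "s = (\<lambda>u\<in>points M. t (SOME U. U \<in> \<U> \<and> u \<in> U) u)"
    have s: "s u = t U u" if U: "U \<in> \<U>" "u \<in> U" for U u
    proof -
      have "(SOME U. U \<in> \<U> \<and> u \<in> U) \<in> \<U> \<and> u \<in> (SOME U. U \<in> \<U> \<and> u \<in> U)"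
        using someI[of "\<lambda>U. U \<in> \<U> \<and> u \<in> U" U] U by simp
      moreover have "u \<in> points M" using U Uun by blast
      ultimately show ?thesis using agree[OF _ _ U] by (simp add: s_def)
    qed
    have tP: "t U \<in> U \<rightarrow>\<^sub>E A" if "U \<in> \<U>" for U using plotsD[OF t(1)[OF that]] p[OF that] by simp
    have sP: "s \<in> points M \<rightarrow>\<^sub>E A"
    proof
      show "s u \<in> A" if u: "u \<in> points M" for u
      proof -
        obtain U where U: "U \<in> \<U>" "u \<in> U" using u Uun by blast
        then show ?thesis using s[OF U] tP[OF U(1)] by auto
      qed
    qed (simp add: s_def)
    have sD: "s \<in> plots A D M"
      unfolding plots_def
    proof (intro CollectI conjI ballI sP)
      fix V \<phi> assume V: "V \<in> Ob (Cart \<P>)" and \<phi>: "\<phi> \<in> smooth_maps V M"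
      note \<phi>D = smooth_mapsD[OF \<phi>]
      \<comment> \<open>The preimages under \<phi> need not be cartesian, so this open cover still
        has to be refined before locality of \<open>D\<close> can be used.\<close>
      have "open_cover V ((\<lambda>U. points V \<inter> \<phi> -` U) ` \<U>)"
        unfolding open_cover_def
      proof (intro conjI ballI)
        fix Z assume "Z \<in> (\<lambda>U. points V \<inter> \<phi> -` U) ` \<U>"
        then show "openin (space_of V) Z" using openin_Int_vimage[OF \<phi>D(3) openin_topspace Uo] by blast
      next
        show "\<Union> ((\<lambda>U. points V \<inter> \<phi> -` U) ` \<U>) = points V" using \<phi>D(2) Uun by blast
      qed
      then obtain \<G> where g: "good_open_cover V \<G>"
        "\<And>G. G \<in> \<G> \<Longrightarrow> \<exists>Z\<in>(\<lambda>U. points V \<inter> \<phi> -` U) ` \<U>. G \<subseteq> Z"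
        by (rule good_open_cover_refinement[OF site_Ob(1)[OF Cart_sub[OF V]]]) (rule that)
      show "compose (points V) s \<phi> \<in> D V"
      proof (rule D_local[OF V g(1)])
        show "compose (points V) s \<phi> \<in> points V \<rightarrow>\<^sub>E A" using sP \<phi>D(2) by (auto simp: compose_def PiE_iff)
        fix G assume G: "G \<in> \<G>"
        then obtain U where U: "U \<in> \<U>" "G \<subseteq> points V \<inter> \<phi> -` U" using g(2) by blast
        note GC = good_cover_Cart[OF Cart_sub[OF V] g(1) G]
        have pG: "points (open_submanifold V G) = G" by (rule points_open_submanifold[OF GC(1)])
        have "restrict \<phi> G \<in> smooth_maps (open_submanifold V G) (?N U)"
          by (rule smooth_maps_restrict[OF site_Ob(1)[OF Cart_sub[OF V]] site_Ob(1)[OF M] GC(1) Uo[OF U(1)] \<phi>])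
            (use U(2) in blast)
        then have "compose G (t U) (restrict \<phi> G) \<in> D (open_submanifold V G)"
          using t(1)[OF U(1)] GC(2) pG unfolding plots_def by (metis (no_types, lifting) mem_Collect_eq)
        moreover have "compose G (t U) (restrict \<phi> G) = restrict (compose (points V) s \<phi>) G"
          using U s by (auto simp: compose_def fun_eq_iff)
        ultimately show "restrict (compose (points V) s \<phi>) G \<in> D (open_submanifold V G)" by simp
      qed
    qed
    have eq: "compose U s (?r U) = t U" if U: "U \<in> \<U>" for U
      using s[OF U] tP[OF U] by (auto simp: compose_def fun_eq_iff PiE_iff extensional_def)
    show "\<exists>!y. y \<in> FOb F M \<and> (\<forall>(V, r)\<in>R. FMor F M V r y = x (V, r))"
    proof (rule ex1I[of _ "enc A M s"])
      have "FMor F M (?N U) (?r U) (enc A M s) = x (?N U, ?r U)" if U: "U \<in> \<U>" for U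
        using FMor_F[OF M UC[OF U] r[OF U] sD] eq[OF U] p[OF U] t(2)[OF U] by simp
      then show "enc A M s \<in> FOb F M \<and> (\<forall>(V, r)\<in>R. FMor F M V r (enc A M s) = x (V, r))"
        using sD FOb_F[OF M] by (auto simp: R inclusions_def)
      fix y assume y: "y \<in> FOb F M \<and> (\<forall>(V, r)\<in>R. FMor F M V r y = x (V, r))"
      then obtain s' where s': "s' \<in> plots A D M" "y = enc A M s'" using FOb_F[OF M] by blast
      \<comment> \<open>Uniqueness is checked pointwise: the restriction of \<open>y\<close> to a
        member containing \<open>u\<close> is prescribed and determines the value of
        \<open>s'\<close> at \<open>u\<close>.\<close>
      have "s' u = s u" if u: "u \<in> points M" for u
      proof -
        obtain U where U: "U \<in> \<U>" "u \<in> U" using u Uun by blast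
        have "FMor F M (?N U) (?r U) y = x (?N U, ?r U)" using y Rr[OF U(1)] by blast
        then have "ev F (?N U) (FMor F M (?N U) (?r U) y) = t U" by (simp add: t_def)
        moreover have "ev F (?N U) (FMor F M (?N U) (?r U) y) = compose U (ev F M y) (?r U)"
          using ev_Mor[OF psh_F M UC[OF U(1)] r[OF U(1)]] y p[OF U(1)] by simp
        ultimately have "compose U s' (?r U) u = t U u" using ev_enc[OF M s'(1)] s'(2) by simp
        then show ?thesis using U s[OF U] by (simp add: compose_def)
      qed
      then have "s' = s" using PiE_ext[OF plotsD[OF s'(1)] sP] by blast
      then show "y = enc A M s" using s'(2) by simp
    qed
  qed
qed

text \<open>Equality of objects, not just isomorphism, holds because the set over the one-point
  manifold is exactly \<open>A\<close> and because \<open>D\<close> is extensional, so that it is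
  determined by its values on cartesian spaces.\<close>

lemma K_F:
  assumes j: "j \<in> {j_open, j_good}"
  shows "F \<in> Ob (ConSh \<S> C (j C))" "FOb (K j) F = (A, D)"
proof -
  have "j_good C M \<subseteq> j_open C M" for M
    unfolding j_good_def j_open_def using good_open_coverD(1) by blast
  then have "is_sheaf C (j C) F" using sheaf_F j unfolding is_sheaf_def by blast
  then show F: "F \<in> Ob (ConSh \<S> C (j C))" using psh_F concrete_F by (simp add: ConSh_simps(1))
  have "(\<lambda>V\<in>Ob (Cart \<P>). ev F V ` FOb F V) = D"
  proof (rule extensionalityI[OF restrict_extensional D_ext])
    fix V assume V: "V \<in> Ob (Cart \<P>)"
    then show "(\<lambda>V\<in>Ob (Cart \<P>). ev F V ` FOb F V) V = D V" using ev_FOb[OF Cart_sub[OF V]] plots_Cart[OF V] by simp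
  qed
  then show "FOb (K j) F = (A, D)" using F FOb_pnt by (simp add: K_def)
qed

end

lemma K_surjective:
  assumes "j \<in> {j_open, j_good}" "q \<in> Ob (Diff \<P> \<S>)"
  shows "\<exists>F\<in>Ob (ConSh \<S> C (j C)). FOb (K j) F = q"
proof -
  have "diffeology \<P> \<S> (fst q) (snd q)" using assms(2) by (simp add: Diff_def)
  from K_F[OF this assms(1)] show ?thesis by auto
qed

end

theorem corollaryA17:
  fixes \<P> :: "'m set set" and \<S> :: "'u set set"
  assumes "size_conventions \<P> \<S>"
  shows "\<forall>C\<in>{Cart \<P>, Open \<P>, Man \<P>}. \<forall>D\<in>{Cart \<P>, Open \<P>, Man \<P>}.
         \<forall>j\<in>{j_open, j_good}. \<forall>k\<in>{j_open, j_good}.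
           equivalent_categories (ConSh \<S> C (j C)) (ConSh \<S> D (k D))"
proof (intro ballI)
  fix C D and j k :: "('m mfd, 'm \<Rightarrow> 'm) category \<Rightarrow> 'm mfd \<Rightarrow> ('m mfd \<times> ('m \<Rightarrow> 'm)) set set"
  assume C: "C \<in> {Cart \<P>, Open \<P>, Man \<P>}" and D: "D \<in> {Cart \<P>, Open \<P>, Man \<P>}"
    and j: "j \<in> {j_open, j_good}" and k: "k \<in> {j_open, j_good}"
  interpret C: manifold_site \<P> \<S> C using assms C by unfold_locales
  interpret D: manifold_site \<P> \<S> D using assms D by unfold_locales
  show "equivalent_categories (ConSh \<S> C (j C)) (ConSh \<S> D (k D))"
    by (rule equivalent_categories_span[OF is_category_ConSh is_category_ConSh is_category_Diff
          C.fully_faithful_K[OF j] D.fully_faithful_K[OF k] C.K_surjective[OF j] D.K_surjective[OF k]])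
qed

end
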